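(* Let $M=G/H$ be a naturally reductive homogeneous space of dimension $n$ with a homogeneous spin structure, and let $t\in\mathbb{R}$. For $n\geq 5$, the square of the Dirac operator $D^t$ acts on spinor fields $\psi$ by $$(D^t)^2\psi = \Omega_{\mathfrak g}(\psi) + \tfrac12(1-3t)\sum_{i,j,k}\langle [Z_i,Z_j]_{\mathfrak m},Z_k\rangle\, Z_i\cdot Z_j\cdot Z_k(\psi)$$ $$-\tfrac12\sum_{i<j<k<l}\langle Z_i,\ \mathrm{Jac}_{\mathfrak h}(Z_j,Z_k,Z_l)+9t^2\,\mathrm{Jac}_{\mathfrak m}(Z_j,Z_k,Z_l)\rangle\, Z_i\cdot Z_j\cdot Z_k\cdot Z_l\cdot\psi$$ $$+\tfrac18\sum_{i,j}Q_{\mathfrak h}([Z_i,Z_j],[Z_i,Z_j])\,\psi+\tfrac38 t^2\sum_{i,j}Q_{\mathfrak m}([Z_i,Z_j],[Z_i,Z_j])\,\psi .$$ For $n\leq 4$, one has $$(D^t)^2\psi = \Omega_{\mathfrak g}(\psi) + \tfrac12(1-3t)\sum_{i,j,k}\langle [Z_i,Z_j]_{\mathfrak m},Z_k\rangle\, Z_i\cdot Z_j\cdot Z_k(\psi)-\tfrac12\sum_{i<j<k<l}\langle Z_i,\mathrm{Jac}_{\mathfrak h}(Z_j,Z_k,Z_l)\rangle\, Z_i\cdot Z_j\cdot Z_k\cdot Z_l\cdot\psi$$ $$+\tfrac18\sum_{i,j}Q_{\mathfrak h}([Z_i,Z_j],[Z_i,Z_j])\,\psi+\tfrac38 t^2\sum_{i,j}Q_{\mathfrak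 m}([Z_i,Z_j],[Z_i,Z_j])\,\psi .$$
   Context: Setting. $M=G/H$ is a Riemannian homogeneous space of dimension $n$, reductive: $\mathfrak g=\mathfrak h\oplus\mathfrak m$ with $\mathrm{Ad}(H)\mathfrak m\subset\mathfrak m$; $\mathfrak m$ is identified with the tangent space at the base point and $\langle\,,\rangle$ is the inner product on $\mathfrak m$ induced by the metric. Subscripts $\mathfrak m,\mathfrak h$ denote components in $\mathfrak g=\mathfrak h\oplus\mathfrak m$. The metric is naturally reductive: $\langle[X,Y]_{\mathfrak m},Z\rangle+\langle Y,[X,Z]_{\mathfrak m}\rangle=0$ for all $X,Y,Z\in\mathfrak m$. It is assumed that $\mathfrak g=\mathfrak m+[\mathfrak m,\mathfrak m]$, and $Q$ denotes the $\mathrm{Ad}(G)$-invariant, symmetric, non-degenerate bilinear form on $\mathfrak g$ (not necessarily positive definite) with $Q(\mathfrak h,\mathfrak m)=0$ and $Q|_{\mathfrak m}=\langle\,,\rangle$. For $A,B\in\mathfrak g$ write $Q_{\mathfrak h}(A,B)=Q(A_{\mathfrak h},B_{\mathfrak h})$ and $Q_{\mathfrak m}(A,B)=\langle A_{\mathfrak m},B_{\mathfrak m}\rangle$. $Z_1,\dots,Z_n$ is an orthonormal basis of $\mathfrak m$; all sums run over $1,\dots,n$. For $X,Y,Z\in\mathfrak m$: $\mathrm{Jac}_{\mathfrak m}(X,Y,Z)=[X,[Y,Z]_{\mathfrak m}]_{\mathfrak m}+[Y,[Z,X]_{\mathfrak m}]_{\mathfrak m}+[Z,[X,Y]_{\mathfrak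 m}]_{\mathfrak m}$ and $\mathrm{Jac}_{\mathfrak h}(X,Y,Z)=[X,[Y,Z]_{\mathfrak h}]+[Y,[Z,X]_{\mathfrak h}]+[Z,[X,Y]_{\mathfrak h}]$ (which lies in $\mathfrak m$). Spinors. The Clifford algebra $\mathcal C(\mathfrak m)$ has relations $Z_i\cdot Z_j+Z_j\cdot Z_i=-2\delta_{ij}$. A homogeneous spin structure is a lift $\widetilde{\mathrm{Ad}}:H\to\mathrm{Spin}(\mathfrak m)$ of the isotropy representation $\mathrm{Ad}:H\to\mathrm{SO}(\mathfrak m)$; $\widetilde{\mathrm{ad}}:\mathfrak h\to\mathfrak{spin}(\mathfrak m)\subset\mathcal C(\mathfrak m)$ is its differential, given by $\widetilde{\mathrm{ad}}(Y)=\frac14\sum_{i,j}\langle[Y,Z_i],Z_j\rangle Z_i\cdot Z_j$; $\kappa:\mathrm{Spin}(\mathfrak m)\to\mathrm{GL}(\Delta_{\mathfrak m})$ is the spin representation. Spinor fields are smooth maps $\psi:G\to\Delta_{\mathfrak m}$ with $\psi(gh)=\kappa(\widetilde{\mathrm{Ad}}(h^{-1}))\psi(g)$ for $g\in G$, $h\in H$, i.e. sections of $S=G\times_{\widetilde{\mathrm{Ad}}}\Delta_{\mathfrak m}$. $X(\psi)$ is the derivative of $\psi$ along the left invariant vector field induced by $X\in\mathfrak g$; in $Z_i\cdot Z_j\cdot Z_k(\psi)$ the vector $Z_k$ differentiates $\psi$ and $Z_i,Z_j$ act by Clifford multiplication. Connections and operators. $\nabla^t$ is the $G$-invariant metric connection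 $\nabla^t_XY=\nabla^0_XY+t[X,Y]_{\mathfrak m}$, where $\nabla^0$ is the canonical connection. With $H:=\frac14\sum_{i,j,k}\langle[Z_i,Z_j]_{\mathfrak m},Z_k\rangle Z_i\cdot Z_j\cdot Z_k\in\mathcal C(\mathfrak m)$, its Dirac operator is $D^t\psi=\sum_i Z_i\cdot Z_i(\psi)+t\,H\cdot\psi$. The lifted Casimir element of $\mathfrak h$ is $\widetilde C_{\mathfrak h}=-\sum_i\widetilde{\mathrm{ad}}(X_i)\cdot\widetilde{\mathrm{ad}}(Y_i)\in\mathcal C(\mathfrak m)$, where $X_i,Y_i$ are bases of $\mathfrak h$ with $Q(X_i,Y_j)=\delta_{ij}$, and $\Omega_{\mathfrak g}(\psi)=-\sum_iZ_i^2(\psi)+\widetilde C_{\mathfrak h}\cdot\psi$. *)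

theory Defs
  imports "HOL-Analysis.Analysis" "HOL-Algebra.Group"
begin

section \<open>Smooth maps and Lie groups\<close>

text \<open>Only used for open \<open>S\<close> in finite-dimensional spaces, where this is the usual \<open>C\<^sup>k\<close>.\<close>

primrec Ck_on :: "nat \<Rightarrow> 'a set \<Rightarrow> ('a::real_normed_vector \<Rightarrow> 'b::real_normed_vector) \<Rightarrow> bool" where
  "Ck_on 0 S f \<longleftrightarrow> continuous_on S f"
| "Ck_on (Suc k) S f \<longleftrightarrow>
     f differentiable_on S \<and> (\<forall>v. Ck_on k S (\<lambda>x. frechet_derivative f (at x) v))"

definition smooth_on :: "'a set \<Rightarrow> ('a::real_normed_vector \<Rightarrow> 'b::real_normed_vector) \<Rightarrow> bool" where
  "smooth_on S f \<longleftrightarrow> (\<forall>k. Ck_on k S f)"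

text \<open>A chart is a pair of its domain \<open>U\<close> and a map \<open>\<phi>\<close> which is meaningful on \<open>U\<close> only;
  the inverse of a chart is \<open>inv_into U \<phi>\<close>.\<close>

definition smooth_atlas ::
  "('g::topological_space set \<times> ('g \<Rightarrow> 'e::euclidean_space)) set \<Rightarrow> bool" where
  "smooth_atlas A \<longleftrightarrow>
     (\<Union>(U, \<phi>)\<in>A. U) = UNIV \<and>
     (\<forall>(U, \<phi>)\<in>A. open U \<and> open (\<phi> ` U) \<and> homeomorphism U (\<phi> ` U) \<phi> (inv_into U \<phi>)) \<and>
     (\<forall>(U, \<phi>)\<in>A. \<forall>(V, \<eta>)\<in>A. smooth_on (\<phi> ` (U \<inter> V)) (\<eta> \<circ> inv_into U \<phi>))"

record ('g, 'e) lie_group = "'g monoid" +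
  atlas :: "('g set \<times> ('g \<Rightarrow> 'e)) set"

text \<open>The underlying manifold is the whole type \<open>'g\<close>, modelled on \<open>'e\<close>.\<close>

definition is_lie_group ::
  "('g::{t2_space, second_countable_topology}, 'e::euclidean_space, 'r) lie_group_scheme \<Rightarrow> bool" where
  "is_lie_group G \<longleftrightarrow>
     group G \<and> carrier G = UNIV \<and> smooth_atlas (atlas G) \<and>
     continuous_on UNIV (\<lambda>(x, y). x \<otimes>\<^bsub>G\<^esub> y) \<and> continuous_on UNIV (\<lambda>x. inv\<^bsub>G\<^esub> x) \<and>
     (\<forall>(U, \<phi>)\<in>atlas G. \<forall>(V, \<eta>)\<in>atlas G. \<forall>(W, \<omega>)\<in>atlas G.
        smooth_on {(a, b). a \<in> \<phi> ` U \<and> b \<in> \<eta> ` V \<and> inv_into U \<phi> a \<otimes>\<^bsub>G\<^esub> inv_into V \<eta> b \<in> W}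
          (\<lambda>(a, b). \<omega> (inv_into U \<phi> a \<otimes>\<^bsub>G\<^esub> inv_into V \<eta> b))) \<and>
     (\<forall>(U, \<phi>)\<in>atlas G. \<forall>(W, \<omega>)\<in>atlas G.
        smooth_on {a \<in> \<phi> ` U. inv\<^bsub>G\<^esub> (inv_into U \<phi> a) \<in> W} (\<lambda>a. \<omega> (inv\<^bsub>G\<^esub> (inv_into U \<phi> a))))"

definition smooth_map ::
  "('g, 'e::euclidean_space, 'r) lie_group_scheme \<Rightarrow> ('g \<Rightarrow> 'v::real_normed_vector) \<Rightarrow> bool" where
  "smooth_map G f \<longleftrightarrow> (\<forall>(U, \<phi>)\<in>atlas G. smooth_on (\<phi> ` U) (f \<circ> inv_into U \<phi>))"

section \<open>The Lie algebra\<close>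

text \<open>The Lie algebra is the tangent space at the identity. It is identified with the model
  space \<open>'e\<close> by a chart around the identity, chosen once and for all: \<open>X :: 'e\<close> is the
  velocity at \<open>s = 0\<close> of the curve \<open>unit_curve G X\<close>, which is a straight line in that chart.
  The inner product that comes with the class of \<open>'e\<close> plays no role.\<close>

definition unit_chart :: "('g, 'e::euclidean_space, 'r) lie_group_scheme \<Rightarrow> 'g set \<times> ('g \<Rightarrow> 'e)" where
  "unit_chart G = (SOME c. c \<in> atlas G \<and> \<one>\<^bsub>G\<^esub> \<in> fst c)"

definition coord :: "('g, 'e::euclidean_space, 'r) lie_group_scheme \<Rightarrow> 'g \<Rightarrow> 'e" where
  "coord G = snd (unit_chart G)"

definition unit_curve :: "('g, 'e::euclidean_space, 'r) lie_group_scheme \<Rightarrow> 'e \<Rightarrow> real \<Rightarrow> 'g" where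
  "unit_curve G X s = inv_into (fst (unit_chart G)) (coord G) (coord G \<one>\<^bsub>G\<^esub> + s *\<^sub>R X)"

text \<open>\<open>lderiv G X f\<close> is \<open>X(f)\<close>, the derivative of \<open>f\<close> along the left-invariant vector field
  with value \<open>X\<close> at the identity.\<close>

definition lderiv ::
  "('g, 'e::euclidean_space, 'r) lie_group_scheme \<Rightarrow> 'e \<Rightarrow> ('g \<Rightarrow> 'v::real_normed_vector) \<Rightarrow> 'g \<Rightarrow> 'v" where
  "lderiv G X f g = vector_derivative (\<lambda>s. f (g \<otimes>\<^bsub>G\<^esub> unit_curve G X s)) (at 0)"

text \<open>The commutator of the left-invariant vector fields of \<open>X\<close> and \<open>Y\<close>, evaluated at the
  identity in the coordinates that identify the tangent space with \<open>'e\<close>.\<close>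

definition lie_bracket :: "('g, 'e::euclidean_space, 'r) lie_group_scheme \<Rightarrow> 'e \<Rightarrow> 'e \<Rightarrow> 'e" where
  "lie_bracket G X Y =
     lderiv G X (lderiv G Y (coord G)) \<one>\<^bsub>G\<^esub> - lderiv G Y (lderiv G X (coord G)) \<one>\<^bsub>G\<^esub>"

definition Ad :: "('g, 'e::euclidean_space, 'r) lie_group_scheme \<Rightarrow> 'g \<Rightarrow> 'e \<Rightarrow> 'e" where
  "Ad G g X = vector_derivative (\<lambda>s. coord G (g \<otimes>\<^bsub>G\<^esub> unit_curve G X s \<otimes>\<^bsub>G\<^esub> inv\<^bsub>G\<^esub> g)) (at 0)"

definition one_parameter_group ::
  "('g::topological_space, 'e::euclidean_space, 'r) lie_group_scheme \<Rightarrow> 'e \<Rightarrow> (real \<Rightarrow> 'g) \<Rightarrow> bool" where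
  "one_parameter_group G X c \<longleftrightarrow>
     continuous_on UNIV c \<and> (\<forall>s t. c (s + t) = c s \<otimes>\<^bsub>G\<^esub> c t) \<and>
     ((\<lambda>s. coord G (c s)) has_vector_derivative X) (at 0)"

text \<open>The Lie algebra of a closed subgroup \<open>H\<close>: all \<open>X\<close> with \<open>exp (s X) \<in> H\<close> for all \<open>s\<close>.\<close>

definition subgroup_lie_algebra ::
  "('g::topological_space, 'e::euclidean_space, 'r) lie_group_scheme \<Rightarrow> 'g set \<Rightarrow> 'e set" where
  "subgroup_lie_algebra G H = {X. \<exists>c. one_parameter_group G X c \<and> range c \<subseteq> H}"

section \<open>Naturally reductive homogeneous spaces\<close>

text \<open>A reductive Riemannian homogeneous space \<open>M = G/H\<close>: the Lie group \<open>G\<close>, the closed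
  subgroup \<open>H = isotropy M\<close>, the complement \<open>complement M\<close> of its Lie algebra (the tangent
  space of \<open>G/H\<close> at the base point), and the inner product \<open>ip M\<close> there. The \<open>G\<close>-invariant
  Riemannian metrics on \<open>G/H\<close> correspond to the \<open>Ad(H)\<close>-invariant inner products on the
  complement; \<open>ip M\<close> is meaningful on the complement only. That the Lie algebra of a closed
  subgroup is a subspace is automatic; below it is stated as part of the direct sum condition.\<close>

record ('g, 'e) homogeneous_space = "('g, 'e) lie_group" +
  isotropy :: "'g set"
  complement :: "'e set"
  ip :: "'e \<Rightarrow> 'e \<Rightarrow> real"

abbreviation isotropy_algebra ::
  "('g::topological_space, 'e::euclidean_space, 'r) homogeneous_space_scheme \<Rightarrow> 'e set" where
  "isotropy_algebra M \<equiv> subgroup_lie_algebra M (isotropy M)"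

definition inner_product_on :: "'e::real_vector set \<Rightarrow> ('e \<Rightarrow> 'e \<Rightarrow> real) \<Rightarrow> bool" where
  "inner_product_on V B \<longleftrightarrow>
     (\<forall>X\<in>V. \<forall>Y\<in>V. B X Y = B Y X) \<and>
     (\<forall>X\<in>V. \<forall>Y\<in>V. \<forall>Z\<in>V. B (X + Y) Z = B X Z + B Y Z) \<and>
     (\<forall>a. \<forall>X\<in>V. \<forall>Y\<in>V. B (a *\<^sub>R X) Y = a * B X Y) \<and>
     (\<forall>X\<in>V. X \<noteq> 0 \<longrightarrow> B X X > 0)"

definition is_reductive_homogeneous_space ::
  "('g::{t2_space, second_countable_topology}, 'e::euclidean_space, 'r) homogeneous_space_scheme \<Rightarrow> bool" where
  "is_reductive_homogeneous_space M \<longleftrightarrow>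
     is_lie_group M \<and> subgroup (isotropy M) M \<and> closed (isotropy M) \<and>
     subspace (isotropy_algebra M) \<and> subspace (complement M) \<and>
     isotropy_algebra M \<inter> complement M = {0} \<and>
     (\<forall>A. \<exists>Y\<in>isotropy_algebra M. \<exists>X\<in>complement M. A = Y + X) \<and>
     (\<forall>h\<in>isotropy M. Ad M h ` complement M \<subseteq> complement M) \<and>
     inner_product_on (complement M) (ip M) \<and>
     (\<forall>h\<in>isotropy M. \<forall>X\<in>complement M. \<forall>Y\<in>complement M. ip M (Ad M h X) (Ad M h Y) = ip M X Y)"

definition m_part ::
  "('g::topological_space, 'e::euclidean_space, 'r) homogeneous_space_scheme \<Rightarrow> 'e \<Rightarrow> 'e" where
  "m_part M A = (THE X. X \<in> complement M \<and> A - X \<in> isotropy_algebra M)"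

definition h_part ::
  "('g::topological_space, 'e::euclidean_space, 'r) homogeneous_space_scheme \<Rightarrow> 'e \<Rightarrow> 'e" where
  "h_part M A = (THE Y. Y \<in> isotropy_algebra M \<and> A - Y \<in> complement M)"

definition naturally_reductive ::
  "('g::{t2_space, second_countable_topology}, 'e::euclidean_space, 'r) homogeneous_space_scheme \<Rightarrow> bool" where
  "naturally_reductive M \<longleftrightarrow>
     is_reductive_homogeneous_space M \<and>
     (\<forall>X\<in>complement M. \<forall>Y\<in>complement M. \<forall>Z\<in>complement M.
        ip M (m_part M (lie_bracket M X Y)) Z + ip M Y (m_part M (lie_bracket M X Z)) = 0)"

definition generated_by_complement ::
  "('g, 'e::euclidean_space, 'r) homogeneous_space_scheme \<Rightarrow> bool" where
  "generated_by_complement M \<longleftrightarrow>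
     (\<forall>A. \<exists>X\<in>complement M.
        \<exists>B\<in>span {lie_bracket M Y Z |Y Z. Y \<in> complement M \<and> Z \<in> complement M}. A = X + B)"

definition invariant_extension ::
  "('g::topological_space, 'e::euclidean_space, 'r) homogeneous_space_scheme \<Rightarrow> ('e \<Rightarrow> 'e \<Rightarrow> real) \<Rightarrow> bool" where
  "invariant_extension M Q \<longleftrightarrow>
     bilinear Q \<and> (\<forall>A B. Q A B = Q B A) \<and> (\<forall>A. (\<forall>B. Q A B = 0) \<longrightarrow> A = 0) \<and>
     (\<forall>g A B. Q (Ad M g A) (Ad M g B) = Q A B) \<and>
     (\<forall>Y\<in>isotropy_algebra M. \<forall>X\<in>complement M. Q Y X = 0) \<and>
     (\<forall>X\<in>complement M. \<forall>Y\<in>complement M. Q X Y = ip M X Y)"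

definition Q_h ::
  "('g::topological_space, 'e::euclidean_space, 'r) homogeneous_space_scheme \<Rightarrow>
   ('e \<Rightarrow> 'e \<Rightarrow> real) \<Rightarrow> 'e \<Rightarrow> 'e \<Rightarrow> real" where
  "Q_h M Q A B = Q (h_part M A) (h_part M B)"

definition Q_m ::
  "('g::topological_space, 'e::euclidean_space, 'r) homogeneous_space_scheme \<Rightarrow> 'e \<Rightarrow> 'e \<Rightarrow> real" where
  "Q_m M A B = ip M (m_part M A) (m_part M B)"

definition Jac_m ::
  "('g::topological_space, 'e::euclidean_space, 'r) homogeneous_space_scheme \<Rightarrow> 'e \<Rightarrow> 'e \<Rightarrow> 'e \<Rightarrow> 'e" where
  "Jac_m M X Y Z =
     m_part M (lie_bracket M X (m_part M (lie_bracket M Y Z))) +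
     m_part M (lie_bracket M Y (m_part M (lie_bracket M Z X))) +
     m_part M (lie_bracket M Z (m_part M (lie_bracket M X Y)))"

definition Jac_h ::
  "('g::topological_space, 'e::euclidean_space, 'r) homogeneous_space_scheme \<Rightarrow> 'e \<Rightarrow> 'e \<Rightarrow> 'e \<Rightarrow> 'e" where
  "Jac_h M X Y Z =
     lie_bracket M X (h_part M (lie_bracket M Y Z)) +
     lie_bracket M Y (h_part M (lie_bracket M Z X)) +
     lie_bracket M Z (h_part M (lie_bracket M X Y))"

definition orthonormal_basis ::
  "('g, 'e::euclidean_space, 'r) homogeneous_space_scheme \<Rightarrow> nat \<Rightarrow> (nat \<Rightarrow> 'e) \<Rightarrow> bool" where
  "orthonormal_basis M n Z \<longleftrightarrow>
     span (Z ` {1..n}) = complement M \<and>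
     (\<forall>i\<in>{1..n}. \<forall>j\<in>{1..n}. ip M (Z i) (Z j) = (if i = j then 1 else 0))"

text \<open>The duality relation makes both spanning families linearly independent.\<close>

definition dual_bases_h ::
  "('g::topological_space, 'e::euclidean_space, 'r) homogeneous_space_scheme \<Rightarrow>
   ('e \<Rightarrow> 'e \<Rightarrow> real) \<Rightarrow> nat \<Rightarrow> (nat \<Rightarrow> 'e) \<Rightarrow> (nat \<Rightarrow> 'e) \<Rightarrow> bool" where
  "dual_bases_h M Q r X Y \<longleftrightarrow>
     span (X ` {1..r}) = isotropy_algebra M \<and> span (Y ` {1..r}) = isotropy_algebra M \<and>
     (\<forall>i\<in>{1..r}. \<forall>j\<in>{1..r}. Q (X i) (Y j) = (if i = j then 1 else 0))"

section \<open>Homogeneous spin structures\<close>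

text \<open>The Clifford algebra of the complement is a real algebra \<open>'c\<close> with the inclusion
  \<open>cliff\<close> (meaningful on the complement); \<open>spin_lift\<close> is the lift of the isotropy
  representation (meaningful on \<open>H\<close>) and \<open>spin_rep\<close> is the action of the Clifford algebra on
  the complex vector space of spinors. The Euclidean structure of \<open>'c\<close> only serves to provide
  the topology of a finite-dimensional vector space.\<close>

record ('g, 'e, 'c, 'd) spin_structure =
  cliff :: "'e \<Rightarrow> 'c"
  spin_lift :: "'g \<Rightarrow> 'c"
  spin_rep :: "'c \<Rightarrow> complex^'d^'d"

text \<open>The dimension condition says that the algebra generated by the complement is subject to
  no relations other than the consequences of \<open>v \<cdot> v = - \<langle>v, v\<rangle>\<close>.\<close>

definition is_clifford_algebra ::
  "'e::euclidean_space set \<Rightarrow> ('e \<Rightarrow> 'e \<Rightarrow> real) \<Rightarrow> ('e \<Rightarrow> 'c::{real_algebra_1, euclidean_space}) \<Rightarrow> bool" where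
  "is_clifford_algebra V B c \<longleftrightarrow>
     (\<forall>v\<in>V. \<forall>w\<in>V. c (v + w) = c v + c w) \<and>
     (\<forall>a. \<forall>v\<in>V. c (a *\<^sub>R v) = a *\<^sub>R c v) \<and>
     (\<forall>v\<in>V. c v * c v = - (B v v *\<^sub>R 1)) \<and>
     (\<forall>S. subspace S \<and> 1 \<in> S \<and> (\<forall>x\<in>S. \<forall>y\<in>S. x * y \<in> S) \<and> c ` V \<subseteq> S \<longrightarrow> S = UNIV) \<and>
     DIM('c) = 2 ^ dim V"

definition spin_group ::
  "'e::euclidean_space set \<Rightarrow> ('e \<Rightarrow> 'e \<Rightarrow> real) \<Rightarrow> ('e \<Rightarrow> 'c::{real_algebra_1, euclidean_space}) \<Rightarrow> 'c set" where
  "spin_group V B c =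
     {prod_list (map c vs) |vs. even (length vs) \<and> set vs \<subseteq> {v \<in> V. B v v = 1}}"

text \<open>Up to isomorphism the spin representation is the restriction to the spin group of an
  irreducible complex representation of the Clifford algebra.\<close>

definition irreducible_complex_rep ::
  "('c::{real_algebra_1, euclidean_space} \<Rightarrow> complex^'d::finite^'d) \<Rightarrow> bool" where
  "irreducible_complex_rep \<rho> \<longleftrightarrow>
     linear \<rho> \<and> \<rho> 1 = mat 1 \<and> (\<forall>a b. \<rho> (a * b) = \<rho> a ** \<rho> b) \<and>
     (\<forall>W. vec.subspace W \<and> (\<forall>a. \<forall>w\<in>W. \<rho> a *v w \<in> W) \<longrightarrow> W = {0} \<or> W = UNIV)"

text \<open>The last condition expresses that the lift covers \<open>Ad\<close>: the double covering maps \<open>s\<close> to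
  \<open>v \<mapsto> s \<cdot> v \<cdot> s\<^sup>-\<^sup>1\<close>. Continuous homomorphisms of Lie groups are smooth.\<close>

definition is_homogeneous_spin_structure ::
  "('g::{t2_space, second_countable_topology}, 'e::euclidean_space, 'r) homogeneous_space_scheme \<Rightarrow>
   ('g, 'e, 'c::{real_algebra_1, euclidean_space}, 'd::finite, 's) spin_structure_scheme \<Rightarrow> bool" where
  "is_homogeneous_spin_structure M S \<longleftrightarrow>
     is_clifford_algebra (complement M) (ip M) (cliff S) \<and>
     irreducible_complex_rep (spin_rep S) \<and>
     continuous_on (isotropy M) (spin_lift S) \<and>
     spin_lift S ` isotropy M \<subseteq> spin_group (complement M) (ip M) (cliff S) \<and>
     (\<forall>h\<in>isotropy M. \<forall>k\<in>isotropy M. spin_lift S (h \<otimes>\<^bsub>M\<^esub> k) = spin_lift S h * spin_lift S k) \<and>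
     (\<forall>h\<in>isotropy M. \<forall>v\<in>complement M.
        spin_lift S h * cliff S v * spin_lift S (inv\<^bsub>M\<^esub> h) = cliff S (Ad M h v))"

definition spinor_field ::
  "('g, 'e::euclidean_space, 'r) homogeneous_space_scheme \<Rightarrow>
   ('g, 'e, 'c, 'd::finite, 's) spin_structure_scheme \<Rightarrow> ('g \<Rightarrow> complex^'d) \<Rightarrow> bool" where
  "spinor_field M S \<psi> \<longleftrightarrow>
     smooth_map M \<psi> \<and>
     (\<forall>g. \<forall>h\<in>isotropy M. \<psi> (g \<otimes>\<^bsub>M\<^esub> h) = spin_rep S (spin_lift S (inv\<^bsub>M\<^esub> h)) *v \<psi> g)"

section \<open>Dirac and Casimir operators\<close>

definition ad_lift ::
  "('g, 'e::euclidean_space, 'r) homogeneous_space_scheme \<Rightarrow>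
   ('g, 'e, 'c::real_algebra_1, 'd::finite, 's) spin_structure_scheme \<Rightarrow> nat \<Rightarrow> (nat \<Rightarrow> 'e) \<Rightarrow> 'e \<Rightarrow> 'c" where
  "ad_lift M S n Z Y =
     (1/4) *\<^sub>R (\<Sum>i=1..n. \<Sum>j=1..n. ip M (lie_bracket M Y (Z i)) (Z j) *\<^sub>R (cliff S (Z i) * cliff S (Z j)))"

definition cubic_element ::
  "('g::topological_space, 'e::euclidean_space, 'r) homogeneous_space_scheme \<Rightarrow>
   ('g, 'e, 'c::real_algebra_1, 'd::finite, 's) spin_structure_scheme \<Rightarrow> nat \<Rightarrow> (nat \<Rightarrow> 'e) \<Rightarrow> 'c" where
  "cubic_element M S n Z =
     (1/4) *\<^sub>R (\<Sum>i=1..n. \<Sum>j=1..n. \<Sum>k=1..n.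
        ip M (m_part M (lie_bracket M (Z i) (Z j))) (Z k) *\<^sub>R (cliff S (Z i) * cliff S (Z j) * cliff S (Z k)))"

text \<open>The Dirac operator of the connection \<open>\<nabla>\<^sup>t\<^sub>X Y = \<nabla>\<^sup>0\<^sub>X Y + t [X, Y]\<^sub>m\<close>, with \<open>\<nabla>\<^sup>0\<close> the
  canonical connection: on spinor fields \<open>\<nabla>\<^sup>0\<close> differentiates along left-invariant vector
  fields, and the torsion term contributes \<open>t\<close> times the cubic element.\<close>

definition dirac ::
  "('g::topological_space, 'e::euclidean_space, 'r) homogeneous_space_scheme \<Rightarrow>
   ('g, 'e, 'c::real_algebra_1, 'd::finite, 's) spin_structure_scheme \<Rightarrow> nat \<Rightarrow> (nat \<Rightarrow> 'e) \<Rightarrow> real \<Rightarrow>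
   ('g \<Rightarrow> complex^'d) \<Rightarrow> 'g \<Rightarrow> complex^'d" where
  "dirac M S n Z t \<psi> g =
     (\<Sum>i=1..n. spin_rep S (cliff S (Z i)) *v lderiv M (Z i) \<psi> g) +
     t *\<^sub>R (spin_rep S (cubic_element M S n Z) *v \<psi> g)"

definition casimir_lift ::
  "('g, 'e::euclidean_space, 'r) homogeneous_space_scheme \<Rightarrow>
   ('g, 'e, 'c::real_algebra_1, 'd::finite, 's) spin_structure_scheme \<Rightarrow> nat \<Rightarrow> (nat \<Rightarrow> 'e) \<Rightarrow>
   nat \<Rightarrow> (nat \<Rightarrow> 'e) \<Rightarrow> (nat \<Rightarrow> 'e) \<Rightarrow> 'c" where
  "casimir_lift M S n Z r X Y = - (\<Sum>i=1..r. ad_lift M S n Z (X i) * ad_lift M S n Z (Y i))"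

definition casimir ::
  "('g, 'e::euclidean_space, 'r) homogeneous_space_scheme \<Rightarrow>
   ('g, 'e, 'c::real_algebra_1, 'd::finite, 's) spin_structure_scheme \<Rightarrow> nat \<Rightarrow> (nat \<Rightarrow> 'e) \<Rightarrow>
   nat \<Rightarrow> (nat \<Rightarrow> 'e) \<Rightarrow> (nat \<Rightarrow> 'e) \<Rightarrow> ('g \<Rightarrow> complex^'d) \<Rightarrow> 'g \<Rightarrow> complex^'d" where
  "casimir M S n Z r X Y \<psi> g =
     - (\<Sum>i=1..n. lderiv M (Z i) (lderiv M (Z i) \<psi>) g) +
     spin_rep S (casimir_lift M S n Z r X Y) *v \<psi> g"

end

theory Submission
  imports Defs
begin

text \<open>In the chart at the identity the Lie bracket is the antisymmetrised mixed second derivative of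
  the multiplication, so that \<open>X Y - Y X = [X, Y]\<close> on functions and \<open>ad\<close>-invariance of \<open>Q\<close> both follow
  from the symmetry of second derivatives. On spinor fields \<open>Y \<in> \<hh>\<close> acts as minus Clifford
  multiplication by \<open>ad_lift Y\<close>: the lift of a one-parameter group is differentiable, its derivative
  and \<open>ad_lift Y\<close> have the same commutators with vectors, hence differ by a scalar, and the scalar
  vanishes because the spin group acts by isometries.

  Squaring the Dirac operator, the second order part gives the Laplacian and, through commutators,
  half of the mixed term and \<open>-1/8\<close> of the quartic element of \<open>R_h(i,j,k,l) = Q_h([Z_i,Z_j],[Z_k,Z_l])\<close>;
  the Casimir element is \<open>-1/16\<close> of the same quartic element. The anticommutator of \<open>Z_k\<close> with the
  cubic element gives the rest of the mixed term, and the square of the cubic element is a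
  combination of the quartic element of \<open>R_m(i,j,k,l) = Q_m([Z_i,Z_j],[Z_k,Z_l])\<close> and a scalar. Finally a quartic
  element is the sum of its totally antisymmetric part, where the Jacobi expressions appear, and a
  scalar.\<close>

section \<open>Sums over ordered index tuples and the Clifford relations\<close>

text \<open>The constants come from two formulas. If \<open>R\<close> is antisymmetric in its first
  two indices and symmetric under exchange of its index pairs, its quartic element is
  \<open>8\<close> times the ordered sum of \<open>alt3 R\<close> minus twice the trace, the sum of
  all \<open>R i j i j\<close>. The quartic element of \<open>R_h\<close> enters the square with
  \<open>-1/8\<close> and the Casimir element with \<open>-1/16\<close>, so \<open>-1/16\<close> of
  it remains beside \<open>casimir\<close>; this yields \<open>-1/2\<close> in front of the ordered
  sum and \<open>1/8\<close> in front of the trace. The square of the cubic element is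
  \<open>-9/16\<close> of the quartic element of \<open>R_m\<close> minus \<open>3/4\<close> of its
  trace. The first part yields the factor \<open>9\<close> and the scalar \<open>9/8\<close>, and
  \<open>9/8 - 3/4 = 3/8\<close>.

  The Clifford identities follow from the anticommutation relations alone, without linear
  independence of monomials; even the statement on central elements needs only a spanning set. In
  the analysis, \<open>vector_derivative\<close> is a choice operator, so a formula for a derivative
  is of use only together with its existence. The spin lift is merely continuous, so its derivative
  is first obtained by integrating it.\<close>

lemma sum2_symmetric:
  fixes f :: "nat \<Rightarrow> nat \<Rightarrow> 'a::real_vector"
  assumes sym: "\<And>i j. f i j = f j i" and diag: "\<And>i. f i i = 0"
  shows "(\<Sum>i=a..n. \<Sum>j=a..n. f i j) = 2 *\<^sub>R (\<Sum>i=a..n. \<Sum>j=i+1..n. f i j)"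
proof (cases "a \<le> Suc n")
  case True
  then show ?thesis
  \<comment> \<open>Downward induction on the lower bound. Splitting the index \<open>a\<close> off
    each sum leaves the tail and the terms in which \<open>a\<close> occurs; those with a repeated
    \<open>a\<close> vanish, and by symmetry every position of a single \<open>a\<close> contributes
    equally. The next two lemmas iterate this, with \<open>3 * 2 = 6\<close> and
    \<open>4 * 6 = 24\<close>.\<close>
  proof (induction a rule: inc_induct)
    case (step a)
    then have a: "a \<le> n" by simp
    have sw: "f j a = f a j" for j by (rule sym)
    have "(\<Sum>i=a..n. \<Sum>j=a..n. f i j)
        = (\<Sum>i=Suc a..n. f i a) + (\<Sum>i=Suc a..n. f a i) + (\<Sum>i=Suc a..n. \<Sum>j=Suc a..n. f i j)"
      using a by (simp add: sum.atLeast_Suc_atMost sum.distrib diag algebra_simps)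
    also have "(\<Sum>i=Suc a..n. f i a) = (\<Sum>i=Suc a..n. f a i)" by (simp only: sw)
    finally show ?case
      using step a by (simp add: sum.atLeast_Suc_atMost algebra_simps scaleR_2)
  qed simp
qed simp

lemma sum3_symmetric:
  fixes f :: "nat \<Rightarrow> nat \<Rightarrow> nat \<Rightarrow> 'a::real_vector"
  assumes s12: "\<And>i j k. f i j k = f j i k" and s23: "\<And>i j k. f i j k = f i k j"
    and diag: "\<And>i k. f i i k = 0"
  shows "(\<Sum>i=a..n. \<Sum>j=a..n. \<Sum>k=a..n. f i j k) =
    6 *\<^sub>R (\<Sum>i=a..n. \<Sum>j=i+1..n. \<Sum>k=j+1..n. f i j k)"
proof (cases "a \<le> Suc n")
  case True
  then show ?thesis
  proof (induction a rule: inc_induct)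
    case (step a)
    then have a: "a \<le> n" by simp
    have z: "f i a a = 0" "f a i a = 0" for i
      by (metis s12 s23 diag)+
    have sw1: "f i a j = f a i j" for i j by (rule s12)
    have sw2: "f i j a = f a i j" for i j by (metis s12 s23)
    let ?B = "{Suc a..n}"
    have "(\<Sum>i=a..n. \<Sum>j=a..n. \<Sum>k=a..n. f i j k)
        = (\<Sum>i\<in>?B. \<Sum>j\<in>?B. f i j a) + (\<Sum>i\<in>?B. \<Sum>j\<in>?B. f i a j) + (\<Sum>i\<in>?B. \<Sum>j\<in>?B. f a i j)
          + (\<Sum>i\<in>?B. \<Sum>j\<in>?B. \<Sum>k\<in>?B. f i j k)"
      using a by (simp add: sum.atLeast_Suc_atMost sum.distrib diag z algebra_simps)
    also have "(\<Sum>i\<in>?B. \<Sum>j\<in>?B. f i j a) = (\<Sum>i\<in>?B. \<Sum>j\<in>?B. f a i j)" by (simp only: sw2)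
    also have "(\<Sum>i\<in>?B. \<Sum>j\<in>?B. f i a j) = (\<Sum>i\<in>?B. \<Sum>j\<in>?B. f a i j)" by (simp only: sw1)
    also have "(\<Sum>i\<in>?B. \<Sum>j\<in>?B. f a i j) = 2 *\<^sub>R (\<Sum>i\<in>?B. \<Sum>j=i+1..n. f a i j)"
      by (rule sum2_symmetric) (metis s23, metis s12 s23 diag)
    finally show ?case
      using step a by (simp add: sum.atLeast_Suc_atMost algebra_simps flip: scaleR_add_left)
  qed simp
qed simp

lemma sum4_symmetric:
  fixes f :: "nat \<Rightarrow> nat \<Rightarrow> nat \<Rightarrow> nat \<Rightarrow> 'a::real_vector"
  assumes s12: "\<And>i j k l. f i j k l = f j i k l" and s23: "\<And>i j k l. f i j k l = f i k j l"
    and s34: "\<And>i j k l. f i j k l = f i j l k"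
    and diag: "\<And>i k l. f i i k l = 0"
  shows "(\<Sum>i=a..n. \<Sum>j=a..n. \<Sum>k=a..n. \<Sum>l=a..n. f i j k l) =
    24 *\<^sub>R (\<Sum>i=a..n. \<Sum>j=i+1..n. \<Sum>k=j+1..n. \<Sum>l=k+1..n. f i j k l)"
proof (cases "a \<le> Suc n")
  case True
  then show ?thesis
  proof (induction a rule: inc_induct)
    case (step a)
    then have a: "a \<le> n" by simp
    have z1: "f a i a j = 0" "f i a a j = 0" for i j
      by (metis s12 s23 diag)+
    have z2: "f a i j a = 0" "f i a j a = 0" "f i j a a = 0" for i j
      by (metis z1 s34 s23)+
    have sw1: "f i a j k = f a i j k" for i j k by (rule s12)
    have sw2: "f i j a k = f a i j k" for i j k by (metis s12 s23)
    have sw3: "f i j k a = f a i j k" for i j k by (metis sw2 s34)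
    let ?B = "{Suc a..n}"
    have "(\<Sum>i=a..n. \<Sum>j=a..n. \<Sum>k=a..n. \<Sum>l=a..n. f i j k l)
        = (\<Sum>i\<in>?B. \<Sum>j\<in>?B. \<Sum>k\<in>?B. f i j k a) + (\<Sum>i\<in>?B. \<Sum>j\<in>?B. \<Sum>k\<in>?B. f i j a k)
          + (\<Sum>i\<in>?B. \<Sum>j\<in>?B. \<Sum>k\<in>?B. f i a j k) + (\<Sum>i\<in>?B. \<Sum>j\<in>?B. \<Sum>k\<in>?B. f a i j k)
          + (\<Sum>i\<in>?B. \<Sum>j\<in>?B. \<Sum>k\<in>?B. \<Sum>l\<in>?B. f i j k l)"
      using a by (simp add: sum.atLeast_Suc_atMost sum.distrib diag z1 z2 algebra_simps)
    also have "(\<Sum>i\<in>?B. \<Sum>j\<in>?B. \<Sum>k\<in>?B. f i j k a) = (\<Sum>i\<in>?B. \<Sum>j\<in>?B. \<Sum>k\<in>?B. f a i j k)" by (simp only: sw3)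
    also have "(\<Sum>i\<in>?B. \<Sum>j\<in>?B. \<Sum>k\<in>?B. f i j a k) = (\<Sum>i\<in>?B. \<Sum>j\<in>?B. \<Sum>k\<in>?B. f a i j k)" by (simp only: sw2)
    also have "(\<Sum>i\<in>?B. \<Sum>j\<in>?B. \<Sum>k\<in>?B. f i a j k) = (\<Sum>i\<in>?B. \<Sum>j\<in>?B. \<Sum>k\<in>?B. f a i j k)" by (simp only: sw1)
    also have "(\<Sum>i\<in>?B. \<Sum>j\<in>?B. \<Sum>k\<in>?B. f a i j k)
        = 6 *\<^sub>R (\<Sum>i\<in>?B. \<Sum>j=i+1..n. \<Sum>k=j+1..n. f a i j k)"
      by (rule sum3_symmetric) (metis s23, metis s34, metis s12 s23 diag)
    finally show ?case
      using step a by (simp add: sum.atLeast_Suc_atMost algebra_simps flip: scaleR_add_left)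
  qed simp
qed simp

section \<open>Clifford relations, antisymmetrised products and curvature-like tensors\<close>

definition kron :: "nat \<Rightarrow> nat \<Rightarrow> real" where "kron i j = of_bool (i = j)"

lemma kron_commute: "kron i j = kron j i"
  by (simp add: kron_def)

text \<open>The sum in the first Bianchi identity. For a tensor with the symmetries of
  \<open>R_h\<close> and \<open>R_m\<close> it is three times the totally antisymmetric
  part.\<close>

definition alt3 :: "(nat \<Rightarrow> nat \<Rightarrow> nat \<Rightarrow> nat \<Rightarrow> real) \<Rightarrow> nat \<Rightarrow> nat \<Rightarrow> nat \<Rightarrow> nat \<Rightarrow> real" where
  "alt3 R i j k l = R i j k l + R i k l j + R i l j k"

text \<open>The ambient algebra is arbitrary and the generators may be dependent, so whatever is
  proved here is a formal consequence of the relations.\<close>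

locale clifford_frame =
  fixes I :: "nat set" and e :: "nat \<Rightarrow> 'c::real_algebra_1"
  assumes fin: "finite I"
    and anticommute: "\<And>i j. i \<in> I \<Longrightarrow> j \<in> I \<Longrightarrow> e i * e j + e j * e i = (- 2 * kron i j) *\<^sub>R 1"
begin

lemma sum_kron:
  fixes x :: "nat \<Rightarrow> 'a::real_vector"
  assumes "i \<in> I"
  shows "(\<Sum>j\<in>I. kron i j *\<^sub>R x j) = x i" "(\<Sum>j\<in>I. kron j i *\<^sub>R x j) = x i"
proof -
  have "(\<Sum>j\<in>I. kron i j *\<^sub>R x j) = (\<Sum>j\<in>I. if i = j then x j else 0)"
    by (intro sum.cong) (auto simp: kron_def)
  then show "(\<Sum>j\<in>I. kron i j *\<^sub>R x j) = x i"
    using assms fin by simp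
  then show "(\<Sum>j\<in>I. kron j i *\<^sub>R x j) = x i"
    by (simp add: kron_commute)
qed

lemma swap:
  assumes "i \<in> I" "j \<in> I"
  shows "e j * e i = - (e i * e j) - (2 * kron i j) *\<^sub>R 1"
proof -
  have "e j * e i = (- 2 * kron i j) *\<^sub>R 1 - e i * e j"
    unfolding eq_diff_eq by (subst add.commute) (rule anticommute[OF assms])
  then show ?thesis by simp
qed

lemma swap_left:
  assumes "i \<in> I" "j \<in> I"
  shows "e j * (e i * x) = - (e i * (e j * x)) - (2 * kron i j) *\<^sub>R x"
proof -
  have "e j * (e i * x) = (e j * e i) * x" by (simp add: mult.assoc)
  also have "\<dots> = - (e i * e j) * x - (2 * kron i j) *\<^sub>R x"
    by (simp only: swap[OF assms]) (simp add: left_diff_distrib)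
  finally show ?thesis by (simp add: mult.assoc)
qed

text \<open>Averaging with the sum in which the indices are exchanged replaces each product by half
  an anticommutator, so only the trace survives.\<close>

lemma symmetric_contraction:
  assumes "\<And>i j. i \<in> I \<Longrightarrow> j \<in> I \<Longrightarrow> s i j = s j i"
  shows "(\<Sum>i\<in>I. \<Sum>j\<in>I. s i j *\<^sub>R (e i * e j)) = (- (\<Sum>i\<in>I. s i i)) *\<^sub>R 1"
proof -
  let ?T = "\<Sum>i\<in>I. \<Sum>j\<in>I. s i j *\<^sub>R (e i * e j)"
  have "?T = (\<Sum>i\<in>I. \<Sum>j\<in>I. s i j *\<^sub>R (e j * e i))"
    by (subst sum.swap) (intro sum.cong refl, simp add: assms)
  then have "2 *\<^sub>R ?T = (\<Sum>i\<in>I. \<Sum>j\<in>I. s i j *\<^sub>R (e i * e j)) + (\<Sum>i\<in>I. \<Sum>j\<in>I. s i j *\<^sub>R (e j * e i))"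
    by (simp add: scaleR_2)
  also have "\<dots> = (\<Sum>i\<in>I. \<Sum>j\<in>I. s i j *\<^sub>R (e i * e j + e j * e i))"
    by (simp add: sum.distrib scaleR_add_right)
  also have "\<dots> = (\<Sum>i\<in>I. \<Sum>j\<in>I. kron i j *\<^sub>R ((- 2 * s i j) *\<^sub>R 1))"
    by (intro sum.cong refl) (simp add: anticommute)
  also have "\<dots> = (\<Sum>i\<in>I. (- 2 * s i i) *\<^sub>R 1)"
    by (intro sum.cong refl sum_kron)
  also have "\<dots> = 2 *\<^sub>R ((- (\<Sum>i\<in>I. s i i)) *\<^sub>R 1)"
    by (simp only: scaleR_sum_left[symmetric] sum_distrib_left[symmetric]) simp
  finally show ?thesis by (simp only: scaleR_cancel_left) simp
qed

text \<open>The antisymmetrised product of four generators, written out as in Wick's theorem with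
  \<open>- kron i j\<close> as the contraction of \<open>e i\<close> and \<open>e j\<close>. It
  agrees with the plain product for distinct indices.\<close>

definition wick :: "nat \<Rightarrow> nat \<Rightarrow> nat \<Rightarrow> nat \<Rightarrow> 'c" where
  "wick i j k l = e i * (e j * (e k * e l)) + kron i j *\<^sub>R (e k * e l) - kron i k *\<^sub>R (e j * e l)
     + kron i l *\<^sub>R (e j * e k) + kron j k *\<^sub>R (e i * e l) - kron j l *\<^sub>R (e i * e k)
     + kron k l *\<^sub>R (e i * e j)
     + (kron i j * kron k l - kron i k * kron j l + kron i l * kron j k) *\<^sub>R 1"

lemma wick_swap:
  assumes "i \<in> I" "j \<in> I" "k \<in> I" "l \<in> I"
  shows "wick j i k l = - wick i j k l" "wick i k j l = - wick i j k l" "wick i j l k = - wick i j k l"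
proof -
  \<comment> \<open>Each exchange of neighbours produces terms with a factor 2; splitting them into
    two copies lets simplification cancel them one by one.\<close>
  have dbl: "(c * 2) *\<^sub>R x = c *\<^sub>R x + c *\<^sub>R x" "(c * (d * 2)) *\<^sub>R x = (c * d) *\<^sub>R x + (c * d) *\<^sub>R x"
    "(2 * c) *\<^sub>R x = c *\<^sub>R x + c *\<^sub>R x"
    for c d and x :: 'c
    by (simp_all only: scaleR_add_left[symmetric] mult_2_right mult_2 distrib_left distrib_right)
  show "wick j i k l = - wick i j k l"
    unfolding wick_def swap[OF assms(1,2)] swap_left[OF assms(1,2)]
    by (simp add: algebra_simps kron_commute dbl)
  show "wick i k j l = - wick i j k l"
    unfolding wick_def swap[OF assms(2,3)] swap_left[OF assms(2,3)]
    by (simp add: algebra_simps kron_commute dbl)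
  show "wick i j l k = - wick i j k l"
    unfolding wick_def swap[OF assms(3,4)] swap_left[OF assms(3,4)]
    by (simp add: algebra_simps kron_commute dbl)
qed


lemma wick_diag: "i \<in> I \<Longrightarrow> k \<in> I \<Longrightarrow> l \<in> I \<Longrightarrow> wick i i k l = 0"
  using wick_swap(1)[of i i k l] by (simp add: eq_neg_iff_add_eq_0 flip: scaleR_2)

lemma wick_distinct: "distinct [i, j, k, l] \<Longrightarrow> wick i j k l = e i * e j * e k * e l"
  by (simp add: wick_def kron_def mult.assoc)

text \<open>Of the six single contractions in \<open>wick\<close>, those of \<open>i\<close> with
  \<open>j\<close> and of \<open>k\<close> with \<open>l\<close> die by antisymmetry of
  \<open>R\<close>. Each of the other four is a contraction with the symmetric matrix
  \<open>A\<close> and gives \<open>- \<rho>\<close>; the two remaining double contractions give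
  \<open>\<rho>\<close> each. The total is \<open>- 2 * \<rho>\<close>.\<close>

lemma curvature_contraction:
  fixes R :: "nat \<Rightarrow> nat \<Rightarrow> nat \<Rightarrow> nat \<Rightarrow> real"
  assumes anti: "\<And>i j k l. R i j k l = - R j i k l" and pair: "\<And>i j k l. R i j k l = R k l i j"
  shows "(\<Sum>i\<in>I. \<Sum>j\<in>I. \<Sum>k\<in>I. \<Sum>l\<in>I. R i j k l *\<^sub>R (e i * e j * e k * e l)) =
    (\<Sum>i\<in>I. \<Sum>j\<in>I. \<Sum>k\<in>I. \<Sum>l\<in>I. R i j k l *\<^sub>R wick i j k l)
      - (2 * (\<Sum>i\<in>I. \<Sum>j\<in>I. R i j i j)) *\<^sub>R 1"
proof -
  have anti2: "R i j k l = - R i j l k" for i j k l using pair[of i j k l] anti[of k l i j] pair[of l k i j] by simp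
  have z: "R i i k l = 0" "R k l i i = 0" for i k l
    using anti[of i i k l] anti2[of k l i i] by simp_all
  define A where "A j l = (\<Sum>i\<in>I. R i j i l)" for j l
  define \<rho> where "\<rho> = (\<Sum>j\<in>I. A j j)"
  have rho: "\<rho> = (\<Sum>i\<in>I. \<Sum>j\<in>I. R i j i j)"
    unfolding \<rho>_def A_def by (rule sum.swap)
  have A: "(\<Sum>j\<in>I. \<Sum>l\<in>I. A j l *\<^sub>R (e j * e l)) = (- \<rho>) *\<^sub>R 1"
    unfolding \<rho>_def by (rule symmetric_contraction) (simp add: A_def pair[of _ _ _ "_::nat"])
  have rot: "(\<Sum>i\<in>I. \<Sum>j\<in>I. \<Sum>l\<in>I. R i j i l *\<^sub>R (e j * e l)) = (- \<rho>) *\<^sub>R 1"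
  proof -
    have "(\<Sum>i\<in>I. \<Sum>j\<in>I. \<Sum>l\<in>I. R i j i l *\<^sub>R (e j * e l))
      = (\<Sum>j\<in>I. \<Sum>i\<in>I. \<Sum>l\<in>I. R i j i l *\<^sub>R (e j * e l))"
      by (rule sum.swap)
    also have "\<dots> = (\<Sum>j\<in>I. \<Sum>l\<in>I. \<Sum>i\<in>I. R i j i l *\<^sub>R (e j * e l))"
      by (intro sum.cong refl sum.swap)
    also have "\<dots> = (\<Sum>j\<in>I. \<Sum>l\<in>I. A j l *\<^sub>R (e j * e l))"
      by (simp add: A_def scaleR_sum_left)
    finally show ?thesis using A by simp
  qed
  have rot2: "(\<Sum>i\<in>I. \<Sum>j\<in>I. \<Sum>l\<in>I. R j i j l *\<^sub>R (e i * e l)) = (- \<rho>) *\<^sub>R 1"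
    using rot by (subst sum.swap)
  \<comment> \<open>The signs of the contractions are absorbed into the order of the indices of
    \<open>R\<close>, so that each surviving term has the shape treated in \<open>rot\<close> or
    \<open>rot2\<close>.\<close>
  have split: "R i j k l *\<^sub>R (e i * e j * e k * e l) = R i j k l *\<^sub>R wick i j k l
      + kron i k *\<^sub>R R i j k l *\<^sub>R (e j * e l) + kron i l *\<^sub>R R i j l k *\<^sub>R (e j * e k)
      + kron j k *\<^sub>R R j i k l *\<^sub>R (e i * e l) + kron j l *\<^sub>R R j i l k *\<^sub>R (e i * e k)
      + kron i k *\<^sub>R kron j l *\<^sub>R R i j k l *\<^sub>R 1 + kron i l *\<^sub>R kron j k *\<^sub>R R i j l k *\<^sub>R 1" for i j k l
  proof -
    have "kron i j * R i j k l = 0" "kron k l * R i j k l = 0"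
      by (auto simp: kron_def z)
    then have "(kron i j * R i j k l) *\<^sub>R (e k * e l) = 0" "(kron k l * R i j k l) *\<^sub>R (e i * e j) = 0"
      "(kron i j * (kron k l * R i j k l)) *\<^sub>R (1::'c) = 0"
      by auto
    moreover have "R i j l k = - R i j k l" "R j i k l = - R i j k l" "R j i l k = R i j k l"
      using anti[of i j k l] anti2[of i j k l] anti2[of j i k l] by auto
    ultimately show ?thesis
      by (simp add: wick_def algebra_simps del: scaleR_eq_0_iff)
  qed
  have t: "(\<Sum>i\<in>I. \<Sum>j\<in>I. \<Sum>k\<in>I. \<Sum>l\<in>I. kron i k *\<^sub>R R i j k l *\<^sub>R (e j * e l)) = (- \<rho>) *\<^sub>R 1"
    "(\<Sum>i\<in>I. \<Sum>j\<in>I. \<Sum>k\<in>I. \<Sum>l\<in>I. kron i l *\<^sub>R R i j l k *\<^sub>R (e j * e k)) = (- \<rho>) *\<^sub>R 1"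
    "(\<Sum>i\<in>I. \<Sum>j\<in>I. \<Sum>k\<in>I. \<Sum>l\<in>I. kron j k *\<^sub>R R j i k l *\<^sub>R (e i * e l)) = (- \<rho>) *\<^sub>R 1"
    "(\<Sum>i\<in>I. \<Sum>j\<in>I. \<Sum>k\<in>I. \<Sum>l\<in>I. kron j l *\<^sub>R R j i l k *\<^sub>R (e i * e k)) = (- \<rho>) *\<^sub>R 1"
    unfolding rot[symmetric]
    by (simp_all only: scaleR_sum_right[symmetric] sum_kron rot rot2 cong: sum.cong)
  have t': "(\<Sum>i\<in>I. \<Sum>j\<in>I. \<Sum>k\<in>I. \<Sum>l\<in>I. kron i k *\<^sub>R kron j l *\<^sub>R R i j k l *\<^sub>R (1::'c)) = \<rho> *\<^sub>R 1"
    "(\<Sum>i\<in>I. \<Sum>j\<in>I. \<Sum>k\<in>I. \<Sum>l\<in>I. kron i l *\<^sub>R kron j k *\<^sub>R R i j l k *\<^sub>R (1::'c)) = \<rho> *\<^sub>R 1"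
    unfolding rho by (simp_all only: scaleR_sum_right[symmetric] sum_kron scaleR_sum_left cong: sum.cong)
  show ?thesis
    unfolding split sum.distrib t t' rho[symmetric]
    by (simp add: algebra_simps flip: scaleR_add_left)
qed

lemma sum_rotate:
  "(\<Sum>j\<in>I. \<Sum>k\<in>I. \<Sum>l\<in>I. G k l j) = (\<Sum>j\<in>I. \<Sum>k\<in>I. \<Sum>l\<in>I. G j k l :: 'a::comm_monoid_add)"
proof -
  have "(\<Sum>j\<in>I. \<Sum>k\<in>I. \<Sum>l\<in>I. G k l j) = (\<Sum>k\<in>I. \<Sum>j\<in>I. \<Sum>l\<in>I. G k l j)"
    by (rule sum.swap)
  also have "\<dots> = (\<Sum>k\<in>I. \<Sum>l\<in>I. \<Sum>j\<in>I. G k l j)"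
    by (intro sum.cong refl sum.swap)
  finally show ?thesis .
qed

text \<open>Since \<open>wick\<close> is antisymmetric, renaming indices shows that replacing
  \<open>R\<close> by \<open>alt3 R\<close> triples the sum. The product of \<open>alt3 R\<close>
  and \<open>wick\<close> is totally symmetric, so its sum is \<open>24\<close> times the ordered
  one, and \<open>24 / 3 = 8\<close>.\<close>

lemma sum_wick_ordered:
  fixes R :: "nat \<Rightarrow> nat \<Rightarrow> nat \<Rightarrow> nat \<Rightarrow> real"
  assumes anti: "\<And>i j k l. R i j k l = - R j i k l" and pair: "\<And>i j k l. R i j k l = R k l i j"
    and I: "I = {1..n}"
  shows "(\<Sum>i\<in>I. \<Sum>j\<in>I. \<Sum>k\<in>I. \<Sum>l\<in>I. R i j k l *\<^sub>R wick i j k l) =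
    8 *\<^sub>R (\<Sum>i=1..n. \<Sum>j=i+1..n. \<Sum>k=j+1..n. \<Sum>l=k+1..n. alt3 R i j k l *\<^sub>R (e i * e j * e k * e l))"
proof -
  have anti2: "R i j k l = - R i j l k" for i j k l using pair[of i j k l] anti[of k l i j] pair[of l k i j] by simp
  \<comment> \<open>Cutting off outside \<open>I\<close> makes the symmetries unconditional, as
    \<open>sum4_symmetric\<close> demands; \<open>wick_swap\<close> holds only for indices in
    \<open>I\<close>.\<close>
  define P where "P i j k l = (if {i, j, k, l} \<subseteq> I then alt3 R i j k l *\<^sub>R wick i j k l else 0)" for i j k l
  have sw: "alt3 R j i k l = - alt3 R i j k l" "alt3 R i k j l = - alt3 R i j k l"
    "alt3 R i j l k = - alt3 R i j k l" for i j k l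
    unfolding alt3_def
    using anti[of i j k l] anti[of l i j k] anti[of k i j l] pair[of j k l i] pair[of j l i k]
      pair[of i l j k] pair[of i k j l] pair[of i j k l] pair[of i l k j] pair[of i k l j]
      anti2[of i j k l] anti2[of i k j l] anti2[of i l j k]
      pair[of l i j k] pair[of k i j l] anti[of i l j k] anti[of i k j l]
    by linarith+
  have "P i j k l = P j i k l" "P i j k l = P i k j l" "P i j k l = P i j l k" "P i i k l = 0" for i j k l
    using wick_swap[of i j k l] sw(1)[of j i k l] sw(2)[of i k j l] sw(3)[of i j l k] wick_diag[of i k l]
    by (auto simp: P_def insert_commute)
  then have "(\<Sum>i=1..n. \<Sum>j=1..n. \<Sum>k=1..n. \<Sum>l=1..n. P i j k l) =
    24 *\<^sub>R (\<Sum>i=1..n. \<Sum>j=i+1..n. \<Sum>k=j+1..n. \<Sum>l=k+1..n. P i j k l)"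
    by (intro sum4_symmetric)
  also have "(\<Sum>i=1..n. \<Sum>j=i+1..n. \<Sum>k=j+1..n. \<Sum>l=k+1..n. P i j k l)
     = (\<Sum>i=1..n. \<Sum>j=i+1..n. \<Sum>k=j+1..n. \<Sum>l=k+1..n. alt3 R i j k l *\<^sub>R (e i * e j * e k * e l))"
    by (intro sum.cong refl) (auto simp: P_def I wick_distinct)
  also have "(\<Sum>i=1..n. \<Sum>j=1..n. \<Sum>k=1..n. \<Sum>l=1..n. P i j k l)
     = (\<Sum>i\<in>I. \<Sum>j\<in>I. \<Sum>k\<in>I. \<Sum>l\<in>I. alt3 R i j k l *\<^sub>R wick i j k l)"
    unfolding I[symmetric] by (intro sum.cong refl) (auto simp: P_def)
  also have "\<dots> = (\<Sum>i\<in>I. \<Sum>j\<in>I. \<Sum>k\<in>I. \<Sum>l\<in>I. R i j k l *\<^sub>R wick i j k l)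
      + (\<Sum>i\<in>I. \<Sum>j\<in>I. \<Sum>k\<in>I. \<Sum>l\<in>I. R i k l j *\<^sub>R wick i j k l)
      + (\<Sum>i\<in>I. \<Sum>j\<in>I. \<Sum>k\<in>I. \<Sum>l\<in>I. R i l j k *\<^sub>R wick i j k l)"
    by (simp add: alt3_def scaleR_add_left sum.distrib)
  also have "(\<Sum>i\<in>I. \<Sum>j\<in>I. \<Sum>k\<in>I. \<Sum>l\<in>I. R i k l j *\<^sub>R wick i j k l)
     = (\<Sum>i\<in>I. \<Sum>j\<in>I. \<Sum>k\<in>I. \<Sum>l\<in>I. R i k l j *\<^sub>R wick i k l j)"
    by (intro sum.cong refl) (metis wick_swap(2,3) minus_minus)
  also have "\<dots> = (\<Sum>i\<in>I. \<Sum>j\<in>I. \<Sum>k\<in>I. \<Sum>l\<in>I. R i j k l *\<^sub>R wick i j k l)"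
    by (intro sum.cong refl sum_rotate)
  also have "(\<Sum>i\<in>I. \<Sum>j\<in>I. \<Sum>k\<in>I. \<Sum>l\<in>I. R i l j k *\<^sub>R wick i j k l)
     = (\<Sum>i\<in>I. \<Sum>j\<in>I. \<Sum>k\<in>I. \<Sum>l\<in>I. R i l j k *\<^sub>R wick i l j k)"
    by (intro sum.cong refl) (metis wick_swap(2,3) minus_minus)
  also have "\<dots> = (\<Sum>i\<in>I. \<Sum>j\<in>I. \<Sum>k\<in>I. \<Sum>l\<in>I. R i j k l *\<^sub>R wick i j k l)"
    by (intro sum.cong refl sum_rotate[symmetric])
  finally have "3 *\<^sub>R (\<Sum>i\<in>I. \<Sum>j\<in>I. \<Sum>k\<in>I. \<Sum>l\<in>I. R i j k l *\<^sub>R wick i j k l)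
     = 3 *\<^sub>R 8 *\<^sub>R (\<Sum>i=1..n. \<Sum>j=i+1..n. \<Sum>k=j+1..n. \<Sum>l=k+1..n. alt3 R i j k l *\<^sub>R (e i * e j * e k * e l))"
    by (simp flip: scaleR_2 scaleR_add_left[of 2 1, simplified])
  then show ?thesis by (simp only: scaleR_cancel_left) simp
qed

end

section \<open>Quadratic and cubic Clifford elements\<close>

context clifford_frame begin

definition quadratic :: "(nat \<Rightarrow> nat \<Rightarrow> real) \<Rightarrow> 'c" where
  "quadratic y = (\<Sum>a\<in>I. \<Sum>b\<in>I. y a b *\<^sub>R (e a * e b))"

text \<open>Passing \<open>e q\<close> through a product of two generators leaves two contractions,
  each with a factor 2, and antisymmetry of \<open>y\<close> makes them equal. Thus a skew matrix
  acts on vectors by commutators up to the factor 4, which is the reason for the \<open>1/4\<close>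
  in \<open>ad_lift\<close>.\<close>

lemma quadratic_commutator:
  assumes anti: "\<And>a b. y a b = - y b a" and q: "q \<in> I"
  shows "e q * quadratic y - quadratic y * e q = (- 4) *\<^sub>R (\<Sum>p\<in>I. y q p *\<^sub>R e p)"
proof -
  have pair: "e q * (e a * e b) - (e a * e b) * e q = 2 *\<^sub>R kron q b *\<^sub>R e a - 2 *\<^sub>R kron q a *\<^sub>R e b"
    if "a \<in> I" "b \<in> I" for a b
  proof -
    have "e q * (e a * e b) = - (e a * (e q * e b)) - (2 * kron a q) *\<^sub>R e b"
      by (rule swap_left[OF that(1) q])
    also have "e q * e b = - (e b * e q) - (2 * kron b q) *\<^sub>R 1"
      by (rule swap[OF that(2) q])
    finally show ?thesis
      by (simp add: algebra_simps kron_commute)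
  qed
  have "e q * quadratic y - quadratic y * e q
      = (\<Sum>a\<in>I. \<Sum>b\<in>I. y a b *\<^sub>R (e q * (e a * e b) - (e a * e b) * e q))"
    by (simp add: quadratic_def sum_distrib_left sum_distrib_right sum_subtractf scaleR_diff_right)
  also have "\<dots> = (\<Sum>a\<in>I. \<Sum>b\<in>I. kron q b *\<^sub>R (2 * y a b) *\<^sub>R e a) - (\<Sum>a\<in>I. \<Sum>b\<in>I. kron q a *\<^sub>R (2 * y a b) *\<^sub>R e b)"
    unfolding sum_subtractf[symmetric]
    by (intro sum.cong refl) (simp only: pair, simp add: algebra_simps)
  also have "(\<Sum>a\<in>I. \<Sum>b\<in>I. kron q b *\<^sub>R (2 * y a b) *\<^sub>R e a) = (\<Sum>a\<in>I. (2 * y a q) *\<^sub>R e a)"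
    using q by (simp only: sum_kron)
  also have "(\<Sum>a\<in>I. \<Sum>b\<in>I. kron q a *\<^sub>R (2 * y a b) *\<^sub>R e b) = (\<Sum>b\<in>I. (2 * y q b) *\<^sub>R e b)"
    using q by (simp only: scaleR_sum_right[symmetric] sum_kron)
  also have "(\<Sum>a\<in>I. (2 * y a q) *\<^sub>R e a) - (\<Sum>b\<in>I. (2 * y q b) *\<^sub>R e b) = (\<Sum>a\<in>I. (-4 * y q a) *\<^sub>R e a)"
    unfolding sum_subtractf[symmetric] 
  proof (intro sum.cong refl)
    fix a
    show "(2 * y a q) *\<^sub>R e a - (2 * y q a) *\<^sub>R e a = (- 4 * y q a) *\<^sub>R e a"
      unfolding scaleR_diff_left[symmetric] using anti[of a q] by simp
  qed
  finally show ?thesis by (simp add: scaleR_sum_right)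
qed

text \<open>\<open>K\<close> has simple anticommutators with the generators: each of its three slots
  contributes \<open>- 2\<close> times \<open>F q\<close>. The square is therefore reduced to
  anticommutators, which leave only the squares of the \<open>F k\<close> and a trace.\<close>

lemma cubic_square:
  fixes c :: "nat \<Rightarrow> nat \<Rightarrow> nat \<Rightarrow> real"
  assumes c12: "\<And>i j k. c i j k = - c j i k" and c23: "\<And>i j k. c i j k = - c i k j"
  defines "F \<equiv> \<lambda>k. quadratic (\<lambda>a b. c a b k)"
  defines "K \<equiv> \<Sum>k\<in>I. F k * e k"
  defines "R \<equiv> \<lambda>i j k l. \<Sum>m\<in>I. c i j m * c k l m"
  shows cubic_anticommutator: "\<And>q. q \<in> I \<Longrightarrow> e q * K + K * e q = (- 6) *\<^sub>R F q"
    and "K * K = (- 9) *\<^sub>R (\<Sum>k\<in>I. F k * F k) - (12 * (\<Sum>i\<in>I. \<Sum>j\<in>I. R i j i j)) *\<^sub>R 1"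
    and "(\<Sum>k\<in>I. F k * F k) = (\<Sum>i\<in>I. \<Sum>j\<in>I. \<Sum>k\<in>I. \<Sum>l\<in>I. R i j k l *\<^sub>R (e i * e j * e k * e l))"
proof -
  have cyc: "c i j k = c j k i" for i j k
    using c12[of i j k] c23[of j i k] by simp
  have comm: "e q * F b - F b * e q = (- 4) *\<^sub>R (\<Sum>p\<in>I. c q p b *\<^sub>R e p)" if "q \<in> I" for q b
    unfolding F_def by (rule quadratic_commutator[OF c12 that])
  show anti: "e q * K + K * e q = (- 6) *\<^sub>R F q" if q: "q \<in> I" for q
  proof -
    have "e q * K + K * e q = (\<Sum>k\<in>I. (e q * F k - F k * e q) * e k) + (\<Sum>k\<in>I. F k * (e q * e k + e k * e q))"
      unfolding K_def sum_distrib_left sum_distrib_right sum.distrib[symmetric]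
      by (intro sum.cong refl) (simp add: algebra_simps)
    also have "(\<Sum>k\<in>I. (e q * F k - F k * e q) * e k) = (-4) *\<^sub>R (\<Sum>k\<in>I. \<Sum>p\<in>I. c q p k *\<^sub>R (e p * e k))"
      by (simp add: comm[OF q] scaleR_sum_right sum_distrib_right)
    also have "(\<Sum>k\<in>I. \<Sum>p\<in>I. c q p k *\<^sub>R (e p * e k)) = F q"
      unfolding F_def quadratic_def by (subst sum.swap) (simp add: cyc[of q])
    also have "(\<Sum>k\<in>I. F k * (e q * e k + e k * e q)) = (\<Sum>k\<in>I. kron q k *\<^sub>R (- 2) *\<^sub>R F k)"
      by (intro sum.cong refl) (simp add: anticommute q)
    also have "\<dots> = (- 2) *\<^sub>R F q" by (rule sum_kron[OF q])
    finally show ?thesis by (simp flip: scaleR_add_left scaleR_minus_left)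
  qed
  define D where "D = (\<Sum>i\<in>I. \<Sum>j\<in>I. R i j i j)"
  have KF: "K * F k - F k * K = (-12) *\<^sub>R (\<Sum>a\<in>I. \<Sum>b\<in>I. c a b k *\<^sub>R (F a * e b))
      + 24 *\<^sub>R (\<Sum>p\<in>I. (\<Sum>a\<in>I. \<Sum>b\<in>I. c a b k * c a b p) *\<^sub>R e p)" if k: "k \<in> I" for k
  proof -
    \<comment> \<open>A commutator with a product is a combination of anticommutators:
      \<open>K a b - a b K = (K a + a K) b - a (K b + b K)\<close>.\<close>
    have "K * F k - F k * K = (\<Sum>a\<in>I. \<Sum>b\<in>I. c a b k *\<^sub>R ((e a * K + K * e a) * e b - e a * (e b * K + K * e b)))"
      unfolding F_def quadratic_def sum_distrib_left sum_distrib_right sum_subtractf[symmetric]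
      by (intro sum.cong refl) (simp add: algebra_simps)
    also have "\<dots> = (\<Sum>a\<in>I. \<Sum>b\<in>I. (-6) *\<^sub>R c a b k *\<^sub>R (F a * e b) + 6 *\<^sub>R c a b k *\<^sub>R (e a * F b))"
      by (intro sum.cong refl) (simp only: anti, simp add: algebra_simps)
    also have "\<dots> = (-6) *\<^sub>R (\<Sum>a\<in>I. \<Sum>b\<in>I. c a b k *\<^sub>R (F a * e b)) + 6 *\<^sub>R (\<Sum>a\<in>I. \<Sum>b\<in>I. c a b k *\<^sub>R (e a * F b))"
      by (simp only: sum.distrib scaleR_sum_right)
    \<comment> \<open>Renaming the indices and moving \<open>e b\<close> past \<open>F a\<close>
      brings this sum to the shape of the first one; the commutators leave a term linear in the
      generators.\<close>
    also have "(\<Sum>a\<in>I. \<Sum>b\<in>I. c a b k *\<^sub>R (e a * F b)) = (\<Sum>a\<in>I. \<Sum>b\<in>I. - (c a b k *\<^sub>R (e b * F a)))"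
      by (subst sum.swap, intro sum.cong refl) (use c12 in \<open>metis scaleR_minus_left\<close>)
    also have "\<dots> = (\<Sum>a\<in>I. \<Sum>b\<in>I. - (c a b k *\<^sub>R (F a * e b)) + c a b k *\<^sub>R 4 *\<^sub>R (\<Sum>p\<in>I. c a b p *\<^sub>R e p))"
    proof (intro sum.cong refl)
      fix a b assume "a \<in> I" "b \<in> I"
      have "e b * F a = F a * e b + (- 4) *\<^sub>R (\<Sum>p\<in>I. c b p a *\<^sub>R e p)"
        using comm[OF \<open>b \<in> I\<close>, of a] by (simp add: algebra_simps)
      also have "(\<Sum>p\<in>I. c b p a *\<^sub>R e p) = (\<Sum>p\<in>I. c a b p *\<^sub>R e p)" by (simp add: cyc[of a b])
      finally have eq: "e b * F a = F a * e b + (- 4) *\<^sub>R (\<Sum>p\<in>I. c a b p *\<^sub>R e p)" .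
      show "- (c a b k *\<^sub>R (e b * F a)) = - (c a b k *\<^sub>R (F a * e b)) + c a b k *\<^sub>R 4 *\<^sub>R (\<Sum>p\<in>I. c a b p *\<^sub>R e p)"
        unfolding eq by (simp add: scaleR_add_right scaleR_diff_right)
    qed
    also have "\<dots> = - (\<Sum>a\<in>I. \<Sum>b\<in>I. c a b k *\<^sub>R (F a * e b)) + 4 *\<^sub>R (\<Sum>a\<in>I. \<Sum>b\<in>I. \<Sum>p\<in>I. (c a b k * c a b p) *\<^sub>R e p)"
      by (simp add: sum.distrib sum_subtractf sum_negf scaleR_sum_right mult_ac)
    also have "(\<Sum>a\<in>I. \<Sum>b\<in>I. \<Sum>p\<in>I. (c a b k * c a b p) *\<^sub>R e p) = (\<Sum>p\<in>I. \<Sum>a\<in>I. \<Sum>b\<in>I. (c a b k * c a b p) *\<^sub>R e p)"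
      by (rule sum_rotate[symmetric])
    also have "\<dots> = (\<Sum>p\<in>I. (\<Sum>a\<in>I. \<Sum>b\<in>I. c a b k * c a b p) *\<^sub>R e p)"
      by (simp add: scaleR_sum_left)
    finally show ?thesis by (simp add: algebra_simps flip: scaleR_add_left)
  qed
  have D: "(\<Sum>k\<in>I. \<Sum>a\<in>I. \<Sum>b\<in>I. c a b k * c a b k) = D"
    unfolding D_def R_def by (rule sum_rotate)
  have K1: "(\<Sum>k\<in>I. K * F k * e k) = K * K" "(\<Sum>k\<in>I. F k * e k * K) = K * K"
    by (simp_all only: mult.assoc sum_distrib_left[symmetric] K_def[symmetric])
      (simp only: mult.assoc[symmetric] sum_distrib_right[symmetric] K_def[symmetric])
  \<comment> \<open>The two expansions in \<open>K1\<close> have \<open>K\<close> on the left and on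
    the right. In their sum, moving \<open>K\<close> inwards produces one commutator with
    \<open>F k\<close> and one anticommutator with \<open>e k\<close>, both already known.\<close>
  have "2 *\<^sub>R (K * K) = (\<Sum>k\<in>I. (K * F k - F k * K) * e k + F k * (e k * K + K * e k))"
  proof -
    have "(\<Sum>k\<in>I. (K * F k - F k * K) * e k + F k * (e k * K + K * e k)) = (\<Sum>k\<in>I. K * F k * e k + F k * e k * K)"
      by (intro sum.cong refl) (simp add: algebra_simps)
    then show ?thesis by (simp only: scaleR_2 sum.distrib K1)
  qed
  also have "\<dots> = (\<Sum>k\<in>I. (-12) *\<^sub>R (\<Sum>a\<in>I. \<Sum>b\<in>I. c a b k *\<^sub>R (F a * (e b * e k)))
      + 24 *\<^sub>R (\<Sum>p\<in>I. (\<Sum>a\<in>I. \<Sum>b\<in>I. c a b k * c a b p) *\<^sub>R (e p * e k))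
      - 6 *\<^sub>R (F k * F k))"
    by (intro sum.cong refl) (simp only: KF anti, simp add: sum_distrib_right mult.assoc algebra_simps)
  also have "\<dots> = (-12) *\<^sub>R (\<Sum>k\<in>I. \<Sum>a\<in>I. \<Sum>b\<in>I. c a b k *\<^sub>R (F a * (e b * e k)))
      + 24 *\<^sub>R (\<Sum>k\<in>I. \<Sum>p\<in>I. (\<Sum>a\<in>I. \<Sum>b\<in>I. c a b k * c a b p) *\<^sub>R (e p * e k))
      - 6 *\<^sub>R (\<Sum>k\<in>I. F k * F k)"
    by (simp only: sum.distrib sum_subtractf scaleR_sum_right)
  also have "(\<Sum>k\<in>I. \<Sum>a\<in>I. \<Sum>b\<in>I. c a b k *\<^sub>R (F a * (e b * e k)))
      = (\<Sum>k\<in>I. \<Sum>a\<in>I. \<Sum>b\<in>I. c b k a *\<^sub>R (F a * (e b * e k)))"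
    by (simp only: cyc[symmetric])
  also have "\<dots> = (\<Sum>a\<in>I. \<Sum>b\<in>I. \<Sum>k\<in>I. c b k a *\<^sub>R (F a * (e b * e k)))"
    by (rule sum_rotate)
  also have "\<dots> = (\<Sum>k\<in>I. F k * F k)"
    by (intro sum.cong refl) (simp add: F_def quadratic_def sum_distrib_left)
  also have "(\<Sum>k\<in>I. \<Sum>p\<in>I. (\<Sum>a\<in>I. \<Sum>b\<in>I. c a b k * c a b p) *\<^sub>R (e p * e k))
      = (\<Sum>k\<in>I. \<Sum>p\<in>I. (\<Sum>a\<in>I. \<Sum>b\<in>I. c a b k * c a b p) *\<^sub>R (e k * e p))"
    by (subst sum.swap) (simp add: mult.commute)
  also have "\<dots> = (- D) *\<^sub>R 1"
    unfolding D[symmetric] by (rule symmetric_contraction) (simp add: mult.commute)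
  also have "(-12) *\<^sub>R (\<Sum>k\<in>I. F k * F k) + 24 *\<^sub>R ((- D) *\<^sub>R 1) - 6 *\<^sub>R (\<Sum>k\<in>I. F k * F k)
      = 2 *\<^sub>R ((- 9) *\<^sub>R (\<Sum>k\<in>I. F k * F k) - (12 * D) *\<^sub>R 1)"
  proof -
    have "(-12) *\<^sub>R x - 6 *\<^sub>R x = (-18) *\<^sub>R x" for x :: 'c
      by (simp only: scaleR_diff_left[symmetric]) simp
    from this[of "\<Sum>k\<in>I. F k * F k"] show ?thesis by (simp add: scaleR_diff_right algebra_simps)
  qed
  finally have "2 *\<^sub>R (K * K) = 2 *\<^sub>R ((- 9) *\<^sub>R (\<Sum>k\<in>I. F k * F k) - (12 * D) *\<^sub>R 1)" .
  then show "K * K = (- 9) *\<^sub>R (\<Sum>k\<in>I. F k * F k) - (12 * (\<Sum>i\<in>I. \<Sum>j\<in>I. R i j i j)) *\<^sub>R 1"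
    unfolding D_def[symmetric] by (simp only: scaleR_cancel_left) simp
  have "(\<Sum>m\<in>I. F m * F m) = (\<Sum>m\<in>I. \<Sum>i\<in>I. \<Sum>j\<in>I. \<Sum>k\<in>I. \<Sum>l\<in>I. (c i j m * c k l m) *\<^sub>R (e i * e j * e k * e l))"
    unfolding F_def quadratic_def sum_distrib_right unfolding sum_distrib_left
    by (intro sum.cong refl) (simp add: mult.assoc)
  also have "\<dots> = (\<Sum>i\<in>I. \<Sum>j\<in>I. \<Sum>m\<in>I. \<Sum>k\<in>I. \<Sum>l\<in>I. (c i j m * c k l m) *\<^sub>R (e i * e j * e k * e l))"
    by (rule sum_rotate)
  also have "\<dots> = (\<Sum>i\<in>I. \<Sum>j\<in>I. \<Sum>k\<in>I. \<Sum>l\<in>I. \<Sum>m\<in>I. (c i j m * c k l m) *\<^sub>R (e i * e j * e k * e l))"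
    by (intro sum.cong refl sum_rotate)
  finally show "(\<Sum>k\<in>I. F k * F k) = (\<Sum>i\<in>I. \<Sum>j\<in>I. \<Sum>k\<in>I. \<Sum>l\<in>I. R i j k l *\<^sub>R (e i * e j * e k * e l))"
    by (simp only: R_def scaleR_sum_left)
qed

end

section \<open>Twice differentiable maps\<close>

text \<open>The derivative \<open>f'\<close> is only meaningful near \<open>x\<close>; second derivatives are needed at \<open>x\<close> alone.\<close>

definition twice_differentiable ::
  "('a::euclidean_space \<Rightarrow> 'b::real_normed_vector) \<Rightarrow> ('a \<Rightarrow> 'a \<Rightarrow> 'b) \<Rightarrow> ('a \<Rightarrow> 'a \<Rightarrow> 'b) \<Rightarrow> 'a \<Rightarrow> bool" where
  "twice_differentiable f f' f'' x \<longleftrightarrow>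
     (\<forall>\<^sub>F y in nhds x. (f has_derivative f' y) (at y)) \<and>
     (\<forall>v. ((\<lambda>y. f' y v) has_derivative (\<lambda>w. f'' w v)) (at x))"

lemma twice_differentiable_first:
  "twice_differentiable f f' f'' x \<Longrightarrow> (f has_derivative f' x) (at x)"
  unfolding twice_differentiable_def by (blast dest: eventually_nhds_x_imp_x)

text \<open>The definition controls \<open>f''\<close> only for each fixed \<open>v\<close>.
  Linearity in \<open>v\<close> is inherited from the maps \<open>f' y\<close> near
  \<open>x\<close>, by uniqueness of derivatives.\<close>

lemma twice_differentiable_second_linear:
  assumes "twice_differentiable f f' f'' x"
  shows "linear (f'' w)"
proof
  have lin: "\<forall>\<^sub>F y in nhds x. linear (f' y)"
    using assms unfolding twice_differentiable_def
    by (auto elim: eventually_mono intro: has_derivative_linear)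
  have d: "((\<lambda>y. f' y v) has_derivative (\<lambda>w. f'' w v)) (at x)" for v
    using assms by (simp add: twice_differentiable_def)
  have x: "linear (f' x)" using lin by (rule eventually_nhds_x_imp_x)
  fix u v and c :: real
  have "((\<lambda>y. f' y u + f' y v) has_derivative (\<lambda>w. f'' w (u + v))) (at x)"
    by (rule has_derivative_transform_eventually[OF d[of "u + v"]])
      (use lin x in \<open>auto simp: linear_add eventually_at_filter elim!: eventually_mono\<close>)
  moreover have "((\<lambda>y. f' y u + f' y v) has_derivative (\<lambda>w. f'' w u + f'' w v)) (at x)"
    by (intro has_derivative_add d)
  ultimately show "f'' w (u + v) = f'' w u + f'' w v"
    by (metis has_derivative_unique)
  have "((\<lambda>y. c *\<^sub>R f' y u) has_derivative (\<lambda>w. f'' w (c *\<^sub>R u))) (at x)"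
    by (rule has_derivative_transform_eventually[OF d[of "c *\<^sub>R u"]])
      (use lin x in \<open>auto simp: linear_scale eventually_at_filter elim!: eventually_mono\<close>)
  moreover have "((\<lambda>y. c *\<^sub>R f' y u) has_derivative (\<lambda>w. c *\<^sub>R f'' w u)) (at x)"
    by (intro has_derivative_scaleR_right d)
  ultimately show "f'' w (c *\<^sub>R u) = c *\<^sub>R f'' w u"
    by (metis has_derivative_unique)
qed

text \<open>Maps that agree near \<open>x\<close> also agree near each \<open>y\<close> close to
  \<open>x\<close>, so the same \<open>f'\<close> serves both on a whole neighbourhood.\<close>

lemma twice_differentiable_cong:
  assumes "twice_differentiable f f' f'' x" and "\<forall>\<^sub>F y in nhds x. f y = g y"
  shows "twice_differentiable g f' f'' x"
proof -
  have "\<forall>\<^sub>F y in nhds x. \<forall>\<^sub>F z in nhds y. f z = g z"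
    using assms(2) by (simp add: eventually_eventually)
  moreover have "\<forall>\<^sub>F y in nhds x. (f has_derivative f' y) (at y)"
    using assms(1) by (simp add: twice_differentiable_def)
  ultimately have "\<forall>\<^sub>F y in nhds x. (g has_derivative f' y) (at y)"
  proof eventually_elim
    case (elim y)
    show ?case
      by (rule has_derivative_transform_eventually[OF elim(2)])
        (use elim(1) in \<open>auto simp: eventually_at_filter elim: eventually_mono dest: eventually_nhds_x_imp_x\<close>)
  qed
  then show ?thesis using assms(1) by (simp add: twice_differentiable_def)
qed

text \<open>The first derivative of the composite is a moving linear map applied to a moving vector,
  but differentiability of \<open>g'\<close> is known for fixed vectors only. Expanding the vector
  in \<open>Basis\<close> turns it into a finite sum of products of differentiable
  functions.\<close>

lemma twice_differentiable_compose:
  fixes f :: "'a::euclidean_space \<Rightarrow> 'b::euclidean_space" and g :: "'b \<Rightarrow> 'c::real_normed_vector"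
  assumes f: "twice_differentiable f f' f'' x" and g: "twice_differentiable g g' g'' (f x)"
  shows "twice_differentiable (\<lambda>y. g (f y)) (\<lambda>y v. g' (f y) (f' y v))
    (\<lambda>w v. g'' (f' x w) (f' x v) + g' (f x) (f'' w v)) x"
proof -
  have f1: "\<forall>\<^sub>F y in nhds x. (f has_derivative f' y) (at y)"
    using f by (simp add: twice_differentiable_def)
  have fx: "(f has_derivative f' x) (at x)" using f by (rule twice_differentiable_first)
  have "filterlim f (nhds (f x)) (nhds x)"
    using has_derivative_continuous[OF fx] by (simp add: continuous_within tendsto_at_iff_tendsto_nhds)
  then have g1: "\<forall>\<^sub>F y in nhds x. (g has_derivative g' (f y)) (at (f y))"
    using g unfolding twice_differentiable_def filterlim_iff by blast
  have "\<forall>\<^sub>F y in nhds x. ((\<lambda>y. g (f y)) has_derivative (\<lambda>v. g' (f y) (f' y v))) (at y)"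
    using f1 g1 by eventually_elim (rule has_derivative_compose)
  moreover have "((\<lambda>y. g' (f y) (f' y v)) has_derivative (\<lambda>w. g'' (f' x w) (f' x v) + g' (f x) (f'' w v))) (at x)" for v
  proof -
    have df: "((\<lambda>y. f' y v) has_derivative (\<lambda>w. f'' w v)) (at x)"
      using f by (simp add: twice_differentiable_def)
    have dg: "((\<lambda>y. g' (f y) b) has_derivative (\<lambda>w. g'' (f' x w) b)) (at x)" for b
      using g by (intro has_derivative_compose[OF fx, of "\<lambda>z. g' z b"]) (simp add: twice_differentiable_def)
    have lin: "\<forall>\<^sub>F y in nhds x. linear (g' (f y))"
      using g1 by (auto elim!: eventually_mono intro: has_derivative_linear)
    have eq: "(\<Sum>b\<in>Basis. (u \<bullet> b) *\<^sub>R L b) = L u" if "linear L" for L :: "'b \<Rightarrow> 'c" and u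
    proof -
      have "L u = L (\<Sum>b\<in>Basis. (u \<bullet> b) *\<^sub>R b)" by (simp add: euclidean_representation)
      also have "\<dots> = (\<Sum>b\<in>Basis. (u \<bullet> b) *\<^sub>R L b)"
        using that by (simp add: linear_sum linear_scale)
      finally show ?thesis by simp
    qed
    have "((\<lambda>y. \<Sum>b\<in>Basis. (f' y v \<bullet> b) *\<^sub>R g' (f y) b) has_derivative
        (\<lambda>w. \<Sum>b\<in>Basis. (f' x v \<bullet> b) *\<^sub>R g'' (f' x w) b + (f'' w v \<bullet> b) *\<^sub>R g' (f x) b)) (at x)"
      by (intro has_derivative_sum has_derivative_scaleR has_derivative_inner_left df dg)
    moreover have "(\<Sum>b\<in>Basis. (f' x v \<bullet> b) *\<^sub>R g'' (f' x w) b + (f'' w v \<bullet> b) *\<^sub>R g' (f x) b)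
        = g'' (f' x w) (f' x v) + g' (f x) (f'' w v)" for w
      using twice_differentiable_second_linear[OF g] eventually_nhds_x_imp_x[OF lin]
      by (simp add: sum.distrib eq)
    ultimately have "((\<lambda>y. \<Sum>b\<in>Basis. (f' y v \<bullet> b) *\<^sub>R g' (f y) b) has_derivative
        (\<lambda>w. g'' (f' x w) (f' x v) + g' (f x) (f'' w v))) (at x)" by simp
    then show ?thesis
      by (rule has_derivative_transform_eventually)
        (use lin eventually_nhds_x_imp_x[OF lin] in \<open>auto simp: eventually_at_filter eq elim!: eventually_mono\<close>)
  qed
  ultimately show ?thesis by (simp add: twice_differentiable_def)
qed

lemma twice_differentiable_bounded_linear:
  assumes "bounded_linear L"
  shows "twice_differentiable (\<lambda>y. c + L y) (\<lambda>_. L) (\<lambda>_ _. 0) x"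
  unfolding twice_differentiable_def
  by (auto intro!: always_eventually derivative_eq_intros bounded_linear_imp_has_derivative assms)

lemma smooth_on_twice_differentiable:
  assumes "smooth_on S f" "open S" "x \<in> S"
  obtains f' f'' where "twice_differentiable f f' f'' x"
proof
  let ?f' = "\<lambda>y. frechet_derivative f (at y)"
  have "Ck_on (Suc (Suc 0)) S f" using assms by (simp only: smooth_on_def)
  then have "f differentiable_on S" and 2: "(\<lambda>y. ?f' y v) differentiable_on S" for v by simp_all
  then have "(f has_derivative ?f' y) (at y)" if "y \<in> S" for y
    using that assms by (auto simp: differentiable_on_eq_differentiable_at simp flip: frechet_derivative_works)
  then have "\<forall>\<^sub>F y in nhds x. (f has_derivative ?f' y) (at y)"
    using assms by (auto simp: eventually_nhds)
  moreover have "((\<lambda>y. ?f' y v) has_derivative frechet_derivative (\<lambda>y. ?f' y v) (at x)) (at x)" for v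
    using 2[of v] assms by (auto simp: differentiable_on_eq_differentiable_at simp flip: frechet_derivative_works)
  ultimately show "twice_differentiable f ?f' (\<lambda>w v. frechet_derivative (\<lambda>y. ?f' y v) (at x) w) x"
    by (simp add: twice_differentiable_def)
qed


text \<open>The mean value theorem is applied in direction \<open>u\<close> to the increment in
  direction \<open>v\<close>; the two resulting values of \<open>f' _ u\<close> are then compared
  with its linear approximation at \<open>x\<close>. This works with a second derivative at the
  single point \<open>x\<close>.\<close>

lemma second_difference_quotient:
  fixes f :: "'a::euclidean_space \<Rightarrow> real"
  assumes "twice_differentiable f f' f'' x"
  shows "((\<lambda>s. (f (x + s *\<^sub>R u + s *\<^sub>R v) - f (x + s *\<^sub>R u) - f (x + s *\<^sub>R v) + f x) / s\<^sup>2) \<longlongrightarrow> f'' v u) (at_right 0)"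
proof (rule tendstoI)
  fix e :: real assume e: "0 < e"
  \<comment> \<open>All points that occur lie within \<open>s * B\<close> of \<open>x\<close>; the
    summand 1 keeps \<open>B\<close> positive when both vectors vanish.\<close>
  define B where "B = norm u + norm v + 1"
  have B: "B > 0" by (simp add: B_def add_nonneg_pos)
  have der: "((\<lambda>y. f' y u) has_derivative (\<lambda>w. f'' w u)) (at x)"
    using assms by (simp add: twice_differentiable_def)
  then have lin: "linear (\<lambda>w. f'' w u)" by (rule has_derivative_linear)
  \<comment> \<open>With \<open>e / (4 * B)\<close> each of the two approximation errors is at most
    \<open>e / 4 * s\<close>, hence their sum at most \<open>e / 2 * s\<close>.\<close>
  obtain d1 where d1: "d1 > 0" "\<And>y. norm (y - x) < d1 \<Longrightarrow>
      norm (f' y u - f' x u - f'' (y - x) u) \<le> e / (4 * B) * norm (y - x)"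
    using der e B unfolding has_derivative_at_alt by (metis divide_pos_pos mult_pos_pos zero_less_numeral)
  obtain d2 where d2: "d2 > 0" "\<And>y. norm (y - x) < d2 \<Longrightarrow> (f has_derivative f' y) (at y)"
    using assms unfolding twice_differentiable_def eventually_nhds_metric by (auto simp: dist_norm)
  define d where "d = min d1 d2 / B"
  have d: "d > 0" using d1 d2 B by (simp add: d_def)
  have "dist ((f (x + s *\<^sub>R u + s *\<^sub>R v) - f (x + s *\<^sub>R u) - f (x + s *\<^sub>R v) + f x) / s\<^sup>2) (f'' v u) < e"
    if s: "0 < s" "s < d" for s
  proof -
    have sB: "s * B < min d1 d2" using s B by (simp add: d_def pos_less_divide_eq)
    have near: "norm (p *\<^sub>R u + q *\<^sub>R v) \<le> s * B" if "0 \<le> p" "p \<le> s" "0 \<le> q" "q \<le> s" for p q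
    proof -
      have "norm (p *\<^sub>R u + q *\<^sub>R v) \<le> p * norm u + q * norm v"
        using that by (metis abs_of_nonneg norm_scaleR norm_triangle_ineq)
      also have "\<dots> \<le> s * norm u + s * norm v"
        using that by (intro add_mono mult_right_mono) auto
      also have "\<dots> \<le> s * B" using s by (simp add: B_def algebra_simps)
      finally show ?thesis .
    qed
    have err: "norm (f' (x + w) u - f' x u - f'' w u) \<le> e / 4 * s"
      if w: "w = p *\<^sub>R u + q *\<^sub>R v" "0 \<le> p" "p \<le> s" "0 \<le> q" "q \<le> s" for w p q
    proof -
      have n: "norm w \<le> s * B" using near w by simp
      then have "norm (f' (x + w) u - f' x u - f'' w u) \<le> e / (4 * B) * norm w"
        using d1(2)[of "x + w"] sB by simp
      also have "\<dots> \<le> e / (4 * B) * (s * B)" using n e B by (intro mult_left_mono) auto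
      finally show ?thesis using B by simp
    qed
    have dd: "((\<lambda>p. f (x + p *\<^sub>R u + q *\<^sub>R v)) has_real_derivative f' (x + p *\<^sub>R u + q *\<^sub>R v) u) (at p)"
      if "0 \<le> p" "p \<le> s" "0 \<le> q" "q \<le> s" for p q
    proof -
      have D: "(f has_derivative f' (x + p *\<^sub>R u + q *\<^sub>R v)) (at (x + p *\<^sub>R u + q *\<^sub>R v))"
        using near[OF that] sB by (intro d2(2)) (simp add: algebra_simps)
      have "((\<lambda>p. x + p *\<^sub>R u + q *\<^sub>R v) has_derivative (\<lambda>t. t *\<^sub>R u)) (at p)"
        by (auto intro!: derivative_eq_intros)
      from has_derivative_compose[OF this D]
      have "((\<lambda>p. f (x + p *\<^sub>R u + q *\<^sub>R v)) has_derivative (\<lambda>t. t * f' (x + p *\<^sub>R u + q *\<^sub>R v) u)) (at p)"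
        using has_derivative_linear[OF D] by (simp add: linear_scale)
      then show ?thesis by (simp add: has_field_derivative_def mult.commute[of _ "f' _ _"])
    qed
    have "\<exists>z>0. z < s \<and> (f (x + s *\<^sub>R u + s *\<^sub>R v) - f (x + s *\<^sub>R u + 0 *\<^sub>R v))
          - (f (x + 0 *\<^sub>R u + s *\<^sub>R v) - f (x + 0 *\<^sub>R u + 0 *\<^sub>R v))
        = (s - 0) * (f' (x + z *\<^sub>R u + s *\<^sub>R v) u - f' (x + z *\<^sub>R u + 0 *\<^sub>R v) u)"
      using s by (intro MVT2[of 0 s "\<lambda>p. f (x + p *\<^sub>R u + s *\<^sub>R v) - f (x + p *\<^sub>R u + 0 *\<^sub>R v)"] DERIV_diff dd) auto
    then obtain z where z: "0 < z" "z < s"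
      and eq: "f (x + s *\<^sub>R u + s *\<^sub>R v) - f (x + s *\<^sub>R u) - f (x + s *\<^sub>R v) + f x
        = s * (f' (x + z *\<^sub>R u + s *\<^sub>R v) u - f' (x + z *\<^sub>R u) u)" by auto
    have "f'' (z *\<^sub>R u + s *\<^sub>R v) u - f'' (z *\<^sub>R u) u = s * f'' v u"
      using linear_add[OF lin] linear_scale[OF lin] by simp
    moreover have "norm (f' (x + (z *\<^sub>R u + s *\<^sub>R v)) u - f' x u - f'' (z *\<^sub>R u + s *\<^sub>R v) u) \<le> e / 4 * s"
      using z s by (intro err[OF refl]) auto
    moreover have "norm (f' (x + (z *\<^sub>R u)) u - f' x u - f'' (z *\<^sub>R u) u) \<le> e / 4 * s"
      using z s by (intro err[of _ z 0]) auto
    ultimately have "\<bar>f' (x + z *\<^sub>R u + s *\<^sub>R v) u - f' (x + z *\<^sub>R u) u - s * f'' v u\<bar> \<le> e / 2 * s"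
      unfolding real_norm_def add.assoc[symmetric] by linarith
    then have "\<bar>(f' (x + z *\<^sub>R u + s *\<^sub>R v) u - f' (x + z *\<^sub>R u) u - s * f'' v u) / s\<bar> \<le> e / 2"
      using s by (simp add: abs_divide divide_le_eq)
    moreover have "(f (x + s *\<^sub>R u + s *\<^sub>R v) - f (x + s *\<^sub>R u) - f (x + s *\<^sub>R v) + f x) / s\<^sup>2 - f'' v u
      = (f' (x + z *\<^sub>R u + s *\<^sub>R v) u - f' (x + z *\<^sub>R u) u - s * f'' v u) / s"
      unfolding eq using s by (simp add: field_simps power2_eq_square)
    ultimately have "\<bar>(f (x + s *\<^sub>R u + s *\<^sub>R v) - f (x + s *\<^sub>R u) - f (x + s *\<^sub>R v) + f x) / s\<^sup>2 - f'' v u\<bar> \<le> e / 2"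
      by (simp only:)
    also have "\<dots> < e" using e by simp
    finally show ?thesis by (simp only: dist_norm real_norm_def)
  qed
  then show "\<forall>\<^sub>F s in at_right 0. dist ((f (x + s *\<^sub>R u + s *\<^sub>R v) - f (x + s *\<^sub>R u) - f (x + s *\<^sub>R v) + f x) / s\<^sup>2) (f'' v u) < e"
    using d unfolding eventually_at_right_field by blast
qed

text \<open>The second difference quotient does not change when \<open>u\<close> and
  \<open>v\<close> are exchanged. Components are taken because the mean value theorem is for real
  functions.\<close>

lemma second_derivative_symmetric:
  fixes f :: "'a::euclidean_space \<Rightarrow> 'b::euclidean_space"
  assumes f: "twice_differentiable f f' f'' x"
  shows "f'' u v = f'' v u"
proof (rule euclidean_eqI)
  fix b :: 'b
  have g: "twice_differentiable (\<lambda>y. f y \<bullet> b) (\<lambda>y v. f' y v \<bullet> b) (\<lambda>w v. f'' w v \<bullet> b) x"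
    using f unfolding twice_differentiable_def
    by (auto elim!: eventually_mono intro!: has_derivative_inner_left)
  have "((\<lambda>s. (f (x + s *\<^sub>R u + s *\<^sub>R v) \<bullet> b - f (x + s *\<^sub>R v) \<bullet> b - f (x + s *\<^sub>R u) \<bullet> b + f x \<bullet> b) / s\<^sup>2)
     \<longlongrightarrow> f'' u v \<bullet> b) (at_right 0)"
    using second_difference_quotient[OF g, of v u] by (simp add: add_ac)
  moreover have "((\<lambda>s. (f (x + s *\<^sub>R u + s *\<^sub>R v) \<bullet> b - f (x + s *\<^sub>R v) \<bullet> b - f (x + s *\<^sub>R u) \<bullet> b + f x \<bullet> b) / s\<^sup>2)
     \<longlongrightarrow> f'' v u \<bullet> b) (at_right 0)"
    using second_difference_quotient[OF g, of u v] by (simp add: algebra_simps)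
  ultimately show "f'' u v \<bullet> b = f'' v u \<bullet> b"
    using tendsto_unique trivial_limit_at_right_real by blast
qed

section \<open>Local groups in coordinates\<close>

lemma has_vector_derivative_iff_tendsto:
  "(f has_vector_derivative D) (at (0::real)) \<longleftrightarrow> ((\<lambda>s. (1 / s) *\<^sub>R (f s - f 0)) \<longlongrightarrow> D) (at 0)"
proof -
  have "((\<lambda>s. (1 / s) *\<^sub>R (f s - f 0)) \<longlongrightarrow> D) (at 0) \<longleftrightarrow>
    ((\<lambda>s. norm ((1 / s) *\<^sub>R (f s - f 0) - D)) \<longlongrightarrow> 0) (at 0)"
    by (simp add: tendsto_norm_zero_iff Lim_null[of _ D])
  also have "\<dots> \<longleftrightarrow> ((\<lambda>s. norm (f s - f 0 - s *\<^sub>R D) / norm s) \<longlongrightarrow> 0) (at 0)"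
  proof (rule tendsto_cong)
    have "norm ((1 / s) *\<^sub>R (f s - f 0) - D) = norm (f s - f 0 - s *\<^sub>R D) / norm s" if "s \<noteq> 0" for s
    proof -
      have "(1 / s) *\<^sub>R (f s - f 0) - D = (1 / s) *\<^sub>R (f s - f 0 - s *\<^sub>R D)"
        using that by (simp add: scaleR_diff_right)
      then show ?thesis by simp
    qed
    then show "\<forall>\<^sub>F s in at 0. norm ((1 / s) *\<^sub>R (f s - f 0) - D) = norm (f s - f 0 - s *\<^sub>R D) / norm s"
      by (simp add: eventually_at_filter)
  qed
  finally show ?thesis
    by (simp add: has_vector_derivative_def has_derivative_iff_norm bounded_linear_scaleR_left)
qed

lemma filterlim_line:
  fixes x :: "'a::real_normed_vector"
  shows "filterlim (\<lambda>s::real. x + s *\<^sub>R X) (nhds x) (nhds 0)"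
proof -
  have "isCont (\<lambda>s::real. x + s *\<^sub>R X) 0" by (intro continuous_intros)
  then show ?thesis
    unfolding isCont_def tendsto_at_iff_tendsto_nhds[of "\<lambda>s. x + s *\<^sub>R X" 0] by simp
qed

text \<open>In finite dimension pointwise convergence of \<open>T s\<close> to the identity is
  uniform on the unit ball. Once the deviation \<open>\<kappa> s\<close> is below
  \<open>1/2\<close>, \<open>q s\<close> is bounded by twice \<open>T s (q s)\<close>, which
  converges; no bound on \<open>q\<close> has to be known beforehand.\<close>

lemma tendsto_of_near_identity:
  fixes T :: "'s \<Rightarrow> 'a::euclidean_space \<Rightarrow> 'a"
  assumes lin: "\<forall>\<^sub>F s in F. linear (T s)"
    and id: "\<And>v. ((\<lambda>s. T s v) \<longlongrightarrow> v) F"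
    and lim: "((\<lambda>s. T s (q s)) \<longlongrightarrow> D) F"
  shows "(q \<longlongrightarrow> D) F"
proof -
  define \<kappa> where "\<kappa> s = (\<Sum>b\<in>Basis. norm (T s b - b))" for s
  have k0: "(\<kappa> \<longlongrightarrow> 0) F"
    unfolding \<kappa>_def by (intro tendsto_null_sum tendsto_norm_zero LIM_zero id)
  then have half: "\<forall>\<^sub>F s in F. \<kappa> s < 1/2" by (rule order_tendstoD) simp
  have "((\<lambda>s. \<kappa> s * (2 * norm (T s (q s)))) \<longlongrightarrow> 0 * (2 * norm D)) F"
    by (intro tendsto_intros k0 lim)
  then have z: "((\<lambda>s. \<kappa> s * (2 * norm (T s (q s)))) \<longlongrightarrow> 0) F" by simp
  have "\<forall>\<^sub>F s in F. norm (q s - T s (q s)) \<le> \<kappa> s * (2 * norm (T s (q s)))"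
    using lin half
  proof eventually_elim
    case (elim s)
    have eq: "T s v - v = (\<Sum>b\<in>Basis. (v \<bullet> b) *\<^sub>R (T s b - b))" for v
    proof -
      have "T s v = T s (\<Sum>b\<in>Basis. (v \<bullet> b) *\<^sub>R b)" by (simp add: euclidean_representation)
      also have "\<dots> = (\<Sum>b\<in>Basis. (v \<bullet> b) *\<^sub>R T s b)"
        using elim(1) by (simp add: linear_sum linear_scale)
      finally show ?thesis
        by (simp add: scaleR_diff_right sum_subtractf euclidean_representation)
    qed
    have "norm (q s - T s (q s)) = norm (T s (q s) - q s)" by (rule norm_minus_commute)
    also have "\<dots> \<le> (\<Sum>b\<in>Basis. norm (q s) * norm (T s b - b))"
      by (subst eq) (auto intro!: sum_norm_le mult_right_mono Basis_le_norm)
    also have "\<dots> = \<kappa> s * norm (q s)"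
      by (simp only: \<kappa>_def sum_distrib_left[symmetric] mult.commute)
    finally have *: "norm (q s - T s (q s)) \<le> \<kappa> s * norm (q s)" .
    have "\<kappa> s * norm (q s) \<le> 1/2 * norm (q s)" using elim(2) by (intro mult_right_mono) auto
    with * have "norm (q s) \<le> 2 * norm (T s (q s))"
      using norm_triangle_ineq[of "T s (q s)" "q s - T s (q s)"] by simp
    moreover have "0 \<le> \<kappa> s" by (simp add: \<kappa>_def sum_nonneg)
    ultimately show ?case using * by (meson mult_left_mono order_trans)
  qed
  then have "((\<lambda>s. q s - T s (q s)) \<longlongrightarrow> 0) F"
    by (rule Lim_null_comparison[OF _ z])
  from tendsto_add[OF this lim] show ?thesis by simp
qed

text \<open>The germ of a product with unit, as seen in a chart at the identity. Associativity
  enters later, through the group itself, in \<open>lderiv_near\<close> and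
  \<open>Ad_near\<close>.\<close>

locale local_group =
  fixes e\<^sub>0 :: "'e::euclidean_space" and mul :: "'e \<times> 'e \<Rightarrow> 'e" and mul' mul''
  assumes mul: "twice_differentiable mul mul' mul'' (e\<^sub>0, e\<^sub>0)"
    and right_unit: "\<forall>\<^sub>F a in nhds e\<^sub>0. mul (a, e\<^sub>0) = a"
    and left_unit: "\<forall>\<^sub>F a in nhds e\<^sub>0. mul (e\<^sub>0, a) = a"
begin

definition mixed :: "'e \<Rightarrow> 'e \<Rightarrow> 'e" where
  "mixed X Y = mul'' (X, 0) (0, Y)"

definition left_field :: "'e \<Rightarrow> 'e \<Rightarrow> 'e" where
  "left_field a Y = mul' (a, e\<^sub>0) (0, Y)"

definition right_field :: "'e \<Rightarrow> 'e \<Rightarrow> 'e" where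
  "right_field a Y = mul' (e\<^sub>0, a) (Y, 0)"

lemma mul_unit: "mul (e\<^sub>0, e\<^sub>0) = e\<^sub>0"
  using right_unit by (rule eventually_nhds_x_imp_x)

lemma tendsto_slices: "filterlim (\<lambda>a. (a, e\<^sub>0)) (nhds (e\<^sub>0, e\<^sub>0)) (nhds e\<^sub>0)"
  "filterlim (\<lambda>a. (e\<^sub>0, a)) (nhds (e\<^sub>0, e\<^sub>0)) (nhds e\<^sub>0)"
  by (auto intro!: tendsto_intros filterlim_ident)

lemma mul_derivative: "\<forall>\<^sub>F p in nhds (e\<^sub>0, e\<^sub>0). (mul has_derivative mul' p) (at p)"
  using mul by (simp add: twice_differentiable_def)

lemma mul_derivative_slices:
  "\<forall>\<^sub>F a in nhds e\<^sub>0. (mul has_derivative mul' (a, e\<^sub>0)) (at (a, e\<^sub>0))"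
  "\<forall>\<^sub>F a in nhds e\<^sub>0. (mul has_derivative mul' (e\<^sub>0, a)) (at (e\<^sub>0, a))"
  using tendsto_slices mul_derivative unfolding filterlim_iff by blast+

lemma fields_at_unit: "left_field e\<^sub>0 Y = Y" "right_field e\<^sub>0 Y = Y"
proof -
  note D = twice_differentiable_first[OF mul]
  have "((\<lambda>s::real. (e\<^sub>0, e\<^sub>0 + s *\<^sub>R Y)) has_derivative (\<lambda>s. (0, s *\<^sub>R Y))) (at 0)"
    "((\<lambda>s::real. (e\<^sub>0 + s *\<^sub>R Y, e\<^sub>0)) has_derivative (\<lambda>s. (s *\<^sub>R Y, 0))) (at 0)"
    by (auto intro!: derivative_eq_intros)
  then have 1: "((\<lambda>s. mul (e\<^sub>0, e\<^sub>0 + s *\<^sub>R Y)) has_derivative (\<lambda>s. mul' (e\<^sub>0, e\<^sub>0) (0, s *\<^sub>R Y))) (at 0)"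
    and 2: "((\<lambda>s. mul (e\<^sub>0 + s *\<^sub>R Y, e\<^sub>0)) has_derivative (\<lambda>s. mul' (e\<^sub>0, e\<^sub>0) (s *\<^sub>R Y, 0))) (at 0)"
    using D by (auto intro: has_derivative_compose[where g = mul])
  have lim: "filterlim (\<lambda>s::real. e\<^sub>0 + s *\<^sub>R Y) (nhds e\<^sub>0) (nhds 0)"
    by (rule filterlim_line)
  have ev: "\<forall>\<^sub>F s in nhds 0. mul (e\<^sub>0, e\<^sub>0 + s *\<^sub>R Y) = e\<^sub>0 + s *\<^sub>R Y"
    "\<forall>\<^sub>F s in nhds 0. mul (e\<^sub>0 + s *\<^sub>R Y, e\<^sub>0) = e\<^sub>0 + s *\<^sub>R Y"
    using lim left_unit right_unit unfolding filterlim_iff by blast+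
  have id: "((\<lambda>s::real. e\<^sub>0 + s *\<^sub>R Y) has_derivative (\<lambda>s. s *\<^sub>R Y)) (at 0)"
    by (auto intro!: derivative_eq_intros)
  have "((\<lambda>s. e\<^sub>0 + s *\<^sub>R Y) has_derivative (\<lambda>s. mul' (e\<^sub>0, e\<^sub>0) (0, s *\<^sub>R Y))) (at 0)"
    by (rule has_derivative_transform_eventually[OF 1])
      (use ev(1) in \<open>auto simp: eventually_at_filter mul_unit elim!: eventually_mono\<close>)
  from has_derivative_unique[OF this id, THEN fun_cong, of 1] show "left_field e\<^sub>0 Y = Y"
    by (simp add: left_field_def)
  have "((\<lambda>s. e\<^sub>0 + s *\<^sub>R Y) has_derivative (\<lambda>s. mul' (e\<^sub>0, e\<^sub>0) (s *\<^sub>R Y, 0))) (at 0)"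
    by (rule has_derivative_transform_eventually[OF 2])
      (use ev(2) in \<open>auto simp: eventually_at_filter mul_unit elim!: eventually_mono\<close>)
  from has_derivative_unique[OF this id, THEN fun_cong, of 1] show "right_field e\<^sub>0 Y = Y"
    by (simp add: right_field_def)
qed

lemma left_field_derivative: "((\<lambda>a. left_field a Y) has_derivative (\<lambda>X. mixed X Y)) (at e\<^sub>0)"
proof -
  have c: "((\<lambda>a. (a, e\<^sub>0)) has_derivative (\<lambda>X. (X, 0))) (at e\<^sub>0)"
    by (auto intro!: derivative_eq_intros)
  have "((\<lambda>p. mul' p (0, Y)) has_derivative (\<lambda>w. mul'' w (0, Y))) (at (e\<^sub>0, e\<^sub>0))"
    using mul by (simp add: twice_differentiable_def)
  from has_derivative_compose[OF c this] show ?thesis by (simp add: left_field_def mixed_def)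
qed

text \<open>Here the symmetry of \<open>mul''\<close> is used. It expresses the derivatives of left-
  and right-invariant fields by the same bilinear map with exchanged arguments, so their difference
  is a commutator.\<close>

lemma right_field_derivative: "((\<lambda>a. right_field a Y) has_derivative (\<lambda>X. mixed Y X)) (at e\<^sub>0)"
proof -
  have c: "((\<lambda>a. (e\<^sub>0, a)) has_derivative (\<lambda>X. (0, X))) (at e\<^sub>0)"
    by (auto intro!: derivative_eq_intros)
  have "((\<lambda>p. mul' p (Y, 0)) has_derivative (\<lambda>w. mul'' w (Y, 0))) (at (e\<^sub>0, e\<^sub>0))"
    using mul by (simp add: twice_differentiable_def)
  from has_derivative_compose[OF c this] show ?thesis
    by (simp add: right_field_def mixed_def second_derivative_symmetric[OF mul, of "(Y, 0)"])
qed

lemma derivative_along_left_field: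
  assumes f: "twice_differentiable f f' f'' e\<^sub>0"
  shows "\<forall>\<^sub>F a in nhds e\<^sub>0. ((\<lambda>s. f (mul (a, e\<^sub>0 + s *\<^sub>R Y))) has_vector_derivative f' a (left_field a Y)) (at 0)"
proof -
  have "\<forall>\<^sub>F a in nhds e\<^sub>0. (f has_derivative f' a) (at a)"
    using f by (simp add: twice_differentiable_def)
  with mul_derivative_slices(1) right_unit show ?thesis
  proof eventually_elim
    case (elim a)
    have "((\<lambda>s::real. (a, e\<^sub>0 + s *\<^sub>R Y)) has_derivative (\<lambda>s. (0, s *\<^sub>R Y))) (at 0)"
      by (auto intro!: derivative_eq_intros)
    then have "((\<lambda>s::real. mul (a, e\<^sub>0 + s *\<^sub>R Y)) has_derivative (\<lambda>s. mul' (a, e\<^sub>0) (0, s *\<^sub>R Y))) (at 0)"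
      using elim(1) by (auto intro: has_derivative_compose[where g = mul])
    then have "((\<lambda>s::real. f (mul (a, e\<^sub>0 + s *\<^sub>R Y))) has_derivative (\<lambda>s. f' a (mul' (a, e\<^sub>0) (0, s *\<^sub>R Y)))) (at 0)"
      using elim(2,3) by (auto intro: has_derivative_compose[where g = f])
    moreover have "f' a (mul' (a, e\<^sub>0) (0, s *\<^sub>R Y)) = s *\<^sub>R f' a (left_field a Y)" for s
    proof -
      have "mul' (a, e\<^sub>0) (0, s *\<^sub>R Y) = s *\<^sub>R mul' (a, e\<^sub>0) (0, Y)"
        using linear_scale[OF has_derivative_linear[OF elim(1)], of s "(0, Y)"] by simp
      then show ?thesis
        using linear_scale[OF has_derivative_linear[OF elim(3)]] by (simp add: left_field_def)
    qed
    ultimately show ?case by (simp add: has_vector_derivative_def)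
  qed
qed

text \<open>The function differentiated here is a partial derivative of \<open>f\<close> composed
  with \<open>mul\<close>, taken at \<open>(a, e\<^sub>0)\<close>. The chain rule for second
  derivatives of that composite therefore gives the result.\<close>

lemma second_derivative_along_left_fields:
  assumes f: "twice_differentiable f f' f'' e\<^sub>0"
  shows "((\<lambda>s. f' (e\<^sub>0 + s *\<^sub>R X) (left_field (e\<^sub>0 + s *\<^sub>R X) Y)) has_vector_derivative
    f'' X Y + f' e\<^sub>0 (mixed X Y)) (at 0)"
proof -
  have "twice_differentiable (\<lambda>p. f (mul p)) (\<lambda>p v. f' (mul p) (mul' p v))
     (\<lambda>w v. f'' (mul' (e\<^sub>0, e\<^sub>0) w) (mul' (e\<^sub>0, e\<^sub>0) v) + f' (mul (e\<^sub>0, e\<^sub>0)) (mul'' w v)) (e\<^sub>0, e\<^sub>0)"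
    by (rule twice_differentiable_compose[OF mul]) (simp add: mul_unit f)
  then have D: "((\<lambda>p. f' (mul p) (mul' p (0, Y))) has_derivative
     (\<lambda>w. f'' (mul' (e\<^sub>0, e\<^sub>0) w) (mul' (e\<^sub>0, e\<^sub>0) (0, Y)) + f' (mul (e\<^sub>0, e\<^sub>0)) (mul'' w (0, Y)))) (at (e\<^sub>0, e\<^sub>0))"
    by (simp add: twice_differentiable_def)
  have c: "((\<lambda>s::real. (e\<^sub>0 + s *\<^sub>R X, e\<^sub>0)) has_derivative (\<lambda>s. (s *\<^sub>R X, 0))) (at 0)"
    by (auto intro!: derivative_eq_intros)
  have D0: "((\<lambda>s. f' (mul (e\<^sub>0 + s *\<^sub>R X, e\<^sub>0)) (mul' (e\<^sub>0 + s *\<^sub>R X, e\<^sub>0) (0, Y))) has_derivative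
     (\<lambda>s. f'' (mul' (e\<^sub>0, e\<^sub>0) (s *\<^sub>R X, 0)) (mul' (e\<^sub>0, e\<^sub>0) (0, Y)) + f' (mul (e\<^sub>0, e\<^sub>0)) (mul'' (s *\<^sub>R X, 0) (0, Y)))) (at 0)"
    by (rule has_derivative_compose[OF c, of "\<lambda>p. f' (mul p) (mul' p (0, Y))"]) (use D in simp)
  have lim: "filterlim (\<lambda>s::real. e\<^sub>0 + s *\<^sub>R X) (nhds e\<^sub>0) (nhds 0)"
    by (rule filterlim_line)
  have "\<forall>\<^sub>F s in nhds 0. mul (e\<^sub>0 + s *\<^sub>R X, e\<^sub>0) = e\<^sub>0 + s *\<^sub>R X"
    using lim right_unit unfolding filterlim_iff by blast
  then have "((\<lambda>s. f' (e\<^sub>0 + s *\<^sub>R X) (left_field (e\<^sub>0 + s *\<^sub>R X) Y)) has_derivative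
     (\<lambda>s. f'' (mul' (e\<^sub>0, e\<^sub>0) (s *\<^sub>R X, 0)) (mul' (e\<^sub>0, e\<^sub>0) (0, Y)) + f' (mul (e\<^sub>0, e\<^sub>0)) (mul'' (s *\<^sub>R X, 0) (0, Y)))) (at 0)"
    by (intro has_derivative_transform_eventually[OF D0])
      (auto simp: eventually_at_filter left_field_def mul_unit elim!: eventually_mono)
  moreover have "f'' (mul' (e\<^sub>0, e\<^sub>0) (s *\<^sub>R X, 0)) (mul' (e\<^sub>0, e\<^sub>0) (0, Y)) + f' (mul (e\<^sub>0, e\<^sub>0)) (mul'' (s *\<^sub>R X, 0) (0, Y))
     = s *\<^sub>R (f'' X Y + f' e\<^sub>0 (mixed X Y))" for s
  proof -
    have "linear (\<lambda>w. mul'' w (0, Y))" "linear (\<lambda>w. f'' w Y)"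
      using mul f by (auto simp: twice_differentiable_def intro: has_derivative_linear)
    note lin = linear_scale[OF this(1), of s "(X, 0)"] linear_scale[OF this(2), of s X]
      linear_scale[OF has_derivative_linear[OF twice_differentiable_first[OF f]]]
    show ?thesis
      using lin fields_at_unit[unfolded left_field_def right_field_def]
      by (simp add: mul_unit mixed_def scaleR_add_right)
  qed
  ultimately show ?thesis by (simp add: has_vector_derivative_def)
qed

text \<open>The hypothesis on \<open>p\<close> is the infinitesimal form of
  \<open>g b = (g b g^-1) g\<close>, so \<open>p s\<close> is the adjoint action of
  \<open>a s\<close> on \<open>B\<close>. Differentiability of \<open>p\<close> is part of the
  claim: the images of its difference quotients under \<open>right_field (a s)\<close> converge, and
  these maps tend to the identity.\<close>

lemma derivative_of_adjoint:
  assumes a: "(a has_vector_derivative A) (at 0)" "a 0 = e\<^sub>0"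
    and p: "\<forall>\<^sub>F s in nhds 0. right_field (a s) (p s) = left_field (a s) B"
  shows "(p has_vector_derivative mixed A B - mixed B A) (at 0)"
proof -
  have lim: "filterlim a (nhds e\<^sub>0) (nhds 0)"
    using has_vector_derivative_continuous[OF a(1)] unfolding continuous_within tendsto_at_iff_tendsto_nhds unfolding a(2) .
  have lin: "\<forall>\<^sub>F s in nhds 0. linear (right_field (a s))"
  proof -
    have "\<forall>\<^sub>F x in nhds e\<^sub>0. linear (right_field x)"
      using mul_derivative_slices(2)
    proof eventually_elim
      case (elim x)
      have "linear (\<lambda>Y::'e. (Y, 0::'e))" by (rule linearI) auto
      from linear_compose[OF this has_derivative_linear[OF elim]] show ?case
        by (simp add: right_field_def[abs_def] o_def)
    qed
    then show ?thesis using lim unfolding filterlim_iff by blast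
  qed
  have dR: "((\<lambda>s. right_field (a s) Y) has_vector_derivative mixed Y A) (at 0)"
    and dL: "((\<lambda>s. left_field (a s) Y) has_vector_derivative mixed A Y) (at 0)" for Y
  proof -
    have "(h has_derivative D) (at (a 0)) \<Longrightarrow> ((\<lambda>s. h (a s)) has_vector_derivative D A) (at 0)"
      for h D
    proof -
      assume D: "(h has_derivative D) (at (a 0))"
      from has_derivative_compose[OF a(1)[unfolded has_vector_derivative_def] D] linear_scale[OF has_derivative_linear[OF D]]
      show ?thesis by (simp add: has_vector_derivative_def)
    qed
    then show "((\<lambda>s. right_field (a s) Y) has_vector_derivative mixed Y A) (at 0)"
      "((\<lambda>s. left_field (a s) Y) has_vector_derivative mixed A Y) (at 0)"
      using a(2) right_field_derivative[of Y] left_field_derivative[of Y] by blast+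
  qed
  have p0: "p 0 = B" using eventually_nhds_x_imp_x[OF p] a(2) by (simp add: fields_at_unit)
  let ?F = "\<lambda>s. left_field (a s) B - right_field (a s) B"
  have "(?F has_vector_derivative mixed A B - mixed B A) (at 0)"
    by (intro has_vector_derivative_diff dL dR)
  then have F: "((\<lambda>s. (1 / s) *\<^sub>R ?F s) \<longlongrightarrow> mixed A B - mixed B A) (at 0)"
    by (simp add: has_vector_derivative_iff_tendsto a(2) fields_at_unit)
  have "((\<lambda>s. (1 / s) *\<^sub>R (p s - p 0)) \<longlongrightarrow> mixed A B - mixed B A) (at 0)"
  proof (rule tendsto_of_near_identity[where T = "\<lambda>s. right_field (a s)"])
    show "\<forall>\<^sub>F s in at 0. linear (right_field (a s))"
      using lin by (auto simp: eventually_at_filter elim: eventually_mono)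
    show "((\<lambda>s. right_field (a s) v) \<longlongrightarrow> v) (at 0)" for v
      using has_vector_derivative_continuous[OF dR[of v]] by (simp add: continuous_within a(2) fields_at_unit)
    have "\<forall>\<^sub>F s in at 0. (1 / s) *\<^sub>R ?F s = right_field (a s) ((1 / s) *\<^sub>R (p s - p 0))"
      unfolding eventually_at_filter using lin p
      by eventually_elim (simp add: p0 linear_diff linear_scale)
    then show "((\<lambda>s. right_field (a s) ((1 / s) *\<^sub>R (p s - p 0))) \<longlongrightarrow> mixed A B - mixed B A) (at 0)"
      by (rule Lim_transform_eventually[OF F])
  qed
  then show ?thesis by (simp add: has_vector_derivative_iff_tendsto)
qed

end

section \<open>Left-invariant derivatives on Lie groups\<close>

lemma has_vector_derivative_transform_nhds:
  assumes "(f has_vector_derivative D) (at t)" and eq: "\<forall>\<^sub>F s in nhds t. f s = h s"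
  shows "(h has_vector_derivative D) (at t)"
  using assms(1) unfolding has_vector_derivative_def
  by (rule has_derivative_transform_eventually)
    (use eq eventually_nhds_x_imp_x[OF eq] in \<open>auto simp: eventually_at_filter elim: eventually_mono\<close>)

locale lie_group_chart =
  fixes G :: "('g::{t2_space, second_countable_topology}, 'e::euclidean_space, 'r) lie_group_scheme"
  assumes lie: "is_lie_group G"
begin

lemma group: "group G" and carrier: "carrier G = UNIV"
  using lie by (auto simp: is_lie_group_def)

sublocale group G by (rule group)

lemmas [simp] = carrier

lemma chart:
  assumes "(U, \<phi>) \<in> atlas G"
  shows "open U" "open (\<phi> ` U)" "continuous_on U \<phi>" "continuous_on (\<phi> ` U) (inv_into U \<phi>)"
    "x \<in> U \<Longrightarrow> inv_into U \<phi> (\<phi> x) = x"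
    "y \<in> \<phi> ` U \<Longrightarrow> inv_into U \<phi> y \<in> U" "y \<in> \<phi> ` U \<Longrightarrow> \<phi> (inv_into U \<phi> y) = y"
proof -
  have "\<forall>(U, \<phi>)\<in>atlas G. open U \<and> open (\<phi> ` U) \<and> homeomorphism U (\<phi> ` U) \<phi> (inv_into U \<phi>)"
    using lie by (simp add: is_lie_group_def smooth_atlas_def)
  then have *: "open U" "open (\<phi> ` U)" "homeomorphism U (\<phi> ` U) \<phi> (inv_into U \<phi>)"
    using assms by auto
  then show "open U" "open (\<phi> ` U)" "continuous_on U \<phi>" "continuous_on (\<phi> ` U) (inv_into U \<phi>)"
    "x \<in> U \<Longrightarrow> inv_into U \<phi> (\<phi> x) = x"
    by (auto simp: homeomorphism_def)
  show "y \<in> \<phi> ` U \<Longrightarrow> inv_into U \<phi> y \<in> U" "y \<in> \<phi> ` U \<Longrightarrow> \<phi> (inv_into U \<phi> y) = y"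
    by (auto intro: inv_into_into f_inv_into_f)
qed

lemma chart_exists: "\<exists>U \<phi>. (U, \<phi>) \<in> atlas G \<and> g \<in> U"
proof -
  have "g \<in> (\<Union>(U, \<phi>)\<in>atlas G. U)"
    using lie by (simp add: is_lie_group_def smooth_atlas_def)
  then show ?thesis by auto
qed

lemma isCont_mult: "isCont (\<lambda>(x, y). x \<otimes>\<^bsub>G\<^esub> y) p" and isCont_inv: "isCont (\<lambda>x. inv\<^bsub>G\<^esub> x) g"
proof -
  have "continuous_on UNIV (\<lambda>(x, y). x \<otimes>\<^bsub>G\<^esub> y)" "continuous_on UNIV (\<lambda>x. inv\<^bsub>G\<^esub> x)"
    using lie by (simp_all add: is_lie_group_def)
  then show "isCont (\<lambda>(x, y). x \<otimes>\<^bsub>G\<^esub> y) p" "isCont (\<lambda>x. inv\<^bsub>G\<^esub> x) g"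
    by (simp_all only: continuous_on_eq_continuous_at[OF open_UNIV] ball_UNIV)
qed

lemma tendsto_mult_group:
  assumes "(f \<longlongrightarrow> a) F" "(h \<longlongrightarrow> b) F"
  shows "((\<lambda>x. f x \<otimes>\<^bsub>G\<^esub> h x) \<longlongrightarrow> a \<otimes>\<^bsub>G\<^esub> b) F"
  using isCont_tendsto_compose[OF isCont_mult tendsto_Pair[OF assms]] by simp

lemma tendsto_inv_group: "(f \<longlongrightarrow> a) F \<Longrightarrow> ((\<lambda>x. inv\<^bsub>G\<^esub> f x) \<longlongrightarrow> inv\<^bsub>G\<^esub> a) F"
  using isCont_tendsto_compose[OF isCont_inv] .

definition udom where "udom = fst (unit_chart G)"

definition unchart :: "'e \<Rightarrow> 'g" where "unchart = inv_into udom (coord G)"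

definition base :: 'e where "base = coord G \<one>\<^bsub>G\<^esub>"

lemma unit_chart: "(udom, coord G) \<in> atlas G" "\<one>\<^bsub>G\<^esub> \<in> udom"
proof -
  obtain U \<phi> where "(U, \<phi>) \<in> atlas G" "\<one>\<^bsub>G\<^esub> \<in> U" using chart_exists by blast
  then have "unit_chart G \<in> atlas G \<and> \<one>\<^bsub>G\<^esub> \<in> fst (unit_chart G)"
    unfolding unit_chart_def by (intro someI[of "\<lambda>c. c \<in> atlas G \<and> \<one>\<^bsub>G\<^esub> \<in> fst c" "(U, \<phi>)"]) simp
  then show "(udom, coord G) \<in> atlas G" "\<one>\<^bsub>G\<^esub> \<in> udom" by (simp_all add: udom_def coord_def)
qed

lemmas unit = chart[OF unit_chart(1), folded unchart_def]

lemma unchart_base [simp]: "unchart base = \<one>\<^bsub>G\<^esub>"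
  using unit(5) unit_chart(2) by (simp add: base_def)

lemma base_in: "base \<in> coord G ` udom" using unit_chart(2) by (simp add: base_def)

lemma unit_curve: "unit_curve G X s = unchart (base + s *\<^sub>R X)"
  by (simp add: unit_curve_def unchart_def udom_def base_def)

lemma tendsto_unchart: "a \<in> coord G ` udom \<Longrightarrow> (unchart \<longlongrightarrow> unchart a) (nhds a)"
  using unit(2,4) by (auto simp: continuous_on_eq_continuous_at isCont_def tendsto_at_iff_tendsto_nhds)

lemma tendsto_coord: "x \<in> udom \<Longrightarrow> (coord G \<longlongrightarrow> coord G x) (nhds x)"
  using unit(1,3) by (auto simp: continuous_on_eq_continuous_at isCont_def tendsto_at_iff_tendsto_nhds)

lemma eventually_in_open: "(f \<longlongrightarrow> l) F \<Longrightarrow> open A \<Longrightarrow> l \<in> A \<Longrightarrow> \<forall>\<^sub>F x in F. f x \<in> A"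
  by (rule topological_tendstoD)

lemma product_twice_differentiable:
  assumes c: "(U, \<phi>) \<in> atlas G" "(V, \<eta>) \<in> atlas G" "(W, \<omega>) \<in> atlas G"
    and x: "x \<in> U" "y \<in> V" "x \<otimes>\<^bsub>G\<^esub> y \<in> W"
  obtains f' f'' where
    "twice_differentiable (\<lambda>(a, b). \<omega> (inv_into U \<phi> a \<otimes>\<^bsub>G\<^esub> inv_into V \<eta> b)) f' f'' (\<phi> x, \<eta> y)"
proof -
  let ?h = "\<lambda>p. inv_into U \<phi> (fst p) \<otimes>\<^bsub>G\<^esub> inv_into V \<eta> (snd p)"
  let ?N = "{(a, b). a \<in> \<phi> ` U \<and> b \<in> \<eta> ` V \<and> inv_into U \<phi> a \<otimes>\<^bsub>G\<^esub> inv_into V \<eta> b \<in> W}"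
  have "continuous_on UNIV (\<lambda>(x, y). x \<otimes>\<^bsub>G\<^esub> y)"
    using lie by (simp add: is_lie_group_def)
  then have "continuous_on (\<phi> ` U \<times> \<eta> ` V) (\<lambda>p. (\<lambda>(x, y). x \<otimes>\<^bsub>G\<^esub> y) (inv_into U \<phi> (fst p), inv_into V \<eta> (snd p)))"
    by (rule continuous_on_compose2)
      (auto intro!: continuous_on_Pair continuous_on_compose2[OF chart(4)[OF c(1)]] continuous_on_compose2[OF chart(4)[OF c(2)]]
        continuous_intros)
  then have "continuous_on (\<phi> ` U \<times> \<eta> ` V) ?h" by simp
  \<comment> \<open>\<open>is_lie_group\<close> provides smoothness on this set; its openness comes
    from the continuity of the multiplication and is what makes derivatives there
    meaningful.\<close>
  then have "open ((\<phi> ` U \<times> \<eta> ` V) \<inter> ?h -` W)"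
    by (intro continuous_open_preimage open_Times chart(2)[OF c(1)] chart(2)[OF c(2)] chart(1)[OF c(3)])
  also have "(\<phi> ` U \<times> \<eta> ` V) \<inter> ?h -` W = ?N" by auto
  finally have "open ?N" .
  moreover have "smooth_on ?N (\<lambda>(a, b). \<omega> (inv_into U \<phi> a \<otimes>\<^bsub>G\<^esub> inv_into V \<eta> b))"
    using lie c unfolding is_lie_group_def by blast
  moreover have "(\<phi> x, \<eta> y) \<in> ?N"
    using x c by (simp add: chart(5))
  ultimately show ?thesis
    using that by (rule_tac smooth_on_twice_differentiable)
qed

text \<open>Left translation is factored through a chart at \<open>g\<close>: the product read in
  charts, with its first argument frozen, followed by \<open>F\<close> read in that chart.\<close>

lemma translate_twice_differentiable:
  fixes F :: "'g \<Rightarrow> 'v::euclidean_space"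
  assumes F: "smooth_map G F"
  obtains f' f'' where "twice_differentiable (\<lambda>b. F (g \<otimes>\<^bsub>G\<^esub> unchart b)) f' f'' base"
proof -
  obtain W \<omega> where W: "(W, \<omega>) \<in> atlas G" "g \<in> W" using chart_exists by blast
  have "smooth_on (\<omega> ` W) (F \<circ> inv_into W \<omega>)"
    using F W by (auto simp: smooth_map_def)
  then obtain k' k'' where k: "twice_differentiable (F \<circ> inv_into W \<omega>) k' k'' (\<omega> g)"
    using smooth_on_twice_differentiable chart(2)[OF W(1)] W(2) by blast
  obtain m' m'' where m: "twice_differentiable (\<lambda>(a, b). \<omega> (inv_into W \<omega> a \<otimes>\<^bsub>G\<^esub> unchart b)) m' m'' (\<omega> g, base)"
    using product_twice_differentiable[OF W(1) unit_chart(1) W(1,2) unit_chart(2)] W(2)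
    by (auto simp: unchart_def base_def)
  have "bounded_linear (\<lambda>b::'e. (0::'e, b))"
    by (intro bounded_linear_Pair bounded_linear_zero bounded_linear_ident)
  from twice_differentiable_bounded_linear[OF this, of "(\<omega> g, 0)" base]
  have "twice_differentiable (\<lambda>b. (\<omega> g, b)) (\<lambda>_ b. (0, b)) (\<lambda>_ _. 0) base" by simp
  from twice_differentiable_compose[OF this, of "\<lambda>(a, b). \<omega> (inv_into W \<omega> a \<otimes>\<^bsub>G\<^esub> unchart b)"] m
  obtain u' u'' where u: "twice_differentiable (\<lambda>b. \<omega> (g \<otimes>\<^bsub>G\<^esub> unchart b)) u' u'' base"
    using W by (auto simp: chart(5))
  obtain f' f'' where f: "twice_differentiable (\<lambda>b. (F \<circ> inv_into W \<omega>) (\<omega> (g \<otimes>\<^bsub>G\<^esub> unchart b))) f' f'' base"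
    using twice_differentiable_compose[OF u, of "F \<circ> inv_into W \<omega>"] k by auto
  have "((\<lambda>b. g \<otimes>\<^bsub>G\<^esub> unchart b) \<longlongrightarrow> g \<otimes>\<^bsub>G\<^esub> unchart base) (nhds base)"
    by (intro tendsto_mult_group tendsto_const tendsto_unchart base_in)
  then have "\<forall>\<^sub>F b in nhds base. g \<otimes>\<^bsub>G\<^esub> unchart b \<in> W"
    by (rule eventually_in_open) (use W chart(1) in auto)
  then have "\<forall>\<^sub>F b in nhds base. (F \<circ> inv_into W \<omega>) (\<omega> (g \<otimes>\<^bsub>G\<^esub> unchart b)) = F (g \<otimes>\<^bsub>G\<^esub> unchart b)"
    by eventually_elim (simp add: chart(5)[OF W(1)])
  from twice_differentiable_cong[OF f this] that show ?thesis by blast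
qed

definition chart_mult :: "'e \<times> 'e \<Rightarrow> 'e" where
  "chart_mult = (\<lambda>(a, b). coord G (unchart a \<otimes>\<^bsub>G\<^esub> unchart b))"

lemma chart_mult_local_group: "\<exists>m' m''. local_group base chart_mult m' m''"
proof -
  obtain m' m'' where "twice_differentiable chart_mult m' m'' (base, base)"
    using product_twice_differentiable[OF unit_chart(1) unit_chart(1) unit_chart(1) unit_chart(2) unit_chart(2)] unit_chart(2)
    by (auto simp: chart_mult_def unchart_def base_def)
  moreover have "\<forall>\<^sub>F a in nhds base. a \<in> coord G ` udom"
    using base_in unit(2) by (rule eventually_nhds_in_open[rotated])
  then have "\<forall>\<^sub>F a in nhds base. chart_mult (a, base) = a" "\<forall>\<^sub>F a in nhds base. chart_mult (base, a) = a"
    by (auto elim!: eventually_mono simp: chart_mult_def unit)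
  ultimately show ?thesis unfolding local_group_def by blast
qed


text \<open>Covers both \<open>unit_curve\<close> and one-parameter groups. Continuity is a separate
  condition because \<open>coord G\<close> is arbitrary outside its chart domain, so the derivative
  alone does not keep the curve near the identity.\<close>

definition velocity_curve :: "(real \<Rightarrow> 'g) \<Rightarrow> 'e \<Rightarrow> bool" where
  "velocity_curve c X \<longleftrightarrow> c 0 = \<one>\<^bsub>G\<^esub> \<and> isCont c 0 \<and> ((\<lambda>s. coord G (c s)) has_vector_derivative X) (at 0)"

lemma velocity_curve_tendsto: "velocity_curve c X \<Longrightarrow> (c \<longlongrightarrow> \<one>\<^bsub>G\<^esub>) (nhds 0)"
  unfolding velocity_curve_def isCont_def tendsto_at_iff_tendsto_nhds by metis

lemma velocity_curve_chart: "velocity_curve c X \<Longrightarrow> \<forall>\<^sub>F s in nhds 0. c s \<in> udom"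
  using velocity_curve_tendsto unit(1) unit_chart(2) by (rule eventually_in_open)

lemma tendsto_unit_curve: "(unit_curve G X \<longlongrightarrow> \<one>\<^bsub>G\<^esub>) (nhds 0)"
proof -
  have "((\<lambda>s. unchart (base + s *\<^sub>R X)) \<longlongrightarrow> unchart base) (nhds 0)"
    using tendsto_unchart[OF base_in] filterlim_line by (rule filterlim_compose)
  then show ?thesis by (simp add: unit_curve[abs_def])
qed

lemma eventually_line_in_chart: "\<forall>\<^sub>F s in nhds 0. base + s *\<^sub>R X \<in> coord G ` udom"
  using filterlim_line unit(2) base_in by (rule eventually_in_open)

lemma unit_curve_0 [simp]: "unit_curve G X 0 = \<one>\<^bsub>G\<^esub>"
  by (simp add: unit_curve)

lemma unit_curve_velocity: "velocity_curve (unit_curve G X) X"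
proof -
  have "((\<lambda>s. base + s *\<^sub>R X) has_vector_derivative X) (at 0)"
    by (auto intro!: derivative_eq_intros)
  moreover have "\<forall>\<^sub>F s in nhds 0. base + s *\<^sub>R X = coord G (unit_curve G X s)"
    using eventually_line_in_chart[of X] by eventually_elim (simp add: unit_curve unit(7))
  ultimately have "((\<lambda>s. coord G (unit_curve G X s)) has_vector_derivative X) (at 0)" by (rule has_vector_derivative_transform_nhds)
  moreover have "isCont (unit_curve G X) 0"
    using tendsto_unit_curve[of X] by (simp add: isCont_def tendsto_at_iff_tendsto_nhds[symmetric] tendsto_nhds_iff)
  ultimately show ?thesis by (simp add: velocity_curve_def)
qed

end

text \<open>Fixes witnesses for the first two derivatives of the multiplication. Results whose
  statements do not mention them are carried back to \<open>lie_group_chart\<close> by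
  \<open>products_exist\<close>.\<close>

locale lie_group_products = lie_group_chart G + local_group base chart_mult mul' mul''
  for G :: "('g::{t2_space, second_countable_topology}, 'e::euclidean_space, 'r) lie_group_scheme"
    and mul' mul''
begin

text \<open>By associativity, moving from the point with coordinate \<open>a\<close> along a unit
  curve is \<open>chart_mult\<close> with \<open>a\<close> as its first argument, translated by
  \<open>g\<close>.\<close>

lemma lderiv_near:
  assumes f: "twice_differentiable (\<lambda>b. F (g \<otimes>\<^bsub>G\<^esub> unchart b)) f' f'' base"
  shows "\<forall>\<^sub>F a in nhds base. ((\<lambda>s. F (g \<otimes>\<^bsub>G\<^esub> unchart a \<otimes>\<^bsub>G\<^esub> unit_curve G Y s)) has_vector_derivative f' a (left_field a Y)) (at 0)"
proof -
  have "\<forall>\<^sub>F a in nhds base. unchart a \<in> udom"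
    using tendsto_unchart[OF base_in] unit(1) by (rule eventually_in_open) (simp add: unit_chart)
  moreover have "\<forall>\<^sub>F a in nhds base. ((\<lambda>s. F (g \<otimes>\<^bsub>G\<^esub> unchart (chart_mult (a, base + s *\<^sub>R Y)))) has_vector_derivative f' a (left_field a Y)) (at 0)"
    by (rule derivative_along_left_field[OF f])
  ultimately show ?thesis
  proof eventually_elim
    case (elim a)
    have "((\<lambda>s. unchart a \<otimes>\<^bsub>G\<^esub> unit_curve G Y s) \<longlongrightarrow> unchart a \<otimes>\<^bsub>G\<^esub> \<one>\<^bsub>G\<^esub>) (nhds 0)"
      by (intro tendsto_mult_group tendsto_const tendsto_unit_curve)
    then have "\<forall>\<^sub>F s in nhds 0. unchart a \<otimes>\<^bsub>G\<^esub> unit_curve G Y s \<in> udom"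
      by (rule eventually_in_open) (use elim unit(1) in simp_all)
    then have "\<forall>\<^sub>F s in nhds 0. F (g \<otimes>\<^bsub>G\<^esub> unchart (chart_mult (a, base + s *\<^sub>R Y))) = F (g \<otimes>\<^bsub>G\<^esub> unchart a \<otimes>\<^bsub>G\<^esub> unit_curve G Y s)"
      by eventually_elim (simp add: chart_mult_def unit(5) unit_curve m_assoc)
    from has_vector_derivative_transform_nhds[OF _ this] elim show ?case by blast
  qed
qed

lemma lderiv_first:
  assumes f: "twice_differentiable (\<lambda>b. F (g \<otimes>\<^bsub>G\<^esub> unchart b)) f' f'' base"
  shows "lderiv G Y F g = f' base Y"
  using vector_derivative_at[OF eventually_nhds_x_imp_x[OF lderiv_near[OF f, of Y]]]
  by (simp add: lderiv_def fields_at_unit)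

lemma lderiv_along_curve:
  assumes f: "twice_differentiable (\<lambda>b. F (g \<otimes>\<^bsub>G\<^esub> unchart b)) f' f'' base" and c: "velocity_curve c X"
  shows "((\<lambda>s. F (g \<otimes>\<^bsub>G\<^esub> c s)) has_vector_derivative lderiv G X F g) (at 0)"
proof -
  have c': "((\<lambda>s. coord G (c s)) has_derivative (\<lambda>s. s *\<^sub>R X)) (at 0)" and c0: "coord G (c 0) = base"
    using c by (simp_all add: velocity_curve_def has_vector_derivative_def base_def)
  have D: "((\<lambda>b. F (g \<otimes>\<^bsub>G\<^esub> unchart b)) has_derivative f' base) (at (coord G (c 0)))"
    using twice_differentiable_first[OF f] c0 by simp
  from has_derivative_compose[OF c' D] linear_scale[OF has_derivative_linear[OF D]]
  have "((\<lambda>s. F (g \<otimes>\<^bsub>G\<^esub> unchart (coord G (c s)))) has_vector_derivative f' base X) (at 0)"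
    by (simp add: has_vector_derivative_def)
  moreover have "\<forall>\<^sub>F s in nhds 0. F (g \<otimes>\<^bsub>G\<^esub> unchart (coord G (c s))) = F (g \<otimes>\<^bsub>G\<^esub> c s)"
    using velocity_curve_chart[OF c] by eventually_elim (simp add: unit(5))
  ultimately show ?thesis
    unfolding lderiv_first[OF f] by (rule has_vector_derivative_transform_nhds)
qed

text \<open>The first claim supplies the existence of the derivative, which the equation for the
  iterated \<open>lderiv\<close> does not contain; \<open>lderiv_dirac\<close> depends on
  it.\<close>

lemma lderiv_second:
  assumes f: "twice_differentiable (\<lambda>b. F (g \<otimes>\<^bsub>G\<^esub> unchart b)) f' f'' base"
  shows "((\<lambda>s. lderiv G Y F (g \<otimes>\<^bsub>G\<^esub> unit_curve G X s)) has_vector_derivative f'' X Y + f' base (mixed X Y)) (at 0)"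
    "lderiv G X (lderiv G Y F) g = f'' X Y + f' base (mixed X Y)"
proof -
  have "\<forall>\<^sub>F s in nhds 0. f' (base + s *\<^sub>R X) (left_field (base + s *\<^sub>R X) Y) = lderiv G Y F (g \<otimes>\<^bsub>G\<^esub> unit_curve G X s)"
    using eventually_compose_filterlim[OF lderiv_near[OF f, of Y] filterlim_line[of base X]]
    by eventually_elim (simp add: lderiv_def unit_curve vector_derivative_at)
  from has_vector_derivative_transform_nhds[OF second_derivative_along_left_fields[OF f, of X Y] this]
  show "((\<lambda>s. lderiv G Y F (g \<otimes>\<^bsub>G\<^esub> unit_curve G X s)) has_vector_derivative f'' X Y + f' base (mixed X Y)) (at 0)" .
  then show "lderiv G X (lderiv G Y F) g = f'' X Y + f' base (mixed X Y)"
    unfolding lderiv_def[of G X "lderiv G Y F"] by (rule vector_derivative_at)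
qed

text \<open>In its own chart \<open>coord G\<close> is the identity, so its second derivative
  vanishes and only \<open>mixed\<close> remains.\<close>

lemma lie_bracket_mixed: "lie_bracket G X Y = mixed X Y - mixed Y X"
proof -
  have "twice_differentiable (\<lambda>b. 0 + b) (\<lambda>_ v. v) (\<lambda>_ _. 0) base"
    by (rule twice_differentiable_bounded_linear) simp
  then have "twice_differentiable (\<lambda>b. coord G (\<one>\<^bsub>G\<^esub> \<otimes>\<^bsub>G\<^esub> unchart b)) (\<lambda>_ v. v) (\<lambda>_ _. 0) base"
    by (rule twice_differentiable_cong)
      (use eventually_nhds_in_open[OF unit(2) base_in] in \<open>auto simp: unit elim!: eventually_mono\<close>)
  from lderiv_second(2)[OF this] show ?thesis by (simp add: lie_bracket_def)
qed

text \<open>Write \<open>g c(s) = (g c(s) g^-1) g\<close> with \<open>c\<close> the unit curve of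
  \<open>B\<close>. The velocity of the left side is \<open>left_field\<close>, that of the right
  side is \<open>right_field\<close> of the velocity of the conjugate curve. Staying near the
  identity keeps all factors in the chart.\<close>

lemma Ad_near: "\<forall>\<^sub>F a in nhds base. right_field a (Ad G (unchart a) B) = left_field a B"
proof -
  have lim: "((\<lambda>a. inv\<^bsub>G\<^esub> unchart a) \<longlongrightarrow> inv\<^bsub>G\<^esub> \<one>\<^bsub>G\<^esub>) (nhds base)"
    using tendsto_inv_group[OF tendsto_unchart[OF base_in]] by simp
  then have i: "\<forall>\<^sub>F a in nhds base. inv\<^bsub>G\<^esub> unchart a \<in> udom"
    by (rule eventually_in_open) (use unit(1) unit_chart(2) in simp_all)
  have "((\<lambda>a. coord G (inv\<^bsub>G\<^esub> unchart a)) \<longlongrightarrow> base) (nhds base)"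
    using filterlim_compose[OF tendsto_coord lim] unit_chart(2) by (simp add: base_def)
  then have "((\<lambda>a. (a, coord G (inv\<^bsub>G\<^esub> unchart a))) \<longlongrightarrow> (base, base)) (nhds base)"
    by (intro tendsto_Pair filterlim_ident)
  from eventually_compose_filterlim[OF mul_derivative this]
  have m: "\<forall>\<^sub>F a in nhds base. (chart_mult has_derivative mul' (a, coord G (inv\<^bsub>G\<^esub> unchart a))) (at (a, coord G (inv\<^bsub>G\<^esub> unchart a)))" .
  have "twice_differentiable (\<lambda>b. 0 + b) (\<lambda>_ v. v) (\<lambda>_ _. 0) base"
    by (rule twice_differentiable_bounded_linear) simp
  then have "twice_differentiable (\<lambda>b. b) (\<lambda>_ v. v) (\<lambda>_ _. 0) base" by simp
  note v = derivative_along_left_field[OF this, of B]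
  show ?thesis
    using i m v mul_derivative_slices(2) eventually_nhds_in_open[OF unit(2) base_in] right_unit
  proof eventually_elim
    case (elim a)
    define g where "g = unchart a"
    define k where "k s = g \<otimes>\<^bsub>G\<^esub> unit_curve G B s \<otimes>\<^bsub>G\<^esub> inv\<^bsub>G\<^esub> g" for s
    define w where "w s = chart_mult (a, base + s *\<^sub>R B)" for s
    have g: "g \<in> udom" "coord G g = a" "inv\<^bsub>G\<^esub> g \<in> udom" using elim unit by (simp_all add: g_def)
    have w: "(w has_vector_derivative left_field a B) (at 0)" using elim by (simp add: w_def[abs_def])
    have w0: "w 0 = a" using elim by (simp add: w_def)
    have "((\<lambda>s. g \<otimes>\<^bsub>G\<^esub> unit_curve G B s) \<longlongrightarrow> g \<otimes>\<^bsub>G\<^esub> \<one>\<^bsub>G\<^esub>) (nhds 0)"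
      by (intro tendsto_mult_group tendsto_const tendsto_unit_curve)
    then have in1: "\<forall>\<^sub>F s in nhds 0. g \<otimes>\<^bsub>G\<^esub> unit_curve G B s \<in> udom"
      by (rule eventually_in_open) (use g unit(1) in simp_all)
    have "(k \<longlongrightarrow> g \<otimes>\<^bsub>G\<^esub> \<one>\<^bsub>G\<^esub> \<otimes>\<^bsub>G\<^esub> inv\<^bsub>G\<^esub> g) (nhds 0)"
      unfolding k_def by (intro tendsto_mult_group tendsto_const tendsto_unit_curve)
    then have in2: "\<forall>\<^sub>F s in nhds 0. k s \<in> udom"
      by (rule eventually_in_open) (use unit_chart(2) unit(1) in simp_all)
    \<comment> \<open>The velocity of the conjugate curve, from multiplying the differentiable curve
      \<open>w\<close> by the inverse of \<open>g\<close>. Only since this derivative exists does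
      \<open>Ad\<close>, a \<open>vector_derivative\<close>, equal it.\<close>
    let ?p = "mul' (a, coord G (inv\<^bsub>G\<^esub> g)) (left_field a B, 0)"
    have "((\<lambda>s. (w s, coord G (inv\<^bsub>G\<^esub> g))) has_derivative (\<lambda>s. (s *\<^sub>R left_field a B, 0))) (at 0)"
      using w by (auto simp: has_vector_derivative_def intro!: derivative_eq_intros)
    moreover have D: "(chart_mult has_derivative mul' (a, coord G (inv\<^bsub>G\<^esub> g))) (at (w 0, coord G (inv\<^bsub>G\<^esub> g)))"
      using elim w0 by (simp add: g_def)
    ultimately have "((\<lambda>s. chart_mult (w s, coord G (inv\<^bsub>G\<^esub> g))) has_derivative (\<lambda>s. mul' (a, coord G (inv\<^bsub>G\<^esub> g)) (s *\<^sub>R left_field a B, 0))) (at 0)"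
      by (rule has_derivative_compose)
    then have "((\<lambda>s. chart_mult (w s, coord G (inv\<^bsub>G\<^esub> g))) has_vector_derivative ?p) (at 0)"
      using linear_scale[OF has_derivative_linear[OF D], of _ "(left_field a B, 0)"] by (simp add: has_vector_derivative_def)
    moreover have "\<forall>\<^sub>F s in nhds 0. chart_mult (w s, coord G (inv\<^bsub>G\<^esub> g)) = coord G (k s)"
      using in1 by eventually_elim (simp add: chart_mult_def w_def k_def g g_def[symmetric] unit(5) flip: unit_curve)
    ultimately have dk: "((\<lambda>s. coord G (k s)) has_vector_derivative ?p) (at 0)" by (rule has_vector_derivative_transform_nhds)
    then have Ad: "Ad G g B = ?p" by (simp add: Ad_def k_def vector_derivative_at)
    have k0: "coord G (k 0) = base" by (simp add: k_def base_def)
    have "((\<lambda>s. (coord G (k s), a)) has_derivative (\<lambda>s. (s *\<^sub>R ?p, 0))) (at 0)"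
      using dk by (auto simp: has_vector_derivative_def intro!: derivative_eq_intros)
    moreover have D: "(chart_mult has_derivative mul' (base, a)) (at (coord G (k 0), a))"
      using elim k0 by simp
    ultimately have "((\<lambda>s. chart_mult (coord G (k s), a)) has_derivative (\<lambda>s. mul' (base, a) (s *\<^sub>R ?p, 0))) (at 0)"
      by (rule has_derivative_compose)
    then have "((\<lambda>s. chart_mult (coord G (k s), a)) has_vector_derivative right_field a ?p) (at 0)"
      using linear_scale[OF has_derivative_linear[OF D], of _ "(?p, 0)"] by (simp add: has_vector_derivative_def right_field_def)
    moreover have "\<forall>\<^sub>F s in nhds 0. chart_mult (coord G (k s), a) = w s"
      using in2 by eventually_elim (simp add: chart_mult_def w_def unit(5) g_def[symmetric], simp add: k_def unit_curve m_assoc)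
    ultimately have "(w has_vector_derivative right_field a ?p) (at 0)" by (rule has_vector_derivative_transform_nhds)
    from vector_derivative_unique_at[OF this w] have "right_field a ?p = left_field a B" .
    with Ad show ?case by (simp add: g_def)
  qed
qed

lemma Ad_derivative:
  assumes c: "velocity_curve c A"
  shows "((\<lambda>s. Ad G (c s) B) has_vector_derivative lie_bracket G A B) (at 0)"
proof -
  have lim: "((\<lambda>s. coord G (c s)) \<longlongrightarrow> base) (nhds 0)"
    using filterlim_compose[OF tendsto_coord velocity_curve_tendsto[OF c]] unit_chart(2) by (simp add: base_def)
  have "\<forall>\<^sub>F s in nhds 0. right_field (coord G (c s)) (Ad G (c s) B) = left_field (coord G (c s)) B"
    using eventually_compose_filterlim[OF Ad_near[of B] lim] velocity_curve_chart[OF c]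
    by eventually_elim (simp add: unit(5))
  then show ?thesis
    unfolding lie_bracket_mixed using c
    by (intro derivative_of_adjoint[where a = "\<lambda>s. coord G (c s)"]) (simp_all add: velocity_curve_def base_def)
qed

end

section \<open>Left-invariant derivatives of smooth maps\<close>

context lie_group_chart begin

lemma products_exist: obtains m' m'' where "lie_group_products G m' m''"
  using chart_mult_local_group lie_group_chart_axioms by (auto simp: lie_group_products_def)

lemma lderiv_velocity_curve:
  fixes F :: "'g \<Rightarrow> 'v::euclidean_space"
  assumes "smooth_map G F" "velocity_curve c X"
  shows "((\<lambda>s. F (g \<otimes>\<^bsub>G\<^esub> c s)) has_vector_derivative lderiv G X F g) (at 0)"
  using products_exist translate_twice_differentiable[OF assms(1), of g] lie_group_products.lderiv_along_curve assms(2)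
  by metis

lemma linear_lderiv:
  fixes F :: "'g \<Rightarrow> 'v::euclidean_space"
  assumes "smooth_map G F"
  shows "linear (\<lambda>X. lderiv G X F g)"
proof -
  obtain f' f'' where f: "twice_differentiable (\<lambda>b. F (g \<otimes>\<^bsub>G\<^esub> unchart b)) f' f'' base"
    using translate_twice_differentiable[OF assms] .
  obtain m' m'' where "lie_group_products G m' m''" by (rule products_exist)
  then interpret lie_group_products G m' m'' .
  show ?thesis
    unfolding lderiv_first[OF f] by (rule has_derivative_linear[OF twice_differentiable_first[OF f]])
qed

lemma lderiv_lderiv:
  fixes F :: "'g \<Rightarrow> 'v::euclidean_space"
  assumes "smooth_map G F"
  shows lderiv_has_derivative:
    "((\<lambda>s. lderiv G Y F (g \<otimes>\<^bsub>G\<^esub> unit_curve G X s)) has_vector_derivative lderiv G X (lderiv G Y F) g) (at 0)"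
    and lderiv_commutator:
    "lderiv G X (lderiv G Y F) g - lderiv G Y (lderiv G X F) g = lderiv G (lie_bracket G X Y) F g"
proof -
  obtain f' f'' where f: "twice_differentiable (\<lambda>b. F (g \<otimes>\<^bsub>G\<^esub> unchart b)) f' f'' base"
    using translate_twice_differentiable[OF assms] .
  obtain m' m'' where "lie_group_products G m' m''" by (rule products_exist)
  then interpret lie_group_products G m' m'' .
  show "((\<lambda>s. lderiv G Y F (g \<otimes>\<^bsub>G\<^esub> unit_curve G X s)) has_vector_derivative lderiv G X (lderiv G Y F) g) (at 0)"
    unfolding lderiv_second(2)[OF f] by (rule lderiv_second(1)[OF f])
  have "linear (f' base)" using twice_differentiable_first[OF f] by (rule has_derivative_linear)
  then show "lderiv G X (lderiv G Y F) g - lderiv G Y (lderiv G X F) g = lderiv G (lie_bracket G X Y) F g"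
    unfolding lderiv_second(2)[OF f] lderiv_first[OF f] lie_bracket_mixed
    using second_derivative_symmetric[OF f, of X Y] by (simp add: linear_diff)
qed

lemma Ad_velocity_curve:
  "velocity_curve c A \<Longrightarrow> ((\<lambda>s. Ad G (c s) B) has_vector_derivative lie_bracket G A B) (at 0)"
  using products_exist lie_group_products.Ad_derivative by metis

lemma lie_bracket_antisym: "lie_bracket G X Y = - lie_bracket G Y X"
  by (simp add: lie_bracket_def)

end

section \<open>One-parameter groups in the spin group\<close>

text \<open>Integrating the homomorphism law gives
  \<open>s x * (J u - J 0) = J (x + u) - J x\<close> for an antiderivative \<open>J\<close>. For
  small \<open>u\<close> the factor \<open>J u - J 0\<close> is close to \<open>u\<close> times the
  unit and hence invertible, which exhibits \<open>s\<close> as a differentiable function.\<close>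

lemma continuous_hom_has_derivative:
  fixes s :: "real \<Rightarrow> 'c::{real_algebra_1, euclidean_space}"
  assumes cont: "continuous_on UNIV s" and hom: "\<And>x y. s (x + y) = s x * s y" and one: "s 0 = 1"
  obtains A where "(s has_vector_derivative A) (at 0)"
proof -
  have "bilinear ((*) :: 'c \<Rightarrow> 'c \<Rightarrow> 'c)"
    by (auto simp: bilinear_def algebra_simps intro!: linearI)
  then interpret mult: bounded_bilinear "(*) :: 'c \<Rightarrow> 'c \<Rightarrow> 'c"
    by (simp add: bilinear_conv_bounded_bilinear)
  \<comment> \<open>The interval is large enough for \<open>x + u\<close> with \<open>x\<close> and
    \<open>u\<close> of absolute value below 1.\<close>
  obtain J where "\<And>x. x \<in> {-2..2} \<Longrightarrow> (J has_vector_derivative s x) (at x within {-2..2})"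
    using antiderivative_continuous[of "-2" 2 s] continuous_on_subset[OF cont] by auto
  then have J: "(J has_vector_derivative s x) (at x)" if "-2 < x" "x < 2" for x
    using that at_within_Icc_at[of "-2" x 2] by (metis atLeastAtMost_iff less_imp_le)
  have translate: "s x * (J u - J 0) = J (x + u) - J x" if "\<bar>x\<bar> < 1" "0 \<le> u" "u < 1" for x u
  proof -
    have "((\<lambda>u. s x * (J u - J 0) - (J (x + u) - J x)) has_derivative (\<lambda>_. 0)) (at v within {0..u})"
      if "v \<in> {0..u}" for v
    proof -
      have v: "-2 < v" "v < 2" "-2 < x + v" "x + v < 2" using that \<open>\<bar>x\<bar> < 1\<close> \<open>u < 1\<close> by auto
      have "((\<lambda>u. J (x + u)) has_vector_derivative 1 *\<^sub>R s (x + v)) (at v)"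
        by (rule vector_diff_chain_at[of "\<lambda>u. x + u" 1 v J, unfolded o_def])
          (auto intro!: derivative_eq_intros J v)
      moreover have "((\<lambda>u. s x * (J u - J 0)) has_vector_derivative s x * (s v - 0)) (at v)"
        by (intro bounded_linear.has_vector_derivative[OF mult.bounded_linear_right] has_vector_derivative_diff J v has_vector_derivative_const)
      ultimately have "((\<lambda>u. s x * (J u - J 0) - (J (x + u) - J x)) has_vector_derivative (s x * (s v - 0) - (1 *\<^sub>R s (x + v) - 0))) (at v)"
        by (intro has_vector_derivative_diff has_vector_derivative_const)
      then show ?thesis
        by (simp add: hom has_vector_derivative_def has_derivative_at_withinI)
    qed
    from has_derivative_zero_unique[OF convex_real_interval(5) this, of u 0] \<open>0 \<le> u\<close>
    show ?thesis by auto
  qed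
  \<comment> \<open>The norm of \<open>'c\<close> need not be submultiplicative. With
    \<open>K\<close> as correction, the bound \<open>1 / (2 * K)\<close> below makes multiplication
    by \<open>1 - (1 / u) *\<^sub>R w\<close> shrink norms by half, so \<open>w * x = 0\<close>
    forces \<open>x = 0\<close>.\<close>
  obtain K where K: "K > 0" "\<And>a b::'c. norm (a * b) \<le> norm a * norm b * K"
    using mult.pos_bounded by blast
  have "((\<lambda>u. (1 / u) *\<^sub>R (J u - J 0)) \<longlongrightarrow> s 0) (at_right 0)"
    using J[of 0] by (auto simp: has_vector_derivative_iff_tendsto intro: tendsto_within_subset[OF _ subset_UNIV])
  then have "\<forall>\<^sub>F u in at_right 0. dist ((1 / u) *\<^sub>R (J u - J 0)) 1 < 1 / (2 * K)"
    using K one by (intro tendstoD) auto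
  moreover have "\<forall>\<^sub>F u::real in at_right 0. 0 < u \<and> u < 1"
    unfolding eventually_at_right_field by (intro exI[of _ 1]) auto
  ultimately have "\<forall>\<^sub>F u in at_right 0. dist ((1 / u) *\<^sub>R (J u - J 0)) 1 < 1 / (2 * K) \<and> 0 < u \<and> u < 1"
    by (rule eventually_conj)
  then obtain u where u: "dist ((1 / u) *\<^sub>R (J u - J 0)) 1 < 1 / (2 * K)" "0 < u" "u < 1"
    using eventually_happens trivial_limit_at_right_real by blast
  define w where "w = J u - J 0"
  have "inj (\<lambda>x. w * x)"
  proof (rule linear_injective_0[THEN iffD2, rule_format])
    show "linear (\<lambda>x. w * x)" by (auto intro!: linearI simp: algebra_simps)
    fix x assume "w * x = 0"
    then have "x = (1 - (1 / u) *\<^sub>R w) * x" by (simp add: left_diff_distrib)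
    then have "norm x \<le> norm (1 - (1 / u) *\<^sub>R w) * norm x * K" using K(2) by metis
    also have "\<dots> \<le> 1 / (2 * K) * norm x * K"
      using u(1) K(1) by (intro mult_right_mono) (auto simp: w_def dist_norm norm_minus_commute)
    also have "\<dots> = norm x / 2" using K(1) by simp
    finally show "x = 0" by simp
  qed
  moreover have "linear (\<lambda>x. w * x)" by (auto intro!: linearI simp: algebra_simps)
  \<comment> \<open>Finite dimension turns injectivity into surjectivity and so yields a right
    inverse of \<open>w\<close>.\<close>
  ultimately have "surj (\<lambda>x. w * x)" by (simp add: linear_injective_imp_surjective)
  then obtain w' where w': "1 = w * w'" unfolding surj_def by blast
  have "((\<lambda>x. J (x + u)) has_vector_derivative 1 *\<^sub>R s (0 + u)) (at 0)"
    by (rule vector_diff_chain_at[of "\<lambda>x. x + u" 1 0 J, unfolded o_def])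
      (use u in \<open>auto intro!: derivative_eq_intros J\<close>)
  then have "((\<lambda>x. (J (x + u) - J x) * w') has_vector_derivative (1 *\<^sub>R s (0 + u) - s 0) * w') (at 0)"
    by (intro bounded_linear.has_vector_derivative[OF mult.bounded_linear_left] has_vector_derivative_diff) (auto intro: J)
  moreover have "\<forall>\<^sub>F x in nhds 0. (J (x + u) - J x) * w' = s x"
    unfolding eventually_nhds_metric
  proof (intro exI[of _ 1] conjI allI impI)
    fix x :: real assume "dist x 0 < 1"
    then have "(J (x + u) - J x) * w' = s x * w * w'"
      using translate[of x u] u by (simp add: w_def)
    also have "\<dots> = s x" by (simp add: mult.assoc flip: w')
    finally show "(J (x + u) - J x) * w' = s x" .
  qed simp
  ultimately show ?thesis using that has_vector_derivative_transform_nhds by blast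
qed

lemma (in clifford_frame) square: "i \<in> I \<Longrightarrow> e i * e i = - 1"
proof -
  assume "i \<in> I"
  from anticommute[OF this this] have "2 *\<^sub>R (e i * e i) = 2 *\<^sub>R (- 1)"
    by (simp add: kron_def scaleR_2)
  then show ?thesis by (simp only: scaleR_cancel_left) simp
qed

lemma (in clifford_frame) anticommute_distinct:
  "i \<in> I \<Longrightarrow> j \<in> I \<Longrightarrow> i \<noteq> j \<Longrightarrow> e i * e j = - (e j * e i)"
  using swap[of j i] by (simp add: kron_def)

section \<open>Even and odd elements, and an invariant inner product\<close>

context clifford_frame begin

text \<open>The even (\<open>p\<close> true) or odd span of the ordered monomials in
  \<open>e 1, ..., e k\<close>, built by appending the last generator on the right. The
  decomposition into \<open>x\<close> and \<open>y\<close> is not claimed to be unique.\<close>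

primrec graded :: "nat \<Rightarrow> bool \<Rightarrow> 'c set" where
  "graded 0 p = (if p then span {1} else {0})"
| "graded (Suc k) p = {x + y * e (Suc k) |x y. x \<in> graded k p \<and> y \<in> graded k (\<not> p)}"

lemma graded_SucI: "x \<in> graded k p \<Longrightarrow> y \<in> graded k (\<not> p) \<Longrightarrow> x + y * e (Suc k) \<in> graded (Suc k) p"
  by auto

lemma subspace_graded: "subspace (graded k p)"
proof (induction k arbitrary: p)
  case (Suc k)
  show ?case
  proof (rule subspaceI)
    show "0 \<in> graded (Suc k) p"
      using subspace_0[OF Suc] by force
    fix x y assume "x \<in> graded (Suc k) p" "y \<in> graded (Suc k) p"
    then obtain a b c d where "x = a + b * e (Suc k)" "y = c + d * e (Suc k)"
      "a \<in> graded k p" "b \<in> graded k (\<not> p)" "c \<in> graded k p" "d \<in> graded k (\<not> p)" by auto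
    moreover from this have "x + y = (a + c) + (b + d) * e (Suc k)" by (simp add: algebra_simps)
    ultimately show "x + y \<in> graded (Suc k) p"
      by (simp only: graded_SucI subspace_add[OF Suc])
  next
    fix r x assume "x \<in> graded (Suc k) p"
    then obtain a b where "x = a + b * e (Suc k)" "a \<in> graded k p" "b \<in> graded k (\<not> p)" by auto
    moreover from this have "r *\<^sub>R x = r *\<^sub>R a + (r *\<^sub>R b) * e (Suc k)" by (simp add: algebra_simps)
    ultimately show "r *\<^sub>R x \<in> graded (Suc k) p"
      by (simp only: graded_SucI subspace_scale[OF Suc])
  qed
qed simp

lemma graded_mono: "x \<in> graded k p \<Longrightarrow> x \<in> graded (Suc k) p"
  using subspace_0[OF subspace_graded] by force

lemma one_graded: "1 \<in> graded k True"
proof (induction k)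
  case 0 then show ?case by (simp add: span_base)
qed (rule graded_mono)

lemma graded_commute:
  assumes "x \<in> graded k p" "k < j" "j \<in> I" "{1..k} \<subseteq> I"
  shows "e j * x = (if p then x * e j else - (x * e j))"
  using assms
proof (induction k arbitrary: p x)
  case 0
  then show ?case by (auto simp: span_singleton split: if_splits)
next
  case (Suc k)
  then obtain a b where x: "x = a + b * e (Suc k)" "a \<in> graded k p" "b \<in> graded k (\<not> p)" by auto
  have I: "k < j" "{1..k} \<subseteq> I" "Suc k \<in> I" using Suc.prems by auto
  note Suc.IH[OF x(2) I(1) Suc.prems(3) I(2)] Suc.IH[OF x(3) I(1) Suc.prems(3) I(2)]
  moreover have "e j * (b * e (Suc k)) = (e j * b) * e (Suc k)" by (simp add: mult.assoc)
  moreover have "b * e j * e (Suc k) = - (b * e (Suc k) * e j)"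
    using anticommute_distinct[of j "Suc k"] Suc.prems I by (simp add: mult.assoc)
  ultimately show ?case by (cases p) (simp_all add: x(1) distrib_left distrib_right mult.assoc)
qed

lemma graded_mult:
  assumes "x \<in> graded k p" "j \<in> {1..k}" "{1..k} \<subseteq> I"
  shows "x * e j \<in> graded k (\<not> p)"
  using assms
proof (induction k arbitrary: p x)
  case (Suc k)
  then obtain a b where x: "x = a + b * e (Suc k)" "a \<in> graded k p" "b \<in> graded k (\<not> p)" by auto
  show ?case
  proof (cases "j = Suc k")
    case True
    have "Suc k \<in> I" using Suc.prems by auto
    then have eq: "x * e j = - b + a * e (Suc k)"
      using square[of "Suc k"] True by (simp add: x(1) distrib_right mult.assoc)
    show ?thesis
      unfolding eq by (rule graded_SucI) (use x subspace_neg[OF subspace_graded] in auto)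
  next
    case False
    then have I: "{1..k} \<subseteq> I" and j: "j \<in> {1..k}" "j \<in> I" "Suc k \<in> I" "Suc k \<noteq> j" using Suc.prems by auto
    then have "x * e j = a * e j + (- (b * e j)) * e (Suc k)"
      using anticommute_distinct[of "Suc k" j] by (simp add: x(1) distrib_right mult.assoc)
    moreover have "a * e j \<in> graded k (\<not> p)" "- (b * e j) \<in> graded k (\<not> \<not> p)"
      using Suc.IH[OF x(2) j(1) I] Suc.IH[OF x(3) j(1) I] subspace_neg[OF subspace_graded] by auto
    ultimately show ?thesis by (simp only: graded_SucI)
  qed
qed simp

text \<open>In \<open>x = a + b * e (Suc k)\<close> the last generator commutes with the even
  \<open>a\<close> and anticommutes with the odd \<open>b\<close>. Commuting with \<open>x\<close>
  therefore forces \<open>b = 0\<close>, and \<open>a\<close> involves fewer generators. Parity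
  matters: in odd dimension the volume element is central as well, but odd.\<close>

lemma even_central_scalar:
  assumes "x \<in> graded k True" "{1..k} \<subseteq> I" "\<And>j. j \<in> {1..k} \<Longrightarrow> e j * x = x * e j"
  shows "x \<in> span {1}"
  using assms
proof (induction k arbitrary: x)
  case (Suc k)
  let ?e = "e (Suc k)"
  obtain a b where x: "x = a + b * ?e" "a \<in> graded k True" "b \<in> graded k False"
    using Suc.prems(1) by auto
  have I: "Suc k \<in> I" "{1..k} \<subseteq> I" using Suc.prems(2) by auto
  have e: "?e * ?e = - 1" by (rule square[OF I(1)])
  have "?e * a = a * ?e" "?e * b = - (b * ?e)"
    using graded_commute[OF x(2), of "Suc k"] graded_commute[OF x(3), of "Suc k"] I by simp_all
  moreover have "?e * (b * ?e) = (?e * b) * ?e" by (simp add: mult.assoc)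
  ultimately have "?e * x = a * ?e + b" "x * ?e = a * ?e - b"
    by (simp_all add: x(1) distrib_left distrib_right mult.assoc e)
  moreover have "?e * x = x * ?e" by (rule Suc.prems(3)) simp
  ultimately have "- b = b" by simp
  then have "b + b = 0" by (metis add.right_inverse)
  then have "b = 0" by (simp flip: scaleR_2)
  then have "x = a" by (simp add: x(1))
  with x(2) I(2) Suc.prems(3) show ?case by (intro Suc.IH) simp_all
qed simp

text \<open>Averaging one generator at a time. The new form is invariant under
  \<open>e (Suc k)\<close> because that generator squares to \<open>- 1\<close>, and stays invariant
  under the earlier ones because the sign from anticommuting occurs in both arguments.\<close>

lemma invariant_inner_product:
  fixes B0 :: "'c \<Rightarrow> 'c \<Rightarrow> real"
  assumes "{1..k} \<subseteq> I" and inner: "bilinear B0" "\<And>x y. B0 x y = (B0 y x :: real)" "\<And>x. x \<noteq> 0 \<Longrightarrow> B0 x x > 0"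
  shows "\<exists>B. bilinear B \<and> (\<forall>x y. B x y = (B y x :: real)) \<and> (\<forall>x. x \<noteq> 0 \<longrightarrow> B x x > 0) \<and>
    (\<forall>i\<in>{1..k}. \<forall>x y. B (e i * x) (e i * y) = B x y)"
  using assms(1)
proof (induction k)
  case 0
  have "\<forall>x y. B0 x y = B0 y x" using inner(2) by blast
  then show ?case using inner(1,3) by (intro exI[of _ B0]) simp
next
  case (Suc k)
  then have "{1..k} \<subseteq> I" by auto
  from Suc.IH[OF this] obtain B where *: "bilinear B \<and> (\<forall>x y. B x y = (B y x :: real)) \<and>
    (\<forall>x. x \<noteq> 0 \<longrightarrow> B x x > 0) \<and> (\<forall>i\<in>{1..k}. \<forall>x y. B (e i * x) (e i * y) = B x y)" ..
  then have B: "bilinear B" "\<And>x. x \<noteq> 0 \<Longrightarrow> B x x > 0"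
      "\<And>i x y. i \<in> {1..k} \<Longrightarrow> B (e i * x) (e i * y) = B x y" by simp_all
  have sym: "B x y = B y x" for x y using * by blast
  let ?e = "e (Suc k)"
  define B' where "B' x y = B x y + B (?e * x) (?e * y)" for x y
  have nonneg: "B x x \<ge> 0" for x
    using B(2)[of x] bilinear_lzero[OF B(1), of 0] by (cases "x = 0") auto
  have I: "Suc k \<in> I" "{1..k} \<subseteq> I" using Suc.prems by auto
  have ee: "?e * (?e * x) = - x" for x
    using square[OF I(1)] by (simp flip: mult.assoc)
  have "B' (e i * x) (e i * y) = B' x y" if i: "i \<in> {1..Suc k}" for i x y
  proof (cases "i = Suc k")
    case True
    then show ?thesis by (simp add: B'_def ee bilinear_lneg[OF B(1)] bilinear_rneg[OF B(1)])
  next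
    case False
    then have i': "i \<in> {1..k}" using i by auto
    have "?e * (e i * x) = - (e i * (?e * x))" for x
      using anticommute_distinct[of "Suc k" i] i' I False by (auto simp flip: mult.assoc)
    then show ?thesis
      using B(3)[OF i'] by (simp add: B'_def bilinear_lneg[OF B(1)] bilinear_rneg[OF B(1)])
  qed
  moreover have "bilinear B'"
    using B(1) unfolding bilinear_def B'_def
    by (auto intro!: linearI simp: linear_add linear_scale distrib_left bilinear_ladd[OF B(1)]  bilinear_radd[OF B(1)]
       bilinear_lmul[OF B(1)] bilinear_rmul[OF B(1)])
  moreover have "B' x y = B' y x" for x y by (simp only: B'_def sym[of x] sym[of "?e * x"])
  moreover have "B' x x > 0" if "x \<noteq> 0" for x
    using B(2)[OF that] nonneg by (simp add: B'_def add_pos_nonneg)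
  ultimately show ?case by (intro exI[of _ B']) auto
qed


end

section \<open>Isometries by spin elements and the derivative of a curve of them\<close>

locale clifford_frame_euclidean = clifford_frame "{1..n}" e
  for n and e :: "nat \<Rightarrow> 'c::{real_algebra_1, euclidean_space}"
begin

definition combination :: "(nat \<Rightarrow> real) \<Rightarrow> 'c" where
  "combination v = (\<Sum>i=1..n. v i *\<^sub>R e i)"

text \<open>Contains the spin group; all its elements are even and act by isometries of every inner
  product that is invariant under the generators.\<close>

inductive_set spin :: "'c set" where
  spin_one: "1 \<in> spin"
| spin_mult: "x \<in> spin \<Longrightarrow> (\<Sum>i=1..n. (v i)\<^sup>2) = 1 \<Longrightarrow> (\<Sum>i=1..n. (w i)\<^sup>2) = 1
    \<Longrightarrow> x * combination v * combination w \<in> spin"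

lemma graded_mult_combination: "x \<in> graded n p \<Longrightarrow> x * combination v \<in> graded n (\<not> p)"
  unfolding combination_def sum_distrib_left
  by (intro subspace_sum subspace_graded) (auto intro!: subspace_scale subspace_graded graded_mult simp del: graded.simps)

lemma spin_graded: "x \<in> spin \<Longrightarrow> x \<in> graded n True"
proof (induction rule: spin.induct)
  case (spin_mult x v w)
  from graded_mult_combination[OF graded_mult_combination[OF spin_mult(4), of v], of w] show ?case by simp
qed (rule one_graded)

text \<open>Being an isometry is not linear in \<open>v\<close>, but being skew is. Each generator
  is a skew isometry, hence so far \<open>combination v\<close> is skew; it squares to
  \<open>- 1\<close> for a unit vector, and the two facts together make it an isometry.\<close>

lemma combination_isometry:
  assumes B: "bilinear B" "\<And>i x y. i \<in> {1..n} \<Longrightarrow> B (e i * x) (e i * y) = (B x y :: real)"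
    and v: "(\<Sum>i=1..n. (v i)\<^sup>2) = 1"
  shows "B (combination v * x) (combination v * y) = B x y"
proof -
  have skew: "B (e i * x) y = - B x (e i * y)" if "i \<in> {1..n}" for i x y
  proof -
    have "e i * (e i * y) = - y" using square[OF that] by (simp flip: mult.assoc)
    then have "- B (e i * x) y = B x (e i * y)"
      using B(2)[OF that, of x "e i * y"] by (simp add: bilinear_rneg[OF B(1)])
    then show ?thesis by linarith
  qed
  have lin: "linear (\<lambda>x. B x y)" "linear (B x)" for x y using B(1) by (auto simp: bilinear_def)
  have "B (combination v * x) y = - B x (combination v * y)" for x y
    by (simp add: combination_def sum_distrib_right linear_sum[OF lin(1)] linear_sum[OF lin(2)]
      linear_scale[OF lin(1)] linear_scale[OF lin(2)] skew sum_negf)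
  moreover have "combination v * (combination v * y) = - y"
  proof -
    have "combination v * combination v = (\<Sum>i=1..n. \<Sum>j=1..n. (v i * v j) *\<^sub>R (e i * e j))"
      by (simp add: combination_def sum_product mult.commute[of "v _" "v _"])
    also have "\<dots> = (- (\<Sum>i=1..n. v i * v i)) *\<^sub>R 1"
      by (rule symmetric_contraction) simp
    finally show ?thesis using v by (simp add: power2_eq_square flip: mult.assoc)
  qed
  ultimately show ?thesis by (simp add: linear_neg[OF lin(2)])
qed

lemma spin_isometry:
  assumes "s \<in> spin" and B: "bilinear B" "\<And>i x y. i \<in> {1..n} \<Longrightarrow> B (e i * x) (e i * y) = (B x y :: real)"
  shows "B (s * x) (s * y) = B x y"
  using assms(1)
proof (induction arbitrary: x y rule: spin.induct)
  case (spin_mult s v w)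
  show ?case
    by (simp only: mult.assoc spin_mult.IH combination_isometry[OF B spin_mult.hyps(2)]
      combination_isometry[OF B spin_mult.hyps(3)])
qed simp

lemma spin_curve_derivative:
  assumes s: "(s has_vector_derivative A) (at 0)" "s 0 = 1" "\<And>t. s t \<in> spin"
    and y: "\<And>a b. y a b = - y b a"
    and comm: "\<And>j. j \<in> {1..n} \<Longrightarrow> A * e j - e j * A = (\<Sum>p=1..n. y j p *\<^sub>R e p)"
  shows "A = (1/4) *\<^sub>R quadratic y"
proof -
  define D where "D = A - (1/4) *\<^sub>R quadratic y"
  \<comment> \<open>The difference quotients are even, and the even elements form a closed subspace,
    so \<open>A\<close> is even as well.\<close>
  have "((\<lambda>t. (1 / t) *\<^sub>R (s t - s 0)) \<longlongrightarrow> A) (at 0)"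
    using s(1) by (simp add: has_vector_derivative_iff_tendsto)
  moreover have "(1 / t) *\<^sub>R (s t - s 0) \<in> graded n True" for t
    using spin_graded[OF s(3)] by (intro subspace_scale subspace_diff subspace_graded)
  ultimately have "A \<in> graded n True"
    using closed_subspace[OF subspace_graded] by (intro Lim_in_closed_set) auto
  moreover have "quadratic y \<in> graded n True"
  proof -
    have "e a * e b \<in> graded n True" if "a \<in> {1..n}" "b \<in> {1..n}" for a b
      using graded_mult[OF graded_mult[OF one_graded that(1)] that(2)] by simp
    then show ?thesis
      unfolding quadratic_def by (intro subspace_sum subspace_graded subspace_scale)
  qed
  ultimately have "D \<in> graded n True"
    unfolding D_def by (intro subspace_diff subspace_scale subspace_graded)
  moreover have "e j * D = D * e j" if "j \<in> {1..n}" for j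
  proof -
    have "D * e j - e j * D = (A * e j - e j * A) + (1/4) *\<^sub>R (e j * quadratic y - quadratic y * e j)"
      by (simp add: D_def algebra_simps)
    also have "\<dots> = 0"
      by (simp only: comm[OF that] quadratic_commutator[OF y that]) simp
    finally show ?thesis by simp
  qed
  ultimately have "D \<in> span {1}" by (intro even_central_scalar[of D n]) auto
  then obtain l where l: "D = l *\<^sub>R 1" by (auto simp: span_singleton)
  \<comment> \<open>Pairing with \<open>1\<close> under an invariant inner product detects the
    scalar \<open>l\<close>: both \<open>A\<close> and \<open>quadratic y\<close> turn out to be
    orthogonal to \<open>1\<close>, the former because \<open>B (s t) (s t)\<close> is
    constant.\<close>
  obtain B where B: "bilinear B" "\<And>x y. B x y = (B y x :: real)" "\<And>x. x \<noteq> 0 \<Longrightarrow> B x x > 0"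
    "\<And>i x y. i \<in> {1..n} \<Longrightarrow> B (e i * x) (e i * y) = B x y"
    using invariant_inner_product[of n "(\<bullet>)"]
    by (auto simp: inner_commute bilinear_conv_bounded_bilinear bounded_bilinear_inner)
  have lin: "linear (\<lambda>x. B x y)" for y using B(1) by (simp add: bilinear_def)
  interpret B: bounded_bilinear B using B(1) by (simp add: bilinear_conv_bounded_bilinear)
  have "((\<lambda>t. B (s t) (s t)) has_vector_derivative B (s 0) A + B A (s 0)) (at 0)"
    by (rule B.has_vector_derivative[OF s(1) s(1)])
  moreover have "B (s t) (s t) = B 1 1" for t
    using spin_isometry[OF s(3) B(1,4), of t 1 1] by simp
  ultimately have "((\<lambda>t::real. B 1 1) has_vector_derivative B 1 A + B A 1) (at 0)"
    using s(2) by simp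
  from vector_derivative_unique_at[OF this has_vector_derivative_const] B(2)[of 1 A]
  have "B A 1 = 0" by simp
  \<comment> \<open>By invariance, \<open>B (e a * e b) 1 = - B (e b) (e a)\<close> is symmetric in
    \<open>a\<close> and \<open>b\<close>, while \<open>y\<close> is antisymmetric.\<close>
  moreover have "B (quadratic y) 1 = 0"
  proof -
    have "B (quadratic y) 1 = (\<Sum>a=1..n. \<Sum>b=1..n. y a b * B (e a * e b) 1)"
      unfolding quadratic_def by (simp add: linear_sum[OF lin] linear_scale[OF lin])
    also have "\<dots> = (\<Sum>a=1..n. \<Sum>b=1..n. - (y a b * B (e b) (e a)))"
    proof (intro sum.cong refl)
      fix a b assume a: "a \<in> {1..n}"
      have "B (e a * e b) 1 = - B (e a * e b) (e a * e a)"
        using square[OF a] by (simp add: bilinear_rneg[OF B(1)])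
      then show "y a b * B (e a * e b) 1 = - (y a b * B (e b) (e a))" using B(4)[OF a] by simp
    qed
    finally have 1: "B (quadratic y) 1 = - (\<Sum>a=1..n. \<Sum>b=1..n. y a b * B (e b) (e a))" by (simp add: sum_negf)
    have "(\<Sum>a=1..n. \<Sum>b=1..n. y a b * B (e b) (e a)) = (\<Sum>a=1..n. \<Sum>b=1..n. y b a * B (e a) (e b))"
      by (rule sum.swap)
    also have "\<dots> = - (\<Sum>a=1..n. \<Sum>b=1..n. y a b * B (e b) (e a))"
      unfolding sum_negf[symmetric]
    proof (intro sum.cong refl)
      fix a b
      show "y b a * B (e a) (e b) = - (y a b * B (e b) (e a))"
        using y[of b a] B(2)[of "e a" "e b"] by simp
    qed
    finally show ?thesis using 1 by simp
  qed
  ultimately have "l * B 1 1 = 0"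
    using linear_diff[OF lin] linear_scale[OF lin] l D_def by (metis diff_self mult_zero_right real_scaleR_def)
  with B(3)[of 1] l have "D = 0" by simp
  then show ?thesis by (simp add: D_def)
qed

end

section \<open>Naturally reductive spaces with a homogeneous spin structure\<close>

lemma (in lie_group_chart) Ad_one: "Ad G \<one>\<^bsub>G\<^esub> B = B"
  using unit_curve_velocity[of B] by (simp add: Ad_def velocity_curve_def vector_derivative_at)

lemma (in lie_group_chart) one_parameter_group_velocity:
  assumes "one_parameter_group G X c"
  shows "velocity_curve c X" "inv\<^bsub>G\<^esub> c t = c (- t)"
proof -
  have hom: "c (s + t) = c s \<otimes>\<^bsub>G\<^esub> c t" for s t
    using assms by (simp add: one_parameter_group_def)
  have "c 0 = c 0 \<otimes>\<^bsub>G\<^esub> c 0" using hom[of 0 0] by simp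
  then have c0: "c 0 = \<one>\<^bsub>G\<^esub>" by (metis UNIV_I carrier l_cancel_one')
  then show "velocity_curve c X"
    using assms by (simp add: one_parameter_group_def velocity_curve_def continuous_on_eq_continuous_at)
  show "inv\<^bsub>G\<^esub> c t = c (- t)"
    using hom[of "- t" t] c0 by (intro inv_equality) simp_all
qed

lemma (in lie_group_chart) Q_ad:
  assumes Q: "bounded_bilinear Q" "\<And>g A B. Q (Ad G g A) (Ad G g B) = (Q A B :: real)"
  shows "Q (lie_bracket G A B) C + Q B (lie_bracket G A C) = 0"
proof -
  interpret Q: bounded_bilinear Q by (rule Q(1))
  note Ad = Ad_velocity_curve[OF unit_curve_velocity[of A]]
  have "((\<lambda>s. Q (Ad G (unit_curve G A s) B) (Ad G (unit_curve G A s) C)) has_vector_derivative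
     Q (Ad G (unit_curve G A 0) B) (lie_bracket G A C) + Q (lie_bracket G A B) (Ad G (unit_curve G A 0) C)) (at 0)"
    by (rule Q.has_vector_derivative[OF Ad Ad])
  then have "((\<lambda>s::real. Q B C) has_vector_derivative Q B (lie_bracket G A C) + Q (lie_bracket G A B) C) (at 0)"
    by (simp add: Q(2) Ad_one)
  from vector_derivative_unique_at[OF this has_vector_derivative_const] show ?thesis by simp
qed

locale naturally_reductive_space =
  fixes M :: "('g::{t2_space, second_countable_topology}, 'e::euclidean_space) homogeneous_space"
    and Q :: "'e \<Rightarrow> 'e \<Rightarrow> real" and n :: nat and Z :: "nat \<Rightarrow> 'e"
  assumes naturally_reductive: "naturally_reductive M"
    and invariant_extension: "invariant_extension M Q"
    and orthonormal_basis: "orthonormal_basis M n Z"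
begin

abbreviation bracket where "bracket \<equiv> lie_bracket M"
abbreviation \<mm> where "\<mm> \<equiv> complement M"
abbreviation \<hh> where "\<hh> \<equiv> isotropy_algebra M"

lemma reductive: "is_lie_group M" "subgroup (isotropy M) M" "subspace \<hh>" "subspace \<mm>" "\<hh> \<inter> \<mm> = {0}"
    "\<exists>V\<in>\<hh>. \<exists>W\<in>\<mm>. A = V + W" "g \<in> isotropy M \<Longrightarrow> W \<in> \<mm> \<Longrightarrow> Ad M g W \<in> \<mm>"
  using naturally_reductive
  unfolding naturally_reductive_def is_reductive_homogeneous_space_def by blast+

sublocale lie_group_chart M by unfold_locales (rule reductive)

lemma Q_props: "bilinear Q" "Q A B = Q B A" "Q (Ad M g A) (Ad M g B) = Q A B"
    "V \<in> \<hh> \<Longrightarrow> W \<in> \<mm> \<Longrightarrow> Q V W = 0" "W \<in> \<mm> \<Longrightarrow> W' \<in> \<mm> \<Longrightarrow> ip M W W' = Q W W'"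
  using invariant_extension by (auto simp: invariant_extension_def)

sublocale Q: bounded_bilinear Q
  using Q_props(1) by (simp add: bilinear_conv_bounded_bilinear)

lemmas ad_invariant = Q_ad[OF Q.bounded_bilinear_axioms Q_props(3)]

lemma decomposition_unique:
  assumes "V \<in> \<hh>" "W \<in> \<mm>" "V' \<in> \<hh>" "W' \<in> \<mm>" "V + W = V' + W'"
  shows "V = V'" "W = W'"
proof -
  have "V - V' = W' - W" using assms(5) by (simp add: algebra_simps)
  moreover have "V - V' \<in> \<hh>" "W' - W \<in> \<mm>" using assms reductive(3,4) by (auto intro: subspace_diff)
  ultimately have "V - V' \<in> \<hh> \<inter> \<mm>" "W' - W \<in> \<hh> \<inter> \<mm>" by auto
  then show "V = V'" "W = W'" using reductive(5) by auto
qed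

lemma parts: "h_part M A \<in> \<hh>" "m_part M A \<in> \<mm>" "A = h_part M A + m_part M A"
proof -
  obtain V W where VW: "V \<in> \<hh>" "W \<in> \<mm>" "A = V + W" using reductive(6) by blast
  have "h_part M A = V" unfolding h_part_def
  proof (rule the_equality)
    fix V' assume "V' \<in> \<hh> \<and> A - V' \<in> \<mm>"
    then show "V' = V" using decomposition_unique(1)[of V' "A - V'" V W] VW by simp
  qed (use VW in simp)
  moreover have "m_part M A = W" unfolding m_part_def
  proof (rule the_equality)
    fix W' assume "W' \<in> \<mm> \<and> A - W' \<in> \<hh>"
    then show "W' = W" using decomposition_unique(2)[of "A - W'" W' V W] VW by simp
  qed (use VW in simp)
  ultimately show "h_part M A \<in> \<hh>" "m_part M A \<in> \<mm>" "A = h_part M A + m_part M A" using VW by simp_all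
qed

lemma parts_minus: "h_part M (- A) = - h_part M A" "m_part M (- A) = - m_part M A"
proof -
  have "h_part M (- A) + m_part M (- A) = - h_part M A + - m_part M A"
    using parts(3)[of A] parts(3)[of "- A"] by (simp add: algebra_simps flip: minus_add)
  then show "h_part M (- A) = - h_part M A" "m_part M (- A) = - m_part M A"
    using decomposition_unique parts subspace_neg reductive(3,4) by meson+
qed

lemma Q_parts: "V \<in> \<hh> \<Longrightarrow> Q V A = Q V (h_part M A)" "W \<in> \<mm> \<Longrightarrow> Q W A = Q W (m_part M A)"
proof -
  show "V \<in> \<hh> \<Longrightarrow> Q V A = Q V (h_part M A)"
    by (subst parts(3)) (simp add: Q.add_right Q_props(4) parts)
  show "W \<in> \<mm> \<Longrightarrow> Q W A = Q W (m_part M A)"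
    by (subst parts(3)) (simp add: Q.add_right Q_props(4)[OF parts(1)] Q_props(2)[of W])
qed

lemma Z: "i \<in> {1..n} \<Longrightarrow> Z i \<in> \<mm>"
    "i \<in> {1..n} \<Longrightarrow> j \<in> {1..n} \<Longrightarrow> Q (Z i) (Z j) = kron i j"
proof -
  show Z: "i \<in> {1..n} \<Longrightarrow> Z i \<in> \<mm>" for i
    using orthonormal_basis span_base[of "Z i" "Z ` {1..n}"] by (auto simp: orthonormal_basis_def)
  show "i \<in> {1..n} \<Longrightarrow> j \<in> {1..n} \<Longrightarrow> Q (Z i) (Z j) = kron i j"
    using orthonormal_basis Q_props(5)[OF Z Z, of i j] by (auto simp: orthonormal_basis_def kron_def)
qed

lemma expand: "W \<in> \<mm> \<Longrightarrow> W = (\<Sum>i=1..n. Q W (Z i) *\<^sub>R Z i)"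
proof -
  have "subspace {W. W = (\<Sum>i=1..n. Q W (Z i) *\<^sub>R Z i)}"
  proof (rule subspaceI)
    fix a :: real and W assume "W \<in> {W. W = (\<Sum>i=1..n. Q W (Z i) *\<^sub>R Z i)}"
    then have W: "W = (\<Sum>i=1..n. Q W (Z i) *\<^sub>R Z i)" by simp
    have "a *\<^sub>R W = a *\<^sub>R (\<Sum>i=1..n. Q W (Z i) *\<^sub>R Z i)" by (rule arg_cong[OF W])
    also have "\<dots> = (\<Sum>i=1..n. (a *\<^sub>R Q W (Z i)) *\<^sub>R Z i)" by (simp add: scaleR_sum_right)
    finally show "a *\<^sub>R W \<in> {W. W = (\<Sum>i=1..n. Q W (Z i) *\<^sub>R Z i)}"
      unfolding mem_Collect_eq Q.scaleR_left .
  qed (auto simp: Q.zero_left Q.add_left scaleR_add_left sum.distrib)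
  moreover have "Z j = (\<Sum>i=1..n. Q (Z j) (Z i) *\<^sub>R Z i)" if j: "j \<in> {1..n}" for j
  proof -
    have "(\<Sum>i=1..n. Q (Z j) (Z i) *\<^sub>R Z i) = (\<Sum>i=1..n. if i = j then Z i else 0)"
      by (intro sum.cong refl) (use j in \<open>auto simp: Z kron_def\<close>)
    then show ?thesis using j by simp
  qed
  ultimately have "span (Z ` {1..n}) \<subseteq> {W. W = (\<Sum>i=1..n. Q W (Z i) *\<^sub>R Z i)}"
    by (intro span_minimal) auto
  then show "W \<in> \<mm> \<Longrightarrow> W = (\<Sum>i=1..n. Q W (Z i) *\<^sub>R Z i)"
    using orthonormal_basis by (auto simp: orthonormal_basis_def)
qed

lemma parseval: "W \<in> \<mm> \<Longrightarrow> Q W A = (\<Sum>i=1..n. Q W (Z i) * Q A (Z i))"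
proof -
  assume "W \<in> \<mm>"
  then have "Q W A = Q (\<Sum>i=1..n. Q W (Z i) *\<^sub>R Z i) A" using expand by metis
  also have "\<dots> = (\<Sum>i=1..n. Q W (Z i) * Q A (Z i))"
    unfolding Q.sum_left Q.scaleR_left by (simp add: Q_props(2)[of "Z _" A])
  finally show ?thesis .
qed

lemma isotropy_curve:
  assumes "V \<in> \<hh>"
  obtains c where "one_parameter_group M V c" "range c \<subseteq> isotropy M"
  using assms by (auto simp: subgroup_lie_algebra_def)

text \<open>The bracket is the derivative of \<open>Ad M (c s) W\<close>, a curve in the closed
  subspace \<mm>.\<close>

lemma bracket_h_m:
  assumes "V \<in> \<hh>" "W \<in> \<mm>"
  shows "bracket V W \<in> \<mm>"
proof -
  obtain c where c: "one_parameter_group M V c" "range c \<subseteq> isotropy M"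
    using isotropy_curve[OF assms(1)] .
  have "((\<lambda>s. (1 / s) *\<^sub>R (Ad M (c s) W - Ad M (c 0) W)) \<longlongrightarrow> bracket V W) (at 0)"
    using Ad_velocity_curve[OF one_parameter_group_velocity(1)[OF c(1)]] by (simp add: has_vector_derivative_iff_tendsto)
  moreover have mem: "Ad M (c s) W \<in> \<mm>" for s using c(2) reductive(7)[OF _ assms(2)] by auto
  have "(1 / s) *\<^sub>R (Ad M (c s) W - Ad M (c 0) W) \<in> \<mm>" for s
    by (intro subspace_scale subspace_diff reductive(4) mem)
  ultimately show ?thesis
    using closed_subspace[OF reductive(4)] by (intro Lim_in_closed_set) auto
qed


text \<open>Zero outside the index range, so that total antisymmetry holds for all natural numbers,
  as \<open>cubic_square\<close> requires.\<close>

definition structure_const :: "nat \<Rightarrow> nat \<Rightarrow> nat \<Rightarrow> real" where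
  "structure_const i j k = (if {i, j, k} \<subseteq> {1..n} then Q (m_part M (bracket (Z i) (Z j))) (Z k) else 0)"

text \<open>The second equation is natural reductivity; together they make the constants totally
  antisymmetric.\<close>

lemma structure_const_antisym:
  "structure_const i j k = - structure_const j i k" "structure_const i j k = - structure_const i k j"
proof -
  show "structure_const i j k = - structure_const j i k"
    using lie_bracket_antisym[of "Z i" "Z j"] by (auto simp: structure_const_def parts_minus Q.minus_left)
  have "Q (m_part M (bracket (Z i) (Z j))) (Z k) = - Q (m_part M (bracket (Z i) (Z k))) (Z j)"
    if "i \<in> {1..n}" "j \<in> {1..n}" "k \<in> {1..n}"
  proof -
    have "ip M (m_part M (bracket (Z i) (Z j))) (Z k) + ip M (Z j) (m_part M (bracket (Z i) (Z k))) = 0"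
      using naturally_reductive Z(1) that unfolding naturally_reductive_def by blast
    then show ?thesis
      using Q_props(5)[OF parts(2) Z(1)] Q_props(5)[OF Z(1) parts(2)] that Q_props(2)[of "Z j"] by (simp add: eq_neg_iff_add_eq_0)
  qed
  then show "structure_const i j k = - structure_const i k j"
    by (auto simp: structure_const_def)
qed

definition R_h :: "nat \<Rightarrow> nat \<Rightarrow> nat \<Rightarrow> nat \<Rightarrow> real" where
  "R_h i j k l = Q (h_part M (bracket (Z i) (Z j))) (h_part M (bracket (Z k) (Z l)))"

text \<open>Written with \<open>structure_const\<close> to match the tensor in
  \<open>cubic_square\<close>; on actual indices it is the analogue of \<open>R_h\<close> for the
  \<mm>-parts, by \<open>R_m_eq\<close>.\<close>

definition R_m :: "nat \<Rightarrow> nat \<Rightarrow> nat \<Rightarrow> nat \<Rightarrow> real" where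
  "R_m i j k l = (\<Sum>m=1..n. structure_const i j m * structure_const k l m)"

lemma R_sym: "R_h i j k l = - R_h j i k l" "R_h i j k l = R_h k l i j"
  "R_m i j k l = - R_m j i k l" "R_m i j k l = R_m k l i j"
proof -
  show "R_h i j k l = - R_h j i k l"
    using lie_bracket_antisym[of "Z i" "Z j"] by (simp add: R_h_def parts_minus Q.minus_left)
  show "R_h i j k l = R_h k l i j" unfolding R_h_def by (rule Q_props(2))
  show "R_m i j k l = - R_m j i k l"
    unfolding R_m_def using structure_const_antisym(1)[of i j] by (simp add: sum_negf)
  show "R_m i j k l = R_m k l i j" by (simp add: R_m_def mult.commute)
qed

lemma R_m_eq:
  assumes "i \<in> {1..n}" "j \<in> {1..n}" "k \<in> {1..n}" "l \<in> {1..n}"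
  shows "R_m i j k l = Q (m_part M (bracket (Z i) (Z j))) (m_part M (bracket (Z k) (Z l)))"
  unfolding R_m_def
  by (subst parseval[OF parts(2)], intro sum.cong refl) (use assms in \<open>auto simp: structure_const_def\<close>)

lemma bracket_shift: "Q (Z i) (bracket (Z j) W) = Q (bracket (Z i) (Z j)) W"
  using ad_invariant[of "Z j" "Z i" W] lie_bracket_antisym[of "Z i" "Z j"] by (simp add: Q.minus_left)

text \<open>Invariance under \<open>ad\<close> moves the outer bracket onto \<open>Z i\<close>. Each
  summand of the Jacobi expression then becomes one value of \<open>R_h\<close>, and the cyclic sum
  is the Bianchi sum.\<close>

lemma Jac_h_coeff:
  assumes "i \<in> {1..n}" "j \<in> {1..n}" "k \<in> {1..n}" "l \<in> {1..n}"
  shows "Jac_h M (Z j) (Z k) (Z l) \<in> \<mm>" "Q (Z i) (Jac_h M (Z j) (Z k) (Z l)) = alt3 R_h i j k l"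
proof -
  have mem: "bracket (Z a) (h_part M A) \<in> \<mm>" if "a \<in> {1..n}" for a A
    using bracket_h_m[OF parts(1) Z(1)[OF that]] lie_bracket_antisym[of "Z a"] subspace_neg[OF reductive(4)] by metis
  then show "Jac_h M (Z j) (Z k) (Z l) \<in> \<mm>"
    unfolding Jac_h_def by (intro subspace_add reductive(4) mem assms)
  have "Q (Z i) (bracket (Z a) (h_part M A)) = Q (h_part M (bracket (Z i) (Z a))) (h_part M A)" for a A
    unfolding bracket_shift using Q_parts(1)[OF parts(1)] Q_props(2) by metis
  then show "Q (Z i) (Jac_h M (Z j) (Z k) (Z l)) = alt3 R_h i j k l"
    by (simp add: Jac_h_def Q.add_right alt3_def R_h_def)
qed

lemma Jac_m_coeff:
  assumes "i \<in> {1..n}" "j \<in> {1..n}" "k \<in> {1..n}" "l \<in> {1..n}"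
  shows "Jac_m M (Z j) (Z k) (Z l) \<in> \<mm>" "Q (Z i) (Jac_m M (Z j) (Z k) (Z l)) = alt3 R_m i j k l"
proof -
  show "Jac_m M (Z j) (Z k) (Z l) \<in> \<mm>"
    unfolding Jac_m_def by (intro subspace_add reductive(4) parts)
  have "Q (Z i) (m_part M (bracket (Z a) (m_part M A))) = Q (m_part M (bracket (Z i) (Z a))) (m_part M A)" for a A
  proof -
    have "Q (Z i) (m_part M (bracket (Z a) (m_part M A))) = Q (bracket (Z i) (Z a)) (m_part M A)"
      using Q_parts(2)[OF Z(1)[OF assms(1)]] bracket_shift by metis
    also have "\<dots> = Q (m_part M (bracket (Z i) (Z a))) (m_part M A)"
      using Q_parts(2)[OF parts(2)] Q_props(2) by metis
    finally show ?thesis .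
  qed
  then show "Q (Z i) (Jac_m M (Z j) (Z k) (Z l)) = alt3 R_m i j k l"
    using assms by (simp add: Jac_m_def Q.add_right alt3_def R_m_eq)
qed

text \<open>For \<open>n \<le> 4\<close> an index of \<open>Z\<^sub>m\<close> always repeats one of the four distinct indices \<open>i, j, k, l\<close>.\<close>

lemma alt3_R_m_small:
  assumes "n \<le> 4" "1 \<le> i" "i < j" "j < k" "k < l" "l \<le> n"
  shows "alt3 R_m i j k l = 0"
proof -
  have z: "structure_const a b c = 0" if "c = a \<or> c = b \<or> a = b" for a b c
    using that structure_const_antisym[of a b c] structure_const_antisym(1)[of a a c] structure_const_antisym(2)[of a b b]
      structure_const_antisym(1)[of a b a] structure_const_antisym(2)[of b a a] by auto
  have idx: "m = i \<or> m = j \<or> m = k \<or> m = l" if "m \<in> {1..n}" for m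
    using assms that by auto
  have "R_m i j k l = 0" "R_m i k l j = 0" "R_m i l j k = 0"
    unfolding R_m_def by (intro sum.neutral ballI; use idx z in \<open>metis mult_eq_0_iff\<close>)+
  then show ?thesis by (simp add: alt3_def)
qed

end

section \<open>The spin lift and its differential on spinor fields\<close>

locale naturally_reductive_spin = naturally_reductive_space M Q n Z
  for M :: "('g::{t2_space, second_countable_topology}, 'e::euclidean_space) homogeneous_space"
    and Q :: "'e \<Rightarrow> 'e \<Rightarrow> real" and n :: nat and Z :: "nat \<Rightarrow> 'e" +
  fixes S :: "('g, 'e, 'c::{real_algebra_1, euclidean_space}, 'd::finite) spin_structure"
  assumes spin_structure: "is_homogeneous_spin_structure M S"
begin

abbreviation e where "e i \<equiv> cliff S (Z i)"

lemma cliff: "v \<in> \<mm> \<Longrightarrow> w \<in> \<mm> \<Longrightarrow> cliff S (v + w) = cliff S v + cliff S w"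
    "v \<in> \<mm> \<Longrightarrow> cliff S (a *\<^sub>R v) = a *\<^sub>R cliff S v"
    "v \<in> \<mm> \<Longrightarrow> cliff S v * cliff S v = - (Q v v *\<^sub>R 1)"
  using spin_structure Q_props(5)
  by (auto simp: is_homogeneous_spin_structure_def is_clifford_algebra_def)

sublocale clifford_frame_euclidean n e
proof unfold_locales
  fix i j assume ij: "i \<in> {1..n}" "j \<in> {1..n}"
  then have m: "Z i \<in> \<mm>" "Z j \<in> \<mm>" "Z i + Z j \<in> \<mm>" using Z subspace_add[OF reductive(4)] by auto
  \<comment> \<open>Polarisation of the quadratic Clifford relation.\<close>
  have "cliff S (Z i + Z j) * cliff S (Z i + Z j) = (e i * e j + e j * e i) + e i * e i + e j * e j"
    by (simp add: cliff(1)[OF m(1,2)] algebra_simps)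
  then have "e i * e j + e j * e i = (Q (Z i) (Z i) + Q (Z j) (Z j) - Q (Z i + Z j) (Z i + Z j)) *\<^sub>R 1"
    unfolding cliff(3)[OF m(1)] cliff(3)[OF m(2)] cliff(3)[OF m(3)] by (simp add: algebra_simps)
  also have "Q (Z i) (Z i) + Q (Z j) (Z j) - Q (Z i + Z j) (Z i + Z j) = - 2 * kron i j"
    using ij by (simp add: Q.add_left Q.add_right Z kron_commute[of j i])
  finally show "e i * e j + e j * e i = (- 2 * kron i j) *\<^sub>R 1" .
qed simp

lemma cliff_expand:
  assumes "W \<in> \<mm>"
  shows "cliff S W = combination (\<lambda>i. Q W (Z i))"
proof -
  \<comment> \<open>Membership in \<mm> is carried through the induction because
    \<open>cliff S\<close> is additive there only.\<close>
  have "cliff S (\<Sum>i\<in>J. a i *\<^sub>R Z i) = (\<Sum>i\<in>J. a i *\<^sub>R e i) \<and> (\<Sum>i\<in>J. a i *\<^sub>R Z i) \<in> \<mm>"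
    if "finite J" "J \<subseteq> {1..n}" for a J
    using that
  proof (induction J)
    case empty
    show ?case using cliff(2)[of 0 0] subspace_0[OF reductive(4)] by simp
  next
    case (insert i J)
    then have "Z i \<in> \<mm>" using Z(1)[of i] by auto
    then show ?case
      using insert by (simp add: cliff(1,2) subspace_add subspace_scale reductive(4))
  qed
  from this[of "{1..n}" "\<lambda>i. Q W (Z i)"] expand[OF assms] show ?thesis
    unfolding combination_def by auto
qed

lemma spin_group_subset: "spin_group \<mm> (ip M) (cliff S) \<subseteq> spin"
proof -
  have "prod_list (map (cliff S) vs) \<in> spin"
    if "length vs = 2 * k" "set vs \<subseteq> {v \<in> \<mm>. ip M v v = 1}" for vs k
    using that
  proof (induction k arbitrary: vs)
    case 0
    then show ?case by (simp add: spin_one)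
  next
    case (Suc k)
    \<comment> \<open>The set \<open>spin\<close> grows by two vectors on the right, so the last two
      factors are split off.\<close>
    obtain us b where us: "vs = us @ [b]" using Suc.prems(1) by (cases vs rule: rev_cases) auto
    then obtain ws a where ws: "vs = ws @ [a, b]" using Suc.prems(1) by (cases us rule: rev_cases) auto
    have unit: "(\<Sum>i=1..n. (Q v (Z i))\<^sup>2) = 1" if "v \<in> \<mm>" "ip M v v = 1" for v
      using parseval[OF that(1), of v] Q_props(5)[OF that(1,1)] that(2) by (simp add: power2_eq_square)
    have ab: "a \<in> \<mm>" "ip M a a = 1" "b \<in> \<mm>" "ip M b b = 1" using Suc.prems(2) ws by auto
    have "prod_list (map (cliff S) ws) * combination (\<lambda>i. Q a (Z i)) * combination (\<lambda>i. Q b (Z i)) \<in> spin"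
      using Suc.IH[of ws] Suc.prems ws ab by (intro spin_mult unit) auto
    then show ?case using ab by (simp add: ws cliff_expand mult.assoc)
  qed
  then show ?thesis unfolding spin_group_def by (auto elim!: evenE)
qed

lemma spin_lift: "h \<in> isotropy M \<Longrightarrow> spin_lift S h \<in> spin"
    "h \<in> isotropy M \<Longrightarrow> k \<in> isotropy M \<Longrightarrow> spin_lift S (h \<otimes>\<^bsub>M\<^esub> k) = spin_lift S h * spin_lift S k"
    "h \<in> isotropy M \<Longrightarrow> v \<in> \<mm> \<Longrightarrow> spin_lift S h * cliff S v * spin_lift S (inv\<^bsub>M\<^esub> h) = cliff S (Ad M h v)"
    "continuous_on (isotropy M) (spin_lift S)"
  using spin_structure spin_group_subset unfolding is_homogeneous_spin_structure_def by blast+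

text \<open>The lift is assumed multiplicative, so its value at the unit is known only to be
  idempotent. An isometry that annihilates \<open>x - 1\<close> forces
  \<open>x - 1 = 0\<close>.\<close>

lemma spin_idempotent:
  assumes "x \<in> spin" "x * x = x"
  shows "x = 1"
proof -
  obtain B :: "'c \<Rightarrow> 'c \<Rightarrow> real" where B: "bilinear B" "\<And>x. x \<noteq> 0 \<Longrightarrow> B x x > 0"
    "\<And>i x y. i \<in> {1..n} \<Longrightarrow> B (e i * x) (e i * y) = B x y"
    using invariant_inner_product[of n "(\<bullet>)"]
    by (auto simp: inner_commute bilinear_conv_bounded_bilinear bounded_bilinear_inner)
  have "B (x - 1) (x - 1) = B (x * (x - 1)) (x * (x - 1))"
    using spin_isometry[OF assms(1) B(1,3)] by simp
  also have "\<dots> = 0" using assms(2) by (simp add: right_diff_distrib bilinear_lzero[OF B(1)])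
  finally have "x - 1 = 0" using B(2)[of "x - 1"] by auto
  then show ?thesis by simp
qed

lemma ad_lift_quadratic:
  assumes "V \<in> \<hh>"
  shows "ad_lift M S n Z V = (1/4) *\<^sub>R quadratic (\<lambda>i j. Q (bracket V (Z i)) (Z j))"
  unfolding ad_lift_def quadratic_def
  by (intro arg_cong[where f = "(*\<^sub>R) (1/4)"] sum.cong refl) (simp add: Q_props(5) bracket_h_m[OF assms] Z)

text \<open>The lift is only assumed to be continuous; that it is differentiable along one-parameter
  groups, with the expected derivative, is a consequence.\<close>

lemma spin_lift_derivative:
  assumes V: "V \<in> \<hh>" and c: "one_parameter_group M V c" "range c \<subseteq> isotropy M"
  shows "((\<lambda>t. spin_lift S (c t)) has_vector_derivative ad_lift M S n Z V) (at 0)"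
proof -
  define s where "s t = spin_lift S (c t)" for t
  have H: "c t \<in> isotropy M" for t using c(2) by auto
  have hom: "s (x + y) = s x * s y" for x y
    using c(1) by (simp add: s_def one_parameter_group_def spin_lift(2) H)
  have one: "s 0 = 1" using hom[of 0 0] by (intro spin_idempotent) (simp_all add: s_def spin_lift(1) H)
  have "continuous_on UNIV s"
    unfolding s_def using c by (intro continuous_on_compose2[OF spin_lift(4)]) (auto simp: one_parameter_group_def)
  from continuous_hom_has_derivative[OF this hom one]
  obtain A where A: "(s has_vector_derivative A) (at 0)" .
  have mult: "bounded_bilinear ((*) :: 'c \<Rightarrow> 'c \<Rightarrow> 'c)"
    by (auto simp: bilinear_def algebra_simps simp flip: bilinear_conv_bounded_bilinear intro!: linearI)
  have "((\<lambda>t. s (- t)) has_vector_derivative (- 1) *\<^sub>R A) (at 0)"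
    by (rule vector_diff_chain_at[of uminus "- 1" 0 s, unfolded o_def])
      (use A in \<open>auto intro!: derivative_eq_intros\<close>)
  then have neg: "((\<lambda>t. s (- t)) has_vector_derivative - A) (at 0)" by simp
  have conj: "A * e j - e j * A = cliff S (bracket V (Z j))" if j: "j \<in> {1..n}" for j
  proof -
    \<comment> \<open>The curve \<open>s t * e j * s (- t)\<close> is differentiated twice: by the
      product rule, and as the Clifford image of \<open>Ad M (c t) (Z j)\<close> in orthonormal
      coordinates.\<close>
    have "((\<lambda>t. s t * e j) has_vector_derivative s 0 * 0 + A * e j) (at 0)"
      by (rule bounded_bilinear.has_vector_derivative[OF mult A has_vector_derivative_const])
    from bounded_bilinear.has_vector_derivative[OF mult this neg]
    have 1: "((\<lambda>t. s t * e j * s (- t)) has_vector_derivative A * e j - e j * A) (at 0)"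
      by (simp add: one algebra_simps)
    have "((\<lambda>t. \<Sum>i=1..n. Q (Ad M (c t) (Z j)) (Z i) *\<^sub>R e i) has_vector_derivative
        (\<Sum>i=1..n. Q (bracket V (Z j)) (Z i) *\<^sub>R e i)) (at 0)"
      by (intro has_vector_derivative_sum
        bounded_linear.has_vector_derivative[OF bounded_linear_compose[OF bounded_linear_scaleR_left Q.bounded_linear_left]]
        Ad_velocity_curve one_parameter_group_velocity c)
    moreover have "(\<Sum>i=1..n. Q (Ad M (c t) (Z j)) (Z i) *\<^sub>R e i) = s t * e j * s (- t)" for t
      using spin_lift(3)[OF H Z(1)[OF j], of t] cliff_expand[OF reductive(7)[OF H Z(1)[OF j]], of t]
        one_parameter_group_velocity(2)[OF c(1), of t]
      by (simp add: combination_def s_def)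
    ultimately have "((\<lambda>t. s t * e j * s (- t)) has_vector_derivative (\<Sum>i=1..n. Q (bracket V (Z j)) (Z i) *\<^sub>R e i)) (at 0)"
      by simp
    from vector_derivative_unique_at[OF 1 this] show ?thesis
      using cliff_expand[OF bracket_h_m[OF V Z(1)[OF j]]] by (simp add: combination_def)
  qed
  have "A = (1/4) *\<^sub>R quadratic (\<lambda>i j. Q (bracket V (Z i)) (Z j))"
  proof (rule spin_curve_derivative[OF A one])
    show "s t \<in> spin" for t by (simp add: s_def spin_lift(1) H)
    show "Q (bracket V (Z a)) (Z b) = - Q (bracket V (Z b)) (Z a)" for a b
      using ad_invariant[of V "Z a" "Z b"] Q_props(2)[of "Z a"] by simp
    show "A * e j - e j * A = (\<Sum>p=1..n. Q (bracket V (Z j)) (Z p) *\<^sub>R e p)" if "j \<in> {1..n}" for j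
      using conj[OF that] cliff_expand[OF bracket_h_m[OF V Z(1)[OF that]]] by (simp add: combination_def)
  qed
  with A ad_lift_quadratic[OF V] show ?thesis by (simp add: s_def[abs_def])
qed

definition act :: "'c \<Rightarrow> complex^'d \<Rightarrow> complex^'d" where
  "act a w = spin_rep S a *v w"

lemma act: "act (a * b) w = act a (act b w)" "act 1 w = w" "bounded_bilinear act"
proof -
  have rep: "irreducible_complex_rep (spin_rep S)"
    using spin_structure by (simp add: is_homogeneous_spin_structure_def)
  then have lin: "linear (spin_rep S)" by (simp add: irreducible_complex_rep_def)
  show "act (a * b) w = act a (act b w)" "act 1 w = w"
    using rep by (simp_all add: act_def irreducible_complex_rep_def matrix_vector_mul_assoc)
  have "bilinear act"
    unfolding bilinear_def act_def
  proof (intro conjI allI linearI)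
    show "spin_rep S x *v (r *\<^sub>R y) = r *\<^sub>R (spin_rep S x *v y)" for x r y
      by (simp add: matrix_vector_mult_def vec_eq_iff scaleR_sum_right)
    show "spin_rep S (r *\<^sub>R x) *v y = r *\<^sub>R (spin_rep S x *v y)" for x r y
      by (simp add: linear_scale[OF lin] matrix_vector_mult_def vec_eq_iff scaleR_sum_right)
  qed (simp_all add: linear_add[OF lin] matrix_vector_mult_add_rdistrib matrix_vector_right_distrib)
  then show "bounded_bilinear act" by (simp add: bilinear_conv_bounded_bilinear)
qed

sublocale act: bounded_bilinear act by (rule act(3))

text \<open>The minus sign comes from equivariance, which involves the inverse of
  \<open>c t\<close>, that is \<open>c (- t)\<close>.\<close>

lemma lderiv_isotropy:
  assumes \<psi>: "spinor_field M S \<psi>" and V: "V \<in> \<hh>"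
  shows "lderiv M V \<psi> g = - act (ad_lift M S n Z V) (\<psi> g)"
proof -
  obtain c where c: "one_parameter_group M V c" "range c \<subseteq> isotropy M"
    using isotropy_curve[OF V] .
  have H: "c t \<in> isotropy M" for t using c(2) by auto
  have sm: "smooth_map M \<psi>" using \<psi> by (simp add: spinor_field_def)
  have 1: "((\<lambda>t. \<psi> (g \<otimes>\<^bsub>M\<^esub> c t)) has_vector_derivative lderiv M V \<psi> g) (at 0)"
    by (rule lderiv_velocity_curve[OF sm one_parameter_group_velocity(1)[OF c(1)]])
  have "((\<lambda>t. spin_lift S (c (- t))) has_vector_derivative (- 1) *\<^sub>R ad_lift M S n Z V) (at 0)"
    by (rule vector_diff_chain_at[of uminus "- 1" 0 "\<lambda>t. spin_lift S (c t)", unfolded o_def])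
      (use spin_lift_derivative[OF V c] in \<open>auto intro!: derivative_eq_intros\<close>)
  then have "((\<lambda>t. act (spin_lift S (c (- t))) (\<psi> g)) has_vector_derivative act ((- 1) *\<^sub>R ad_lift M S n Z V) (\<psi> g)) (at 0)"
    by (rule bounded_linear.has_vector_derivative[OF act.bounded_linear_left])
  moreover have "act (spin_lift S (c (- t))) (\<psi> g) = \<psi> (g \<otimes>\<^bsub>M\<^esub> c t)" for t
    using \<psi> H one_parameter_group_velocity(2)[OF c(1), of t] by (simp add: spinor_field_def act_def)
  ultimately have "((\<lambda>t. \<psi> (g \<otimes>\<^bsub>M\<^esub> c t)) has_vector_derivative - act (ad_lift M S n Z V) (\<psi> g)) (at 0)"
    by (simp add: act.minus_left)
  from vector_derivative_unique_at[OF 1 this] show ?thesis .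
qed

end

section \<open>The square of the Dirac operator\<close>

lemma sum_swap_inner4:
  "(\<Sum>a\<in>A. \<Sum>i\<in>I. \<Sum>j\<in>J. \<Sum>k\<in>K. \<Sum>l\<in>L. f a i j k l) =
   (\<Sum>i\<in>I. \<Sum>j\<in>J. \<Sum>k\<in>K. \<Sum>l\<in>L. \<Sum>a\<in>A. f a i j k l :: 'a::comm_monoid_add)"
proof -
  have "(\<Sum>a\<in>A. \<Sum>i\<in>I. \<Sum>j\<in>J. \<Sum>k\<in>K. \<Sum>l\<in>L. f a i j k l)
    = (\<Sum>i\<in>I. \<Sum>a\<in>A. \<Sum>j\<in>J. \<Sum>k\<in>K. \<Sum>l\<in>L. f a i j k l)"
    by (rule sum.swap)
  also have "\<dots> = (\<Sum>i\<in>I. \<Sum>j\<in>J. \<Sum>a\<in>A. \<Sum>k\<in>K. \<Sum>l\<in>L. f a i j k l)"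
    by (rule sum.cong[OF refl], rule sum.swap)
  also have "\<dots> = (\<Sum>i\<in>I. \<Sum>j\<in>J. \<Sum>k\<in>K. \<Sum>a\<in>A. \<Sum>l\<in>L. f a i j k l)"
    by (rule sum.cong[OF refl], rule sum.cong[OF refl], rule sum.swap)
  also have "\<dots> = (\<Sum>i\<in>I. \<Sum>j\<in>J. \<Sum>k\<in>K. \<Sum>l\<in>L. \<Sum>a\<in>A. f a i j k l)"
    by (rule sum.cong[OF refl], rule sum.cong[OF refl], rule sum.cong[OF refl], rule sum.swap)
  finally show ?thesis .
qed

context clifford_frame begin

definition quartic :: "(nat \<Rightarrow> nat \<Rightarrow> nat \<Rightarrow> nat \<Rightarrow> real) \<Rightarrow> 'c" where
  "quartic R = (\<Sum>i\<in>I. \<Sum>j\<in>I. \<Sum>k\<in>I. \<Sum>l\<in>I. R i j k l *\<^sub>R (e i * e j * e k * e l))"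

lemma quadratic_mult: "quadratic y * quadratic y' = quartic (\<lambda>i j k l. y i j * y' k l)"
  unfolding quartic_def quadratic_def sum_distrib_right unfolding sum_distrib_left
  by (intro sum.cong refl) (simp add: mult.assoc)

lemma sum_quadratic: "(\<Sum>i\<in>I. \<Sum>j\<in>I. e i * e j * quadratic (R i j)) = quartic R"
  unfolding quartic_def quadratic_def sum_distrib_left
  by (intro sum.cong refl) (simp add: mult.assoc)

end

context clifford_frame_euclidean begin

definition ordered_quartic :: "(nat \<Rightarrow> nat \<Rightarrow> nat \<Rightarrow> nat \<Rightarrow> real) \<Rightarrow> 'c" where
  "ordered_quartic R = (\<Sum>i=1..n. \<Sum>j=i+1..n. \<Sum>k=j+1..n. \<Sum>l=k+1..n. alt3 R i j k l *\<^sub>R (e i * e j * e k * e l))"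

lemma quartic_ordered:
  assumes "\<And>i j k l. R i j k l = - R j i k l" "\<And>i j k l. R i j k l = R k l i j"
  shows "quartic R = 8 *\<^sub>R ordered_quartic R - (2 * (\<Sum>i=1..n. \<Sum>j=1..n. R i j i j)) *\<^sub>R 1"
  unfolding quartic_def ordered_quartic_def curvature_contraction[OF assms] sum_wick_ordered[OF assms refl] ..

end

context naturally_reductive_spin begin

declare One_nat_def [simp del]

text \<open>In this form \<open>V\<close> occurs only through \<open>Q V\<close>, so dual bases can
  be summed out in the Casimir element, and inserting the \<hh>-part of a bracket produces
  \<open>R_h\<close>.\<close>

lemma ad_lift_isotropy:
  assumes "V \<in> \<hh>"
  shows "ad_lift M S n Z V = (1/4) *\<^sub>R quadratic (\<lambda>i j. Q V (h_part M (bracket (Z i) (Z j))))"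
proof -
  have "Q (bracket V (Z i)) (Z j) = Q V (h_part M (bracket (Z i) (Z j)))" for i j
    using ad_invariant[of "Z i" V "Z j"] lie_bracket_antisym[of V "Z i"] Q_parts(1)[OF assms, of "bracket (Z i) (Z j)"]
    by (simp add: Q.minus_left)
  then show ?thesis by (simp only: ad_lift_quadratic[OF assms])
qed

lemma casimir_lift_quartic:
  assumes dual: "dual_bases_h M Q r X Y"
  shows "casimir_lift M S n Z r X Y = (- 1/16) *\<^sub>R quartic R_h"
proof -
  have X: "X a \<in> \<hh>" and Y: "Y a \<in> \<hh>" if "a \<in> {1..r}" for a
    using dual that span_base[of "X a" "X ` {1..r}"] span_base[of "Y a" "Y ` {1..r}"] by (auto simp: dual_bases_h_def)
  \<comment> \<open>The completeness relation of dual bases: both sides are linear in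
    \<open>V\<close>, and for \<open>V\<close> in the basis \<open>Y\<close> the duality relation
    selects one summand.\<close>
  have expand: "(\<Sum>a=1..r. Q (X a) V * Q (Y a) W) = Q V W" if "V \<in> \<hh>" for V W
  proof -
    have lin: "linear (\<lambda>V. \<Sum>a=1..r. Q (X a) V * Q (Y a) W)" "linear (\<lambda>V. Q V W)"
      by (rule linearI; simp add: Q.add_left Q.scaleR_left Q.add_right Q.scaleR_right distrib_right sum.distrib
        sum_distrib_left mult.assoc)+
    have basis: "(\<Sum>a=1..r. Q (X a) V' * Q (Y a) W) = Q V' W" if "V' \<in> Y ` {1..r}" for V'
    proof -
      obtain b where b: "b \<in> {1..r}" "V' = Y b" using \<open>V' \<in> Y ` {1..r}\<close> by blast
      have "(\<Sum>a=1..r. Q (X a) (Y b) * Q (Y a) W) = (\<Sum>a=1..r. if a = b then Q (Y a) W else 0)"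
        by (intro sum.cong refl) (use dual b in \<open>simp add: dual_bases_h_def\<close>)
      then show ?thesis using b by simp
    qed
    have "V \<in> span (Y ` {1..r})" using that dual by (simp add: dual_bases_h_def)
    from linear_eq_on_span[OF lin basis this] show ?thesis .
  qed
  have "casimir_lift M S n Z r X Y = - (\<Sum>a=1..r. (1/16) *\<^sub>R quartic
      (\<lambda>i j k l. Q (X a) (h_part M (bracket (Z i) (Z j))) * Q (Y a) (h_part M (bracket (Z k) (Z l)))))"
    unfolding casimir_lift_def
    by (intro arg_cong[where f = uminus] sum.cong refl) (simp add: ad_lift_isotropy X Y quadratic_mult)
  also have "\<dots> = (- 1/16) *\<^sub>R (\<Sum>a=1..r. quartic
      (\<lambda>i j k l. Q (X a) (h_part M (bracket (Z i) (Z j))) * Q (Y a) (h_part M (bracket (Z k) (Z l)))))"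
    by (simp add: scaleR_sum_right sum_negf)
  also have "(\<Sum>a=1..r. quartic
      (\<lambda>i j k l. Q (X a) (h_part M (bracket (Z i) (Z j))) * Q (Y a) (h_part M (bracket (Z k) (Z l))))) = quartic R_h"
    unfolding quartic_def sum_swap_inner4 scaleR_sum_left[symmetric] expand[OF parts(1)] R_h_def ..
  finally show ?thesis .
qed

lemma cubic_element_eq:
  "cubic_element M S n Z = (1/4) *\<^sub>R (\<Sum>k=1..n. quadratic (\<lambda>a b. structure_const a b k) * e k)"
proof -
  have "(\<Sum>k=1..n. quadratic (\<lambda>a b. structure_const a b k) * e k)
      = (\<Sum>k=1..n. \<Sum>a=1..n. \<Sum>b=1..n. structure_const a b k *\<^sub>R (e a * e b * e k))"
    by (simp add: quadratic_def sum_distrib_right)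
  also have "\<dots> = (\<Sum>a=1..n. \<Sum>b=1..n. \<Sum>k=1..n. structure_const a b k *\<^sub>R (e a * e b * e k))"
    by (rule sum_rotate)
  also have "\<dots> = (\<Sum>a=1..n. \<Sum>b=1..n. \<Sum>k=1..n. ip M (m_part M (bracket (Z a) (Z b))) (Z k) *\<^sub>R (e a * e b * e k))"
    by (intro sum.cong refl) (simp add: structure_const_def Q_props(5) parts Z)
  finally show ?thesis by (simp only: cubic_element_def)
qed

text \<open>One sixteenth of \<open>cubic_square\<close>, because of the \<open>1/4\<close> in the
  cubic element: \<open>9/16\<close> and \<open>12/16 = 3/4\<close>.\<close>

lemma cubic_element_square:
  "cubic_element M S n Z * cubic_element M S n Z
    = (- 9/16) *\<^sub>R quartic R_m - (3/4 * (\<Sum>i=1..n. \<Sum>j=1..n. R_m i j i j)) *\<^sub>R 1"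
  using cubic_square(2,3)[of structure_const, OF structure_const_antisym]
  unfolding cubic_element_eq quartic_def R_m_def by (simp add: scaleR_diff_right)

lemma cubic_element_anticommutator:
  "q \<in> {1..n} \<Longrightarrow> e q * cubic_element M S n Z + cubic_element M S n Z * e q
    = (- 3/2) *\<^sub>R quadratic (\<lambda>a b. structure_const a b q)"
  using cubic_anticommutator[of structure_const, OF structure_const_antisym, of q]
  unfolding cubic_element_eq by (simp flip: scaleR_add_right)

definition mixed_term :: "(nat \<Rightarrow> complex^'d) \<Rightarrow> complex^'d" where
  "mixed_term V = (\<Sum>i=1..n. \<Sum>j=1..n. \<Sum>k=1..n. structure_const i j k *\<^sub>R act (e i * e j) (V k))"

text \<open>\<open>P i j\<close> stands for a second derivative. Exchanging the indices and then the
  generators gives twice the double sum as its commutator part minus twice the diagonal; half of the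
  assumed commutator yields \<open>1/2\<close> and \<open>1/8\<close>.\<close>

lemma first_order_square:
  assumes P: "\<And>i j. i \<in> {1..n} \<Longrightarrow> j \<in> {1..n} \<Longrightarrow>
    P i j - P j i = (\<Sum>k=1..n. structure_const i j k *\<^sub>R V k) - (1/4) *\<^sub>R act (quadratic (R_h i j)) u"
  shows "(\<Sum>i=1..n. act (e i) (\<Sum>j=1..n. act (e j) (P i j)))
    = - (\<Sum>i=1..n. P i i) + (1/2) *\<^sub>R mixed_term V - (1/8) *\<^sub>R act (quartic R_h) u"
proof -
  let ?A = "\<Sum>i=1..n. \<Sum>j=1..n. act (e i * e j) (P i j)"
  have "?A = (\<Sum>i=1..n. \<Sum>j=1..n. act (e j * e i) (P j i))" by (rule sum.swap)
  also have "\<dots> = (\<Sum>i=1..n. \<Sum>j=1..n. - act (e i * e j) (P j i) - kron i j *\<^sub>R 2 *\<^sub>R P j i)"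
  proof (intro sum.cong refl)
    fix i j assume "i \<in> {1..n}" "j \<in> {1..n}"
    then show "act (e j * e i) (P j i) = - act (e i * e j) (P j i) - kron i j *\<^sub>R 2 *\<^sub>R P j i"
      by (subst swap) (simp_all add: act.diff_left act.minus_left act.scaleR_left act(2) mult.commute)
  qed
  also have "\<dots> = - (\<Sum>i=1..n. \<Sum>j=1..n. act (e i * e j) (P j i)) - (\<Sum>i=1..n. \<Sum>j=1..n. kron i j *\<^sub>R 2 *\<^sub>R P j i)"
    by (simp only: sum_subtractf sum_negf)
  also have "(\<Sum>i=1..n. \<Sum>j=1..n. kron i j *\<^sub>R 2 *\<^sub>R P j i) = (\<Sum>i=1..n. 2 *\<^sub>R P i i)"
    by (intro sum.cong refl sum_kron)
  finally have "2 *\<^sub>R ?A = (?A - (\<Sum>i=1..n. \<Sum>j=1..n. act (e i * e j) (P j i))) - 2 *\<^sub>R (\<Sum>i=1..n. P i i)"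
    by (simp add: scaleR_2 scaleR_sum_right)
  also have "?A - (\<Sum>i=1..n. \<Sum>j=1..n. act (e i * e j) (P j i))
      = (\<Sum>i=1..n. \<Sum>j=1..n. act (e i * e j) (P i j - P j i))"
    by (simp add: sum_subtractf act.diff_right)
  also have "\<dots> = (\<Sum>i=1..n. \<Sum>j=1..n. (\<Sum>k=1..n. structure_const i j k *\<^sub>R act (e i * e j) (V k))
      - (1/4) *\<^sub>R act (e i * e j * quadratic (R_h i j)) u)"
    by (intro sum.cong refl) (simp only: P act.diff_right act.sum_right act.scaleR_right act(1)[of "_ * _"])
  also have "\<dots> = mixed_term V - (1/4) *\<^sub>R act (quartic R_h) u"
    unfolding sum_quadratic[symmetric] mixed_term_def act.sum_left scaleR_sum_right sum_subtractf ..
  finally have "2 *\<^sub>R ?A = 2 *\<^sub>R (- (\<Sum>i=1..n. P i i) + (1/2) *\<^sub>R mixed_term V - (1/8) *\<^sub>R act (quartic R_h) u)"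
    by (simp add: algebra_simps)
  then have "?A = - (\<Sum>i=1..n. P i i) + (1/2) *\<^sub>R mixed_term V - (1/8) *\<^sub>R act (quartic R_h) u"
    by (simp only: scaleR_cancel_left) simp
  then show ?thesis by (simp only: act.sum_right act(1))
qed

text \<open>Smoothness of the field \<open>dirac M S n Z t \<psi>\<close> is not established. Its
  derivative along a unit curve is computed term by term, from the differentiability of \<psi> and
  of its left-invariant derivatives.\<close>

lemma lderiv_dirac:
  assumes \<psi>: "smooth_map M \<psi>"
  shows "lderiv M W (dirac M S n Z t \<psi>) g
    = (\<Sum>i=1..n. act (e i) (lderiv M W (lderiv M (Z i) \<psi>) g)) + t *\<^sub>R act (cubic_element M S n Z) (lderiv M W \<psi> g)"
proof -
  have "((\<lambda>s. (\<Sum>i=1..n. act (e i) (lderiv M (Z i) \<psi> (g \<otimes>\<^bsub>M\<^esub> unit_curve M W s)))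
      + t *\<^sub>R act (cubic_element M S n Z) (\<psi> (g \<otimes>\<^bsub>M\<^esub> unit_curve M W s))) has_vector_derivative
    (\<Sum>i=1..n. act (e i) (lderiv M W (lderiv M (Z i) \<psi>) g)) + t *\<^sub>R act (cubic_element M S n Z) (lderiv M W \<psi> g)) (at 0)"
    by (intro has_vector_derivative_add has_vector_derivative_sum
        bounded_linear.has_vector_derivative[OF act.bounded_linear_right]
        bounded_linear.has_vector_derivative[OF bounded_linear_scaleR_right]
        lderiv_has_derivative \<psi> lderiv_velocity_curve unit_curve_velocity)
  then show ?thesis
    unfolding lderiv_def[of M W "dirac M S n Z t \<psi>"] by (simp add: dirac_def act_def vector_derivative_at)
qed

lemma commutator_spinor:
  assumes \<psi>: "spinor_field M S \<psi>" and ij: "i \<in> {1..n}" "j \<in> {1..n}"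
  shows "lderiv M (Z i) (lderiv M (Z j) \<psi>) g - lderiv M (Z j) (lderiv M (Z i) \<psi>) g
    = (\<Sum>k=1..n. structure_const i j k *\<^sub>R lderiv M (Z k) \<psi> g) - (1/4) *\<^sub>R act (quadratic (R_h i j)) (\<psi> g)"
proof -
  have sm: "smooth_map M \<psi>" using \<psi> by (simp add: spinor_field_def)
  note lin = linear_lderiv[OF sm, of g]
  let ?A = "bracket (Z i) (Z j)"
  have "lderiv M (m_part M ?A) \<psi> g = lderiv M (\<Sum>k=1..n. Q (m_part M ?A) (Z k) *\<^sub>R Z k) \<psi> g"
    using expand[OF parts(2), of ?A] by simp
  also have "\<dots> = (\<Sum>k=1..n. Q (m_part M ?A) (Z k) *\<^sub>R lderiv M (Z k) \<psi> g)"
    by (simp only: linear_sum[OF lin, unfolded o_def] linear_scale[OF lin])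
  also have "\<dots> = (\<Sum>k=1..n. structure_const i j k *\<^sub>R lderiv M (Z k) \<psi> g)"
    by (intro sum.cong refl) (use ij in \<open>simp add: structure_const_def\<close>)
  finally have m: "lderiv M (m_part M ?A) \<psi> g = (\<Sum>k=1..n. structure_const i j k *\<^sub>R lderiv M (Z k) \<psi> g)" .
  have "lderiv M (h_part M ?A) \<psi> g = - (1/4) *\<^sub>R act (quadratic (R_h i j)) (\<psi> g)"
    unfolding lderiv_isotropy[OF \<psi> parts(1)] ad_lift_isotropy[OF parts(1)] act.scaleR_left
    by (simp add: R_h_def[abs_def])
  then show ?thesis
    using lderiv_commutator[OF sm, of "Z i" "Z j" g] linear_add[OF lin, of "h_part M ?A" "m_part M ?A"] m parts(3)[of ?A]
    by simp
qed

theorem dirac_square: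
  assumes \<psi>: "spinor_field M S \<psi>" and dual: "dual_bases_h M Q r X Y"
  shows "dirac M S n Z t (dirac M S n Z t \<psi>) g = casimir M S n Z r X Y \<psi> g
     + (1/2 * (1 - 3 * t)) *\<^sub>R mixed_term (\<lambda>k. lderiv M (Z k) \<psi> g)
     - (1/2) *\<^sub>R act (ordered_quartic R_h + (9 * t\<^sup>2) *\<^sub>R ordered_quartic R_m) (\<psi> g)
     + (1/8 * (\<Sum>i=1..n. \<Sum>j=1..n. R_h i j i j)) *\<^sub>R \<psi> g
     + (3/8 * t\<^sup>2 * (\<Sum>i=1..n. \<Sum>j=1..n. R_m i j i j)) *\<^sub>R \<psi> g"
proof -
  have sm: "smooth_map M \<psi>" using \<psi> by (simp add: spinor_field_def)
  define u where "u = \<psi> g"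
  define V where "V = (\<lambda>k. lderiv M (Z k) \<psi> g)"
  define P where "P = (\<lambda>i j. lderiv M (Z i) (lderiv M (Z j) \<psi>) g)"
  define H where "H = cubic_element M S n Z"
  define \<rho>\<^sub>h where "\<rho>\<^sub>h = (\<Sum>i=1..n. \<Sum>j=1..n. R_h i j i j)"
  define \<rho>\<^sub>m where "\<rho>\<^sub>m = (\<Sum>i=1..n. \<Sum>j=1..n. R_m i j i j)"
  have "(\<Sum>i=1..n. act (e i * H + H * e i) (V i)) = (- 3/2) *\<^sub>R (\<Sum>k=1..n. act (quadratic (\<lambda>a b. structure_const a b k)) (V k))"
    unfolding H_def scaleR_sum_right
    by (intro sum.cong refl) (simp only: cubic_element_anticommutator act.scaleR_left)
  also have "(\<Sum>k=1..n. act (quadratic (\<lambda>a b. structure_const a b k)) (V k))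
      = (\<Sum>k=1..n. \<Sum>a=1..n. \<Sum>b=1..n. structure_const a b k *\<^sub>R act (e a * e b) (V k))"
    by (simp only: quadratic_def act.sum_left act.scaleR_left)
  also have "\<dots> = mixed_term V" unfolding mixed_term_def by (rule sum_rotate)
  finally have cross: "(\<Sum>i=1..n. act (e i * H + H * e i) (V i)) = (- 3/2) *\<^sub>R mixed_term V" .
  have "dirac M S n Z t (dirac M S n Z t \<psi>) g
      = (\<Sum>i=1..n. act (e i) ((\<Sum>j=1..n. act (e j) (P i j)) + t *\<^sub>R act H (V i)))
        + t *\<^sub>R act H ((\<Sum>i=1..n. act (e i) (V i)) + t *\<^sub>R act H u)"
    unfolding dirac_def[of M S n Z t "dirac M S n Z t \<psi>"] lderiv_dirac[OF sm] 
    unfolding dirac_def act_def[symmetric] P_def V_def H_def u_def ..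
  also have "\<dots> = (\<Sum>i=1..n. act (e i) (\<Sum>j=1..n. act (e j) (P i j)))
      + t *\<^sub>R (\<Sum>i=1..n. act (e i * H + H * e i) (V i)) + t\<^sup>2 *\<^sub>R act (H * H) u"
    by (simp add: act.add_right act.scaleR_right act.add_left act(1) sum.distrib act.sum_right scaleR_add_right
      scaleR_sum_right power2_eq_square)
  also have "(\<Sum>i=1..n. act (e i) (\<Sum>j=1..n. act (e j) (P i j)))
      = - (\<Sum>i=1..n. P i i) + (1/2) *\<^sub>R mixed_term V - (1/8) *\<^sub>R act (quartic R_h) u"
    by (rule first_order_square) (simp only: P_def V_def u_def commutator_spinor[OF \<psi>])
  finally have square: "dirac M S n Z t (dirac M S n Z t \<psi>) g
      = - (\<Sum>i=1..n. P i i) + (1/2) *\<^sub>R mixed_term V - (1/8) *\<^sub>R act (quartic R_h) u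
        + t *\<^sub>R (- 3/2) *\<^sub>R mixed_term V + t\<^sup>2 *\<^sub>R act (H * H) u"
    unfolding cross .
  have casimir: "casimir M S n Z r X Y \<psi> g = - (\<Sum>i=1..n. P i i) - (1/16) *\<^sub>R act (quartic R_h) u"
    unfolding casimir_def casimir_lift_quartic[OF dual] act_def[symmetric] P_def u_def by (simp add: act.scaleR_left act.minus_left)
  have quartic: "act (quartic R_h) u = 8 *\<^sub>R act (ordered_quartic R_h) u - (2 * \<rho>\<^sub>h) *\<^sub>R u"
    unfolding quartic_ordered[OF R_sym(1,2)] \<rho>\<^sub>h_def act.diff_left act.scaleR_left act(2) ..
  have HH: "act (H * H) u = (- 9/2) *\<^sub>R act (ordered_quartic R_m) u + (3/8 * \<rho>\<^sub>m) *\<^sub>R u"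
  proof -
    have "act (H * H) u = (- 9/16) *\<^sub>R (8 *\<^sub>R act (ordered_quartic R_m) u - (2 * \<rho>\<^sub>m) *\<^sub>R u) - (3/4 * \<rho>\<^sub>m) *\<^sub>R u"
      unfolding H_def cubic_element_square quartic_ordered[OF R_sym(3,4)] \<rho>\<^sub>m_def act.diff_left act.scaleR_left act(2) ..
    also have "\<dots> = (- 9/2) *\<^sub>R act (ordered_quartic R_m) u + (9/8 * \<rho>\<^sub>m - 3/4 * \<rho>\<^sub>m) *\<^sub>R u"
      unfolding scaleR_diff_right scaleR_diff_left by simp
    finally show ?thesis by simp
  qed
  \<comment> \<open>The remaining identity is linear in the vectors; taking components reduces it to
    real arithmetic.\<close>
  have "- p + (1/2) *\<^sub>R v - (1/8) *\<^sub>R (8 *\<^sub>R x - (2 * \<rho>\<^sub>h) *\<^sub>R u)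
        + t *\<^sub>R (- 3/2) *\<^sub>R v + t\<^sup>2 *\<^sub>R ((- 9/2) *\<^sub>R y + (3/8 * \<rho>\<^sub>m) *\<^sub>R u)
      = - p - (1/16) *\<^sub>R (8 *\<^sub>R x - (2 * \<rho>\<^sub>h) *\<^sub>R u) + (1/2 * (1 - 3 * t)) *\<^sub>R v
        - (1/2) *\<^sub>R (x + (9 * t\<^sup>2) *\<^sub>R y) + (1/8 * \<rho>\<^sub>h) *\<^sub>R u + (3/8 * t\<^sup>2 * \<rho>\<^sub>m) *\<^sub>R u"
    for p v x y u :: "complex^'d"
    by (rule euclidean_eqI) (simp only: inner_add_left inner_diff_left inner_minus_left inner_scaleR_left, simp add: field_simps)
  then show ?thesis
    unfolding u_def[symmetric] V_def[symmetric] \<rho>\<^sub>h_def[symmetric] \<rho>\<^sub>m_def[symmetric]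
      act.add_left act.scaleR_left square casimir quartic HH by this
qed

end

theorem theorem3p2:
  fixes M :: "('g::{t2_space, second_countable_topology}, 'e::euclidean_space) homogeneous_space"
    and S :: "('g, 'e, 'c::{real_algebra_1, euclidean_space}, 'd::finite) spin_structure"
    and Q :: "'e \<Rightarrow> 'e \<Rightarrow> real"
    and n r :: nat
    and Z X Y :: "nat \<Rightarrow> 'e"
    and t :: real
    and \<psi> :: "'g \<Rightarrow> complex^'d"
  assumes "naturally_reductive M"
    and "generated_by_complement M"
    and "invariant_extension M Q"
    and "is_homogeneous_spin_structure M S"
    and "orthonormal_basis M n Z"
    and "dual_bases_h M Q r X Y"
    and "spinor_field M S \<psi>"
  shows "(n \<ge> 5 \<longrightarrow> (\<forall>g. dirac M S n Z t (dirac M S n Z t \<psi>) g =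
        casimir M S n Z r X Y \<psi> g
      + (1/2 * (1 - 3 * t)) *\<^sub>R (\<Sum>i=1..n. \<Sum>j=1..n. \<Sum>k=1..n.
          ip M (m_part M (lie_bracket M (Z i) (Z j))) (Z k) *\<^sub>R
            (spin_rep S (cliff S (Z i) * cliff S (Z j)) *v lderiv M (Z k) \<psi> g))
      - (1/2) *\<^sub>R (\<Sum>i=1..n. \<Sum>j=i+1..n. \<Sum>k=j+1..n. \<Sum>l=k+1..n.
          ip M (Z i) (Jac_h M (Z j) (Z k) (Z l) + (9 * t\<^sup>2) *\<^sub>R Jac_m M (Z j) (Z k) (Z l)) *\<^sub>R
            (spin_rep S (cliff S (Z i) * cliff S (Z j) * cliff S (Z k) * cliff S (Z l)) *v \<psi> g))
      + (1/8 * (\<Sum>i=1..n. \<Sum>j=1..n.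
          Q_h M Q (lie_bracket M (Z i) (Z j)) (lie_bracket M (Z i) (Z j)))) *\<^sub>R \<psi> g
      + (3/8 * t\<^sup>2 * (\<Sum>i=1..n. \<Sum>j=1..n.
          Q_m M (lie_bracket M (Z i) (Z j)) (lie_bracket M (Z i) (Z j)))) *\<^sub>R \<psi> g))
    \<and> (n \<le> 4 \<longrightarrow> (\<forall>g. dirac M S n Z t (dirac M S n Z t \<psi>) g =
        casimir M S n Z r X Y \<psi> g
      + (1/2 * (1 - 3 * t)) *\<^sub>R (\<Sum>i=1..n. \<Sum>j=1..n. \<Sum>k=1..n.
          ip M (m_part M (lie_bracket M (Z i) (Z j))) (Z k) *\<^sub>R
            (spin_rep S (cliff S (Z i) * cliff S (Z j)) *v lderiv M (Z k) \<psi> g))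
      - (1/2) *\<^sub>R (\<Sum>i=1..n. \<Sum>j=i+1..n. \<Sum>k=j+1..n. \<Sum>l=k+1..n.
          ip M (Z i) (Jac_h M (Z j) (Z k) (Z l)) *\<^sub>R
            (spin_rep S (cliff S (Z i) * cliff S (Z j) * cliff S (Z k) * cliff S (Z l)) *v \<psi> g))
      + (1/8 * (\<Sum>i=1..n. \<Sum>j=1..n.
          Q_h M Q (lie_bracket M (Z i) (Z j)) (lie_bracket M (Z i) (Z j)))) *\<^sub>R \<psi> g
      + (3/8 * t\<^sup>2 * (\<Sum>i=1..n. \<Sum>j=1..n.
          Q_m M (lie_bracket M (Z i) (Z j)) (lie_bracket M (Z i) (Z j)))) *\<^sub>R \<psi> g))"
proof -
  interpret naturally_reductive_spin M Q n Z S
    using assms by unfold_locales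
  have mixed: "mixed_term (\<lambda>k. lderiv M (Z k) \<psi> g) = (\<Sum>i=1..n. \<Sum>j=1..n. \<Sum>k=1..n.
          ip M (m_part M (lie_bracket M (Z i) (Z j))) (Z k) *\<^sub>R
            (spin_rep S (cliff S (Z i) * cliff S (Z j)) *v lderiv M (Z k) \<psi> g))" for g
    unfolding mixed_term_def act_def
    by (intro sum.cong refl) (simp add: structure_const_def Q_props(5) parts Z)
  \<comment> \<open>The coefficient is left as \<open>a\<close> so that the formula serves with
    \<open>9 * t\<^sup>2\<close> and, when the quartic element of \<open>R_m\<close> vanishes, with
    \<open>0\<close>.\<close>
  have ordered: "act (ordered_quartic R_h + a *\<^sub>R ordered_quartic R_m) (\<psi> g) =
      (\<Sum>i=1..n. \<Sum>j=i+1..n. \<Sum>k=j+1..n. \<Sum>l=k+1..n.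
          ip M (Z i) (Jac_h M (Z j) (Z k) (Z l) + a *\<^sub>R Jac_m M (Z j) (Z k) (Z l)) *\<^sub>R
            (spin_rep S (cliff S (Z i) * cliff S (Z j) * cliff S (Z k) * cliff S (Z l)) *v \<psi> g))" for a g
  proof -
    have "act (ordered_quartic R_h + a *\<^sub>R ordered_quartic R_m) (\<psi> g) =
      (\<Sum>i=1..n. \<Sum>j=i+1..n. \<Sum>k=j+1..n. \<Sum>l=k+1..n.
          (alt3 R_h i j k l + a * alt3 R_m i j k l) *\<^sub>R act (e i * e j * e k * e l) (\<psi> g))"
      unfolding ordered_quartic_def scaleR_sum_right sum.distrib[symmetric] act.sum_left
      by (intro sum.cong refl) (simp only: scaleR_scaleR scaleR_add_left[symmetric] act.scaleR_left)
    also have "\<dots> = (\<Sum>i=1..n. \<Sum>j=i+1..n. \<Sum>k=j+1..n. \<Sum>l=k+1..n.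
          ip M (Z i) (Jac_h M (Z j) (Z k) (Z l) + a *\<^sub>R Jac_m M (Z j) (Z k) (Z l)) *\<^sub>R act (e i * e j * e k * e l) (\<psi> g))"
    proof (intro sum.cong refl)
      fix i j k l assume "i \<in> {1..n}" "j \<in> {i+1..n}" "k \<in> {j+1..n}" "l \<in> {k+1..n}"
      then have idx: "i \<in> {1..n}" "j \<in> {1..n}" "k \<in> {1..n}" "l \<in> {1..n}" by auto
      have "ip M (Z i) (Jac_h M (Z j) (Z k) (Z l) + a *\<^sub>R Jac_m M (Z j) (Z k) (Z l))
          = Q (Z i) (Jac_h M (Z j) (Z k) (Z l) + a *\<^sub>R Jac_m M (Z j) (Z k) (Z l))"
        by (intro Q_props(5) Z(1) subspace_add subspace_scale reductive(4) Jac_h_coeff(1)[OF idx] Jac_m_coeff(1)[OF idx] idx)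
      then show "(alt3 R_h i j k l + a * alt3 R_m i j k l) *\<^sub>R act (e i * e j * e k * e l) (\<psi> g) =
          ip M (Z i) (Jac_h M (Z j) (Z k) (Z l) + a *\<^sub>R Jac_m M (Z j) (Z k) (Z l)) *\<^sub>R act (e i * e j * e k * e l) (\<psi> g)"
        by (simp only: Q.add_right Q.scaleR_right Jac_h_coeff(2)[OF idx] Jac_m_coeff(2)[OF idx] real_scaleR_def)
    qed
    finally show ?thesis unfolding act_def .
  qed
  have h: "(\<Sum>i=1..n. \<Sum>j=1..n. R_h i j i j) =
      (\<Sum>i=1..n. \<Sum>j=1..n. Q_h M Q (lie_bracket M (Z i) (Z j)) (lie_bracket M (Z i) (Z j)))"
    unfolding R_h_def Q_h_def ..
  have m: "(\<Sum>i=1..n. \<Sum>j=1..n. R_m i j i j) =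
      (\<Sum>i=1..n. \<Sum>j=1..n. Q_m M (lie_bracket M (Z i) (Z j)) (lie_bracket M (Z i) (Z j)))"
    by (intro sum.cong refl) (simp add: R_m_eq Q_m_def Q_props(5) parts)
  note square = dirac_square[OF assms(7,6), of t, unfolded mixed h m]
  have small: "ordered_quartic R_m = 0" if "n \<le> 4"
    unfolding ordered_quartic_def
  proof (intro sum.neutral ballI)
    fix i j k l assume "i \<in> {1..n}" "j \<in> {i+1..n}" "k \<in> {j+1..n}" "l \<in> {k+1..n}"
    then have "alt3 R_m i j k l = 0" using that by (intro alt3_R_m_small) auto
    then show "alt3 R_m i j k l *\<^sub>R (e i * e j * e k * e l) = 0" by simp
  qed
  show ?thesis
  proof (intro conjI impI allI)
    fix g
    show "dirac M S n Z t (dirac M S n Z t \<psi>) g = casimir M S n Z r X Y \<psi> g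
      + (1/2 * (1 - 3 * t)) *\<^sub>R (\<Sum>i=1..n. \<Sum>j=1..n. \<Sum>k=1..n.
          ip M (m_part M (lie_bracket M (Z i) (Z j))) (Z k) *\<^sub>R
            (spin_rep S (cliff S (Z i) * cliff S (Z j)) *v lderiv M (Z k) \<psi> g))
      - (1/2) *\<^sub>R (\<Sum>i=1..n. \<Sum>j=i+1..n. \<Sum>k=j+1..n. \<Sum>l=k+1..n.
          ip M (Z i) (Jac_h M (Z j) (Z k) (Z l) + (9 * t\<^sup>2) *\<^sub>R Jac_m M (Z j) (Z k) (Z l)) *\<^sub>R
            (spin_rep S (cliff S (Z i) * cliff S (Z j) * cliff S (Z k) * cliff S (Z l)) *v \<psi> g))
      + (1/8 * (\<Sum>i=1..n. \<Sum>j=1..n.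
          Q_h M Q (lie_bracket M (Z i) (Z j)) (lie_bracket M (Z i) (Z j)))) *\<^sub>R \<psi> g
      + (3/8 * t\<^sup>2 * (\<Sum>i=1..n. \<Sum>j=1..n.
          Q_m M (lie_bracket M (Z i) (Z j)) (lie_bracket M (Z i) (Z j)))) *\<^sub>R \<psi> g"
      by (rule square[unfolded ordered])
  next
    fix g assume "n \<le> 4"
    then show "dirac M S n Z t (dirac M S n Z t \<psi>) g = casimir M S n Z r X Y \<psi> g
      + (1/2 * (1 - 3 * t)) *\<^sub>R (\<Sum>i=1..n. \<Sum>j=1..n. \<Sum>k=1..n.
          ip M (m_part M (lie_bracket M (Z i) (Z j))) (Z k) *\<^sub>R
            (spin_rep S (cliff S (Z i) * cliff S (Z j)) *v lderiv M (Z k) \<psi> g))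
      - (1/2) *\<^sub>R (\<Sum>i=1..n. \<Sum>j=i+1..n. \<Sum>k=j+1..n. \<Sum>l=k+1..n.
          ip M (Z i) (Jac_h M (Z j) (Z k) (Z l)) *\<^sub>R
            (spin_rep S (cliff S (Z i) * cliff S (Z j) * cliff S (Z k) * cliff S (Z l)) *v \<psi> g))
      + (1/8 * (\<Sum>i=1..n. \<Sum>j=1..n.
          Q_h M Q (lie_bracket M (Z i) (Z j)) (lie_bracket M (Z i) (Z j)))) *\<^sub>R \<psi> g
      + (3/8 * t\<^sup>2 * (\<Sum>i=1..n. \<Sum>j=1..n.
          Q_m M (lie_bracket M (Z i) (Z j)) (lie_bracket M (Z i) (Z j)))) *\<^sub>R \<psi> g"
      using square[of g] ordered[of 0 g] by (simp only: small scaleR_zero_right scaleR_zero_left add_0_right)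
  qed
qed

end
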